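(* Let $\sigma=\{\sigma_i\mid i\in I\}$ be a partition of the set $\mathbb{P}$ of all primes, let $G$ be a finite $\sigma$-soluble group, and let $n\ge 0$ be an integer with $|\sigma(G)|\ge n$. Assume that every $(n+1)$-maximal subgroup of $G$ is $\sigma$-subnormal in $G$. Then $G$ is $\sigma$-dispersive.
   Context: All groups are finite. $\mathbb{P}$ is the set of all primes, and $\sigma=\{\sigma_i\mid i\in I\}$ is a partition of $\mathbb{P}$, i.e. $\mathbb{P}=\bigcup_{i\in I}\sigma_i$ and $\sigma_i\cap\sigma_j=\emptyset$ for all $i\ne j$. For a finite group $G$, $\pi(G)$ denotes the set of primes dividing $|G|$, and $\sigma(G)=\{\sigma_i\mid \sigma_i\cap\pi(G)\neq\emptyset\}$. A finite group $X$ is $\sigma$-primary if $X=1$ or $|\sigma(X)|=1$. $G$ is $\sigma$-soluble if every chief factor of $G$ is $\sigma$-primary. A Hall $\sigma_i$-subgroup of $G$ is a subgroup $H$ such that every prime dividing $|H|$ lies in $\sigma_i$ and no prime dividing $|G:H|$ lies in $\sigma_i$. A set $\mathcal{H}$ of subgroups of $G$ is a complete Hall $\sigma$-set of $G$ if every non-identity member of $\mathcal{H}$ is a Hall $\sigma_i$-subgroup of $G$ for some $\sigma_i\in\sigma(G)$, and $\mathcal{H}$ contains exactly one Hall $\sigma_i$-subgroup of $G$ for every $\sigma_i\in\sigma(G)$. $G$ is a $\sigma$-group if it possesses a complete Hall $\sigma$-set. A $\sigma$-group $G$ is $\sigma$-dispersive if $G$ has a normal series $1=G_1<G_2<\cdots<G_t<G_{t+1}=G$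 (each $G_i$ normal in $G$) and a complete Hall $\sigma$-set $\{H_1,\ldots,H_t\}$ such that $G_iH_i=G_{i+1}$ for all $i=1,\ldots,t$. For $k\geq 1$, a subgroup $M_k$ of $G$ is a $k$-maximal subgroup of $G$ if there is a subgroup chain $M_k<M_{k-1}<\cdots<M_1<M_0=G$ such that $M_i$ is a maximal subgroup of $M_{i-1}$ for all $i=1,\ldots,k$. A subgroup $A$ of $G$ is $\sigma$-subnormal in $G$ if there is a subgroup chain $A=A_0\le A_1\le\cdots\le A_t=G$ such that for each $i=1,\ldots,t$ either $A_{i-1}$ is normal in $A_i$ or $A_i/(A_{i-1})_{A_i}$ is $\sigma$-primary, where $(A_{i-1})_{A_i}$ denotes the core of $A_{i-1}$ in $A_i$, i.e. the largest normal subgroup of $A_i$ contained in $A_{i-1}$. *)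

theory Defs
  imports "HOL-Algebra.Coset" "HOL-Computational_Algebra.Primes" "HOL-Library.Disjoint_Sets"
begin

text \<open>
  In the definitions below, the argument \<open>S\<close> is the set \<open>{\<sigma>\<^sub>i | i \<in> I}\<close> of all classes of the
  partition. A subgroup \<open>H\<close> of \<open>G\<close> is represented by its carrier set; the group that it forms is
  \<open>G\<lparr>carrier := H\<rparr>\<close>.
\<close>

text \<open>Some of the \<open>\<sigma>\<^sub>i\<close> may be empty.\<close>

definition partition_of_primes :: "'i set \<Rightarrow> ('i \<Rightarrow> nat set) \<Rightarrow> bool" where
  "partition_of_primes I \<sigma> \<longleftrightarrow> (\<Union>i\<in>I. \<sigma> i) = {p. prime p} \<and> disjoint_family_on \<sigma> I"

definition prime_divisors :: "('a, 'b) monoid_scheme \<Rightarrow> nat set" where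
  "prime_divisors G = {p. prime p \<and> p dvd order G}"

definition sigma_classes :: "nat set set \<Rightarrow> ('a, 'b) monoid_scheme \<Rightarrow> nat set set" where
  "sigma_classes S G = {s \<in> S. s \<inter> prime_divisors G \<noteq> {}}"

definition sigma_primary :: "nat set set \<Rightarrow> ('a, 'b) monoid_scheme \<Rightarrow> bool" where
  "sigma_primary S G \<longleftrightarrow> carrier G = {\<one>\<^bsub>G\<^esub>} \<or> card (sigma_classes S G) = 1"

text \<open>\<open>H / K\<close> is a chief factor: \<open>K < H\<close> are normal subgroups of \<open>G\<close> with no normal subgroup of \<open>G\<close>
  strictly in between, i.e.\ \<open>H / K\<close> is a minimal normal subgroup of \<open>G / K\<close>.\<close>

definition chief_factor :: "('a, 'b) monoid_scheme \<Rightarrow> 'a set \<Rightarrow> 'a set \<Rightarrow> bool" where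
  "chief_factor G H K \<longleftrightarrow>
     H \<lhd> G \<and> K \<lhd> G \<and> K \<subset> H \<and> \<not> (\<exists>N. N \<lhd> G \<and> K \<subset> N \<and> N \<subset> H)"

definition sigma_soluble :: "nat set set \<Rightarrow> ('a, 'b) monoid_scheme \<Rightarrow> bool" where
  "sigma_soluble S G \<longleftrightarrow>
     (\<forall>H K. chief_factor G H K \<longrightarrow> sigma_primary S (G\<lparr>carrier := H\<rparr> Mod K))"

definition hall_subgroup :: "nat set \<Rightarrow> 'a set \<Rightarrow> ('a, 'b) monoid_scheme \<Rightarrow> bool" where
  "hall_subgroup s H G \<longleftrightarrow>
     subgroup H G \<and>
     (\<forall>p. prime p \<and> p dvd card H \<longrightarrow> p \<in> s) \<and>
     (\<forall>p. prime p \<and> p dvd card (rcosets\<^bsub>G\<^esub> H) \<longrightarrow> p \<notin> s)"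

definition complete_hall_set ::
    "nat set set \<Rightarrow> 'a set set \<Rightarrow> ('a, 'b) monoid_scheme \<Rightarrow> bool" where
  "complete_hall_set S \<H> G \<longleftrightarrow>
     (\<forall>H\<in>\<H>. subgroup H G) \<and>
     (\<forall>H\<in>\<H>. H \<noteq> {\<one>\<^bsub>G\<^esub>} \<longrightarrow> (\<exists>s\<in>sigma_classes S G. hall_subgroup s H G)) \<and>
     (\<forall>s\<in>sigma_classes S G. \<exists>!H. H \<in> \<H> \<and> hall_subgroup s H G)"

definition sigma_group :: "nat set set \<Rightarrow> ('a, 'b) monoid_scheme \<Rightarrow> bool" where
  "sigma_group S G \<longleftrightarrow> (\<exists>\<H>. complete_hall_set S \<H> G)"

text \<open>The length \<open>t = 0\<close> is allowed; it occurs exactly for the trivial group.\<close>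

definition sigma_dispersive :: "nat set set \<Rightarrow> ('a, 'b) monoid_scheme \<Rightarrow> bool" where
  "sigma_dispersive S G \<longleftrightarrow>
     sigma_group S G \<and>
     (\<exists>(t::nat) (N :: nat \<Rightarrow> 'a set) (H :: nat \<Rightarrow> 'a set).
        N 1 = {\<one>\<^bsub>G\<^esub>} \<and> N (t + 1) = carrier G \<and>
        (\<forall>i\<in>{1..t + 1}. N i \<lhd> G) \<and>
        (\<forall>i\<in>{1..t}. N i \<subset> N (i + 1)) \<and>
        complete_hall_set S (H ` {1..t}) G \<and>
        (\<forall>i\<in>{1..t}. N i <#>\<^bsub>G\<^esub> H i = N (i + 1)))"

definition maximal_subgroup :: "'a set \<Rightarrow> ('a, 'b) monoid_scheme \<Rightarrow> bool" where
  "maximal_subgroup M G \<longleftrightarrow>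
     subgroup M G \<and> M \<noteq> carrier G \<and>
     (\<forall>K. subgroup K G \<and> M \<subseteq> K \<longrightarrow> K = M \<or> K = carrier G)"

definition k_maximal_subgroup :: "nat \<Rightarrow> 'a set \<Rightarrow> ('a, 'b) monoid_scheme \<Rightarrow> bool" where
  "k_maximal_subgroup k A G \<longleftrightarrow>
     k \<ge> 1 \<and>
     (\<exists>M :: nat \<Rightarrow> 'a set. M 0 = carrier G \<and> M k = A \<and>
        (\<forall>i\<in>{1..k}. maximal_subgroup (M i) (G\<lparr>carrier := M (i - 1)\<rparr>)))"

definition normal_core :: "'a set \<Rightarrow> ('a, 'b) monoid_scheme \<Rightarrow> 'a set" where
  "normal_core A G = (GREATEST N. N \<lhd> G \<and> N \<subseteq> A)"

definition sigma_subnormal :: "nat set set \<Rightarrow> 'a set \<Rightarrow> ('a, 'b) monoid_scheme \<Rightarrow> bool" where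
  "sigma_subnormal S A G \<longleftrightarrow>
     (\<exists>(t::nat) (B :: nat \<Rightarrow> 'a set).
        B 0 = A \<and> B t = carrier G \<and>
        (\<forall>i\<le>t. subgroup (B i) G) \<and>
        (\<forall>i\<in>{1..t}. B (i - 1) \<subseteq> B i \<and>
           (B (i - 1) \<lhd> G\<lparr>carrier := B i\<rparr> \<or>
            sigma_primary S
              (G\<lparr>carrier := B i\<rparr> Mod normal_core (B (i - 1)) (G\<lparr>carrier := B i\<rparr>)))))"

end

theory Submission
  imports Defs "HOL-Algebra.Group_Action" "HOL-Algebra.Sylow" "HOL-Algebra.Left_Coset"
    "HOL-Algebra.Multiplicative_Group"
begin

text \<open>
  The primes are divided into classes, the members of \<open>S\<close>. Call a group dispersive if it has a series of
  normal Hall subgroups whose factors belong to different classes. The proof is by induction on the order of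
  the group. The index of a maximal subgroup of a \<open>\<sigma>\<close>-soluble group belongs to a single class, so the
  hypothesis passes to maximal subgroups with \<open>n - 1\<close> in place of \<open>n\<close>. In a counterexample \<open>X\<close> of least order
  all proper subgroups are therefore dispersive, and \<open>X\<close> has no nontrivial normal Hall subgroup for any
  class, because it would have a complement, and a dispersive series of the complement could be extended
  (\<open>dispersive_of_normal_hall\<close>).

  Two facts on \<open>\<sigma>\<close>-subnormality are needed. First, a \<open>\<sigma>\<close>-subnormal subgroup meets each Hall subgroup of the
  group in a Hall subgroup (\<open>class_subnormal_hall\<close>), so if its order belongs to a class, it lies in all the
  conjugates of a Hall subgroup for this class. Secondly, not only the \<open>(n + 1)\<close>-maximal subgroups but also
  the \<open>k\<close>-maximal ones for all \<open>k > n\<close> are \<open>\<sigma>\<close>-subnormal (\<open>long_maximal_chains_subnormal\<close>); the reason is that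
  a group whose maximal subgroups are all \<open>\<sigma>\<close>-subnormal is the direct product of its Hall subgroups for the
  classes. So a Hall subgroup \<open>R\<close> that is not normal is joined to \<open>X\<close> only by maximal chains of length at
  most \<open>n\<close>.

  Let \<open>K\<close> be a proper normal subgroup of \<open>X\<close> whose index belongs to a class \<open>a\<close>. The first nontrivial term
  \<open>Q\<close> of a dispersive series of \<open>K\<close> belongs to \<open>a\<close> as well, since \<open>Q\<close> would be a normal Hall subgroup of \<open>X\<close>
  otherwise. Let \<open>K / E\<close> be the last factor, \<open>b\<close> its class and \<open>R\<close> a complement of \<open>E\<close> in \<open>K\<close>. A maximal
  chain from \<open>R\<close> to \<open>X\<close> through \<open>R Q\<close> and \<open>K\<close> has at least as many steps as there are classes, because \<open>a\<close>
  accounts for two of them. As this number is at least \<open>n\<close>, no step can be refined: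
  \<open>R\<close> is maximal in \<open>R Q\<close>, and the maximal subgroups of \<open>R\<close> are \<open>\<sigma>\<close>-subnormal and hence lie in the normal
  core of \<open>R\<close>. So \<open>R\<close> is an abelian group of prime power order with a single maximal subgroup. If \<open>Q \<noteq> E\<close>, a
  complement of \<open>E\<close> modulo \<open>Q\<close> is a proper subgroup, and that it is dispersive leads to a contradiction
  (\<open>E_eq_Q\<close>). If \<open>Q = E\<close>, then \<open>X = Q R U\<close> with \<open>R U\<close> a Frobenius group with factors of prime order that both
  act irreducibly on the abelian group \<open>Q\<close>, and \<open>Frobenius_group_action_trivial\<close> is contradicted.

  The conjugacy of Hall subgroups for a class is not elementary (it depends on the solubility of groups of
  odd order). The Frattini argument is therefore only applied to Sylow subgroups and to complements of
  abelian normal subgroups of coprime index; the existence of complements is the Schur-Zassenhaus theorem.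
  All groups except quotients are subgroups of one ambient group, and divisibility of orders and indices
  replaces quotients wherever possible.
\<close>

section \<open>Numbers all of whose prime divisors lie in a given set\<close>

definition pi_number :: "nat set \<Rightarrow> nat \<Rightarrow> bool" where
  "pi_number s n \<longleftrightarrow> n > 0 \<and> (\<forall>p. prime p \<longrightarrow> p dvd n \<longrightarrow> p \<in> s)"

lemma pi_number_pos: "pi_number s n \<Longrightarrow> n > 0"
  by (simp add: pi_number_def)

lemma pi_number_1 [simp]: "pi_number s (Suc 0)"
  by (auto simp: pi_number_def)

lemma pi_number_mult: "pi_number s (m * n) \<longleftrightarrow> pi_number s m \<and> pi_number s n"
  by (auto simp: pi_number_def prime_dvd_mult_iff)

lemma pi_number_dvd: "pi_number s n \<Longrightarrow> m dvd n \<Longrightarrow> pi_number s m"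
  unfolding pi_number_def by (meson dvd_pos_nat dvd_trans)

lemma pi_number_mono: "pi_number s n \<Longrightarrow> s \<subseteq> t \<Longrightarrow> pi_number t n"
  by (auto simp: pi_number_def)

lemma pi_number_coprime: "pi_number s m \<Longrightarrow> pi_number (- s) n \<Longrightarrow> coprime m n"
proof (rule ccontr)
  assume a: "pi_number s m" "pi_number (- s) n" "\<not> coprime m n"
  then obtain p where "prime p" "p dvd m" "p dvd n"
    by (metis gcd_nat.boundedE coprime_iff_gcd_eq_1 prime_factor_nat)
  with a show False by (auto simp: pi_number_def)
qed

lemma pi_number_both: "pi_number s m \<Longrightarrow> pi_number (- s) m \<Longrightarrow> m = 1"
  using pi_number_coprime[of s m m] by simp

lemma pi_number_both_disjoint: "pi_number s m \<Longrightarrow> pi_number t m \<Longrightarrow> s \<inter> t = {} \<Longrightarrow> m = 1"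
  by (rule pi_number_both[of s]) (auto elim: pi_number_mono)

lemma pi_number_prime_power: "prime p \<Longrightarrow> pi_number {p} (p ^ k)"
  unfolding pi_number_def
  by (metis prime_dvd_power primes_dvd_imp_eq prime_gt_0_nat singletonI zero_less_power)

lemma pi_number_cofactor:
  assumes "m * n = m' * n'" "pi_number s m" "pi_number s m'" "pi_number (- s) n" "pi_number (- s) n'"
  shows "m = m'" "n = n'"
proof -
  have "coprime m n'" "coprime m' n" using assms pi_number_coprime by blast+
  then have "m dvd m'" "m' dvd m" using assms(1)
    by (metis coprime_dvd_mult_left_iff dvd_triv_left)+
  then show "m = m'" by (rule dvd_antisym)
  then show "n = n'" using assms(1) pi_number_pos[OF assms(2)] by simp
qed

definition index :: "'a set \<Rightarrow> 'a set \<Rightarrow> nat" where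
  "index X N = card X div card N"

section \<open>Subgroups of a finite group\<close>

locale finite_group = group G for G (structure) +
  assumes finite_carrier: "finite (carrier G)"

context group
begin

lemma word_cancel [simp]:
  "x \<in> carrier G \<Longrightarrow> y \<in> carrier G \<Longrightarrow> inv x \<otimes> (x \<otimes> y) = y"
  "x \<in> carrier G \<Longrightarrow> y \<in> carrier G \<Longrightarrow> x \<otimes> (inv x \<otimes> y) = y"
  by (simp_all add: m_assoc[symmetric])

text \<open>Together with \<open>word_cancel\<close> these rules reduce words to their normal form in the free group.\<close>

lemmas word = m_assoc inv_mult_group

definition conj_by :: "'a \<Rightarrow> 'a set \<Rightarrow> 'a set" where
  "conj_by x A = (\<lambda>a. x \<otimes> a \<otimes> inv x) ` A"

text \<open>Normality, normalisers, centralisers and indices are stated for subsets of one ambient group, so that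
  a subgroup of a subgroup is just a subgroup.\<close>

definition normal_in :: "'a set \<Rightarrow> 'a set \<Rightarrow> bool" where
  "normal_in N X \<longleftrightarrow>
     subgroup N G \<and> subgroup X G \<and> N \<subseteq> X \<and> (\<forall>x\<in>X. \<forall>y\<in>N. x \<otimes> y \<otimes> inv x \<in> N)"

definition normalizer_in :: "'a set \<Rightarrow> 'a set \<Rightarrow> 'a set" where
  "normalizer_in X A = {x \<in> X. conj_by x A = A}"

lemma mem_carrier: "subgroup X G \<Longrightarrow> x \<in> X \<Longrightarrow> x \<in> carrier G"
  by (rule subgroup.mem_carrier)

lemmas sg = subgroup.m_closed subgroup.m_inv_closed subgroup.one_closed

lemma normal_inD:
  assumes "normal_in N X"
  shows "subgroup N G" "subgroup X G" "N \<subseteq> X"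
    and "\<And>x y. x \<in> X \<Longrightarrow> y \<in> N \<Longrightarrow> x \<otimes> y \<otimes> inv x \<in> N"
  using assms by (auto simp: normal_in_def)

lemma normal_inD2:
  assumes "normal_in N X" "x \<in> X" "y \<in> N"
  shows "inv x \<otimes> y \<otimes> x \<in> N"
  using normal_inD(4)[OF assms(1), of "inv x" y] assms normal_inD(1,2)[OF assms(1)]
  by (simp add: sg mem_carrier[OF normal_inD(2)[OF assms(1)]])

lemma normal_inI:
  assumes "subgroup N G" "subgroup X G" "N \<subseteq> X" "\<And>x y. x \<in> X \<Longrightarrow> y \<in> N \<Longrightarrow> x \<otimes> y \<otimes> inv x \<in> N"
  shows "normal_in N X"
  using assms by (auto simp: normal_in_def)

lemma subgroup_in_iff:
  assumes "subgroup X G"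
  shows "subgroup A (G\<lparr>carrier := X\<rparr>) \<longleftrightarrow> subgroup A G \<and> A \<subseteq> X"
proof
  assume "subgroup A (G\<lparr>carrier := X\<rparr>)"
  then show "subgroup A G \<and> A \<subseteq> X"
    using incl_subgroup[OF assms] subgroup.subset by fastforce
next
  assume "subgroup A G \<and> A \<subseteq> X"
  then show "subgroup A (G\<lparr>carrier := X\<rparr>)" using assms subgroup_incl by blast
qed

lemma normal_in_iff:
  assumes "subgroup X G"
  shows "N \<lhd> G\<lparr>carrier := X\<rparr> \<longleftrightarrow> normal_in N X"
proof -
  interpret X: group "G\<lparr>carrier := X\<rparr>" by (rule subgroup.subgroup_is_group[OF assms group_axioms])
  show ?thesis
    unfolding X.normal_inv_iff subgroup_in_iff[OF assms] normal_in_def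
    using assms m_inv_consistent[OF assms] by auto
qed

lemma normal_iff: "N \<lhd> G \<longleftrightarrow> normal_in N (carrier G)"
  using normal_in_iff[OF subgroup_self, of N] by simp

lemma normal_in_restrict:
  assumes "normal_in N X" "subgroup Y G" "Y \<subseteq> X"
  shows "normal_in (N \<inter> Y) Y"
  using assms normal_inD[OF assms(1)] subgroups_Inter_pair[of N Y]
  by (intro normal_inI) (auto simp: sg)

lemma normal_in_between: "normal_in N X \<Longrightarrow> subgroup Y G \<Longrightarrow> N \<subseteq> Y \<Longrightarrow> Y \<subseteq> X \<Longrightarrow> normal_in N Y"
  by (auto simp: normal_in_def)

lemma normal_in_Int:
  assumes "normal_in N X" "normal_in M X" shows "normal_in (N \<inter> M) X"
  using normal_inD[OF assms(1)] normal_inD[OF assms(2)] subgroups_Inter_pair[of N M]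
  by (intro normal_inI) auto

lemma normal_in_self: "subgroup X G \<Longrightarrow> normal_in X X"
  by (auto simp: normal_in_def sg)

lemma normal_in_triv: "subgroup X G \<Longrightarrow> normal_in {\<one>} X"
  by (auto simp: normal_in_def triv_subgroup sg mem_carrier)

lemma conj_by_subset: "subgroup X G \<Longrightarrow> x \<in> X \<Longrightarrow> A \<subseteq> X \<Longrightarrow> conj_by x A \<subseteq> X"
  by (auto simp: conj_by_def sg)

lemma conj_by_carrier: "x \<in> carrier G \<Longrightarrow> A \<subseteq> carrier G \<Longrightarrow> conj_by x A \<subseteq> carrier G"
  by (auto simp: conj_by_def)

lemma conj_by_mult:
  assumes "x \<in> carrier G" "y \<in> carrier G" "A \<subseteq> carrier G"
  shows "conj_by (x \<otimes> y) A = conj_by x (conj_by y A)"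
  unfolding conj_by_def image_image
  by (rule image_cong) (use assms in \<open>auto simp: word subset_eq\<close>)

lemma conj_by_one: "A \<subseteq> carrier G \<Longrightarrow> conj_by \<one> A = A"
  by (auto simp: conj_by_def subset_eq image_iff)

lemma conj_by_inv:
  assumes "x \<in> carrier G" "A \<subseteq> carrier G"
  shows "conj_by (inv x) (conj_by x A) = A" "conj_by x (conj_by (inv x) A) = A"
  using assms conj_by_mult[of "inv x" x A] conj_by_mult[of x "inv x" A] by (simp_all add: conj_by_one)

lemma conj_by_inj: "x \<in> carrier G \<Longrightarrow> A \<subseteq> carrier G \<Longrightarrow> inj_on (\<lambda>a. x \<otimes> a \<otimes> inv x) A"
  by (rule inj_onI) (auto simp: subset_eq)

lemma card_conj_by: "x \<in> carrier G \<Longrightarrow> A \<subseteq> carrier G \<Longrightarrow> card (conj_by x A) = card A"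
  unfolding conj_by_def by (rule card_image) (rule conj_by_inj)

lemma conj_by_mono: "A \<subseteq> B \<Longrightarrow> conj_by x A \<subseteq> conj_by x B"
  by (auto simp: conj_by_def)

lemma subgroup_conj_by:
  assumes "subgroup A G" "x \<in> carrier G"
  shows "subgroup (conj_by x A) G"
proof (rule subgroupI)
  show "conj_by x A \<subseteq> carrier G" using assms subgroup.subset conj_by_carrier by blast
  show "conj_by x A \<noteq> {}" using subgroup.one_closed[OF assms(1)] by (auto simp: conj_by_def)
next
  fix a assume "a \<in> conj_by x A"
  then obtain y where y: "y \<in> A" "a = x \<otimes> y \<otimes> inv x" by (auto simp: conj_by_def)
  then have "inv a = x \<otimes> inv y \<otimes> inv x"
    using assms by (simp add: word mem_carrier)
  then show "inv a \<in> conj_by x A" using y assms by (auto simp: conj_by_def sg)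
next
  fix a b assume "a \<in> conj_by x A" "b \<in> conj_by x A"
  then obtain y z where y: "y \<in> A" "a = x \<otimes> y \<otimes> inv x" "z \<in> A" "b = x \<otimes> z \<otimes> inv x"
    by (auto simp: conj_by_def)
  then have "a \<otimes> b = x \<otimes> (y \<otimes> z) \<otimes> inv x"
    using assms by (simp add: word mem_carrier)
  then show "a \<otimes> b \<in> conj_by x A" using y assms by (auto simp: conj_by_def sg)
qed

lemma normal_in_conj_by:
  assumes "normal_in N X" "x \<in> X" shows "conj_by x N = N"
proof
  note n = normal_inD[OF assms(1)]
  have x: "x \<in> carrier G" using n assms mem_carrier by blast
  show 1: "conj_by x N \<subseteq> N" using n assms by (auto simp: conj_by_def)
  show "N \<subseteq> conj_by x N"
  proof
    fix y assume y: "y \<in> N"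
    have "inv x \<otimes> y \<otimes> x \<in> N" by (rule normal_inD2[OF assms(1,2) y])
    moreover have "y = x \<otimes> (inv x \<otimes> y \<otimes> x) \<otimes> inv x"
      using x y n mem_carrier by (simp add: word)
    ultimately show "y \<in> conj_by x N" unfolding conj_by_def by blast
  qed
qed

lemma normal_in_conj_iff:
  "normal_in N X \<longleftrightarrow> subgroup N G \<and> subgroup X G \<and> N \<subseteq> X \<and> (\<forall>x\<in>X. conj_by x N = N)"
proof
  show "normal_in N X" if "subgroup N G \<and> subgroup X G \<and> N \<subseteq> X \<and> (\<forall>x\<in>X. conj_by x N = N)"
    using that unfolding normal_in_def conj_by_def by blast
qed (simp add: normal_in_conj_by normal_inD)

lemma subgroup_normalizer_in:
  assumes "subgroup X G" "A \<subseteq> X"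
  shows "subgroup (normalizer_in X A) G"
proof (rule subgroupI)
  have A: "A \<subseteq> carrier G" using assms subgroup.subset by blast
  show "normalizer_in X A \<subseteq> carrier G"
    using subgroup.subset[OF assms(1)] by (auto simp: normalizer_in_def)
  show "normalizer_in X A \<noteq> {}"
    using assms conj_by_one[OF A] by (auto simp: normalizer_in_def intro: sg)
  fix a assume a: "a \<in> normalizer_in X A"
  then have ac: "a \<in> carrier G" using assms by (auto simp: normalizer_in_def mem_carrier)
  show "inv a \<in> normalizer_in X A"
    using a conj_by_inv(1)[OF ac A] assms(1) by (auto simp: normalizer_in_def sg)
  fix b assume b: "b \<in> normalizer_in X A"
  then have bc: "b \<in> carrier G" using assms by (auto simp: normalizer_in_def mem_carrier)
  show "a \<otimes> b \<in> normalizer_in X A"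
    using a b conj_by_mult[OF ac bc A] assms(1) by (auto simp: normalizer_in_def sg)
qed

lemma normalizer_in_subset: "normalizer_in X A \<subseteq> X"
  by (auto simp: normalizer_in_def)

lemma normal_in_normalizer:
  assumes "subgroup X G" "subgroup A G" "A \<subseteq> X"
  shows "normal_in A (normalizer_in X A)"
  unfolding normal_in_conj_iff
  using assms normal_in_conj_by[OF normal_in_self[OF assms(2)]] subgroup_normalizer_in
  by (auto simp: normalizer_in_def)

lemma normalizer_in_eq_iff:
  assumes "subgroup X G" "subgroup A G" "A \<subseteq> X"
  shows "normalizer_in X A = X \<longleftrightarrow> normal_in A X"
  using assms by (auto simp: normal_in_conj_iff normalizer_in_def)

lemma subgroup_set_mult_normalized:
  assumes "subgroup A G" "subgroup B G" "\<And>a b. a \<in> A \<Longrightarrow> b \<in> B \<Longrightarrow> a \<otimes> b \<otimes> inv a \<in> B"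
  shows "subgroup (A <#> B) G"
proof (rule subgroupI)
  have A: "A \<subseteq> carrier G" and B: "B \<subseteq> carrier G" using assms subgroup.subset by blast+
  show "A <#> B \<subseteq> carrier G" using A B by (auto simp: set_mult_def)
  show "A <#> B \<noteq> {}" using assms by (auto simp: set_mult_def intro: sg)
  fix x assume "x \<in> A <#> B"
  then obtain a b where x: "a \<in> A" "b \<in> B" "x = a \<otimes> b" by (auto simp: set_mult_def)
  have c: "a \<in> carrier G" "b \<in> carrier G" using x A B by auto
  have "inv a \<otimes> (a \<otimes> inv b \<otimes> inv a) \<in> A <#> B"
    unfolding set_mult_def using x assms(1,2) assms(3)[OF x(1), of "inv b"] by (blast intro: sg)
  then show "inv x \<in> A <#> B" using c x by (simp add: word)
  fix y assume "y \<in> A <#> B"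
  then obtain a' b' where y: "a' \<in> A" "b' \<in> B" "y = a' \<otimes> b'" by (auto simp: set_mult_def)
  have c': "a' \<in> carrier G" "b' \<in> carrier G" using y A B by auto
  have 1: "inv a' \<otimes> b \<otimes> a' \<in> B" using assms(3)[of "inv a'" b] x y c' assms(1) by (simp add: sg)
  have 2: "x \<otimes> y = (a \<otimes> a') \<otimes> (inv a' \<otimes> b \<otimes> a' \<otimes> b')" using x y c c' by (simp add: word)
  show "x \<otimes> y \<in> A <#> B"
    unfolding 2 set_mult_def using x y 1 assms(1,2) by (blast intro: sg)
qed

lemma set_mult_subset: "subgroup X G \<Longrightarrow> A \<subseteq> X \<Longrightarrow> B \<subseteq> X \<Longrightarrow> A <#> B \<subseteq> X"
  by (auto simp: set_mult_def subset_eq intro: sg)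

lemma subset_set_mult:
  assumes "subgroup A G" "subgroup B G"
  shows "A \<subseteq> A <#> B" "B \<subseteq> A <#> B"
proof -
  show "A \<subseteq> A <#> B"
  proof
    fix a assume "a \<in> A"
    then have "a \<otimes> \<one> \<in> A <#> B" unfolding set_mult_def using assms by (blast intro: sg)
    then show "a \<in> A <#> B" using \<open>a \<in> A\<close> assms mem_carrier by simp
  qed
  show "B \<subseteq> A <#> B"
  proof
    fix b assume "b \<in> B"
    then have "\<one> \<otimes> b \<in> A <#> B" unfolding set_mult_def using assms by (blast intro: sg)
    then show "b \<in> A <#> B" using \<open>b \<in> B\<close> assms mem_carrier by simp
  qed
qed

lemma subgroup_set_mult:
  assumes "subgroup A G" "A \<subseteq> X" "normal_in N X"
  shows "subgroup (A <#> N) G" "A <#> N \<subseteq> X" "A \<subseteq> A <#> N" "N \<subseteq> A <#> N" "normal_in N (A <#> N)"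
proof -
  note n = normal_inD[OF assms(3)]
  show 1: "subgroup (A <#> N) G"
    using n assms by (intro subgroup_set_mult_normalized) auto
  show 2: "A <#> N \<subseteq> X" using n assms by (intro set_mult_subset) auto
  show "A \<subseteq> A <#> N" and 3: "N \<subseteq> A <#> N" using subset_set_mult assms(1) n(1) by auto
  show "normal_in N (A <#> N)" using normal_in_between[OF assms(3) 1 3 2] .
qed

lemma conj_by_set_mult:
  assumes "x \<in> carrier G" "A \<subseteq> carrier G" "B \<subseteq> carrier G"
  shows "conj_by x (A <#> B) = conj_by x A <#> conj_by x B"
proof -
  have e: "x \<otimes> (a \<otimes> b) \<otimes> inv x = (x \<otimes> a \<otimes> inv x) \<otimes> (x \<otimes> b \<otimes> inv x)" if "a \<in> A" "b \<in> B" for a b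
    using that assms by (simp add: word subset_eq)
  have "conj_by x (A <#> B) = (\<Union>a\<in>A. \<Union>b\<in>B. {x \<otimes> (a \<otimes> b) \<otimes> inv x})"
    by (auto simp: conj_by_def set_mult_def)
  also have "\<dots> = (\<Union>a\<in>A. \<Union>b\<in>B. {(x \<otimes> a \<otimes> inv x) \<otimes> (x \<otimes> b \<otimes> inv x)})"
    by (intro SUP_cong refl) (simp add: e)
  finally show ?thesis by (simp add: conj_by_def set_mult_def)
qed

lemma normal_in_set_mult:
  assumes "normal_in M X" "normal_in N X"
  shows "normal_in (M <#> N) X"
proof -
  note m = normal_inD[OF assms(1)] and n = normal_inD[OF assms(2)]
  note s = subgroup_set_mult[OF m(1,3) assms(2)]
  have "conj_by x (M <#> N) = M <#> N" if x: "x \<in> X" for x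
    using conj_by_set_mult[OF mem_carrier[OF m(2) x] subgroup.subset[OF m(1)] subgroup.subset[OF n(1)]]
      normal_in_conj_by[OF assms(1) x] normal_in_conj_by[OF assms(2) x] by simp
  then show ?thesis unfolding normal_in_conj_iff using s(1,2) m(2) by blast
qed

lemma Dedekind_law:
  assumes "subgroup C G" "A \<subseteq> C" "B \<subseteq> carrier G"
  shows "(A <#> B) \<inter> C = A <#> (B \<inter> C)"
proof -
  have "b \<in> C" if "a \<in> A" "b \<in> B" "a \<otimes> b \<in> C" for a b
  proof -
    have "inv a \<otimes> (a \<otimes> b) \<in> C" using that assms by (meson sg subset_eq)
    then show ?thesis using that assms mem_carrier by (metis subsetD word_cancel(1))
  qed
  then show ?thesis using assms by (auto simp: set_mult_def subset_eq intro: sg)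
qed

end

context finite_group
begin

lemma finite_subgroup: "subgroup X G \<Longrightarrow> finite X"
  using finite_carrier subgroup.subset finite_subset by blast

lemma card_pos: "subgroup X G \<Longrightarrow> card X > 0"
  using finite_subgroup[of X] subgroup.one_closed[of X G] by (auto simp: card_gt_0_iff)

lemma card_dvd:
  assumes "subgroup A G" "subgroup B G" "A \<subseteq> B"
  shows "card A dvd card B"
proof -
  have "subgroup A (G\<lparr>carrier := B\<rparr>)" using assms subgroup_in_iff by blast
  from group.lagrange[OF subgroup.subgroup_is_group[OF assms(2) group_axioms] this]
  show ?thesis by (auto simp: order_def intro: dvdI[of _ _ "_ :: nat"] dest: sym)
qed

lemma card_index:
  assumes "subgroup A G" "subgroup B G" "A \<subseteq> B"
  shows "card B = card A * index B A"
  using card_dvd[OF assms] by (simp add: index_def)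

lemma index_pos: "subgroup A G \<Longrightarrow> subgroup B G \<Longrightarrow> A \<subseteq> B \<Longrightarrow> index B A > 0"
  using card_index[of A B] card_pos[of B] by (cases "index B A = 0") auto

lemma index_trans:
  assumes "subgroup A G" "subgroup B G" "subgroup C G" "A \<subseteq> B" "B \<subseteq> C"
  shows "index C A = index C B * index B A"
proof -
  have "card A * index C A = card A * (index C B * index B A)"
    using card_index[of A B] card_index[of B C] card_index[of A C] assms by (simp add: ac_simps)
  then show ?thesis using card_pos[OF assms(1)] by simp
qed

lemma index_dvd:
  assumes "subgroup A G" "subgroup B G" "subgroup C G" "A \<subseteq> B" "B \<subseteq> C"
  shows "index B A dvd index C A" "index C B dvd index C A"
  using index_trans[OF assms] by simp_all

lemma index_triv: "index X {\<one>} = card X"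
  by (simp add: index_def)

lemma index_dvd_card: "subgroup A G \<Longrightarrow> subgroup B G \<Longrightarrow> A \<subseteq> B \<Longrightarrow> index B A dvd card B"
  using card_index[of A B] by (metis dvd_triv_right)

lemma index_eq_1:
  assumes "subgroup A G" "subgroup B G" "A \<subseteq> B"
  shows "index B A = 1 \<longleftrightarrow> A = B"
proof
  assume "index B A = 1"
  then show "A = B"
    using card_index[OF assms] assms finite_subgroup card_subset_eq by (metis mult.right_neutral)
next
  assume "A = B" then show "index B A = 1" using card_pos[OF assms(1)] by (simp add: index_def)
qed

lemma subgroup_eqI_card:
  "subgroup A G \<Longrightarrow> subgroup B G \<Longrightarrow> A \<subseteq> B \<Longrightarrow> card A = card B \<Longrightarrow> A = B"
  by (simp add: card_subset_eq finite_subgroup)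

lemma card_1_iff: "subgroup A G \<Longrightarrow> card A = 1 \<longleftrightarrow> A = {\<one>}"
  using subgroup.one_closed[of A G] by (auto simp: card_1_singleton_iff)

lemma index_self: "subgroup A G \<Longrightarrow> index A A = 1"
  using index_eq_1[of A A] by simp

lemma conj_by_eqI:
  assumes "subgroup A G" "x \<in> carrier G" "conj_by x A \<subseteq> A"
  shows "conj_by x A = A"
  using assms card_conj_by[OF assms(2) subgroup.subset[OF assms(1)]] finite_subgroup[OF assms(1)]
  by (simp add: card_subset_eq)

lemma nontrivial_prime_divisor:
  assumes "subgroup A G" "A \<noteq> {\<one>}"
  obtains p where "prime p" "p dvd card A"
  using assms card_1_iff[OF assms(1)] prime_factor_nat[of "card A"] by auto

lemma card_set_mult:
  assumes A: "subgroup A G" and B: "subgroup B G"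
  shows "card (A <#> B) * card (A \<inter> B) = card A * card B"
proof -
  let ?D = "A \<inter> B" and ?f = "\<lambda>(a, b). a \<otimes> b"
  have D: "subgroup ?D G" using assms subgroups_Inter_pair by blast
  have img: "A <#> B = ?f ` (A \<times> B)" by (auto simp: set_mult_def)
  have fib: "card ((A \<times> B) \<inter> ?f -` {x}) = card ?D" if "x \<in> A <#> B" for x
  proof -
    obtain a b where x: "a \<in> A" "b \<in> B" "x = a \<otimes> b" using \<open>x \<in> A <#> B\<close> by (auto simp: set_mult_def)
    have c: "a \<in> carrier G" "b \<in> carrier G" using x A B mem_carrier by blast+
    have Dc: "d \<in> carrier G" if "d \<in> ?D" for d using that A mem_carrier by blast
    have "bij_betw (\<lambda>d. (a \<otimes> d, inv d \<otimes> b)) ?D ((A \<times> B) \<inter> ?f -` {x})"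
    proof (rule bij_betwI')
      fix d d' assume "d \<in> ?D" "d' \<in> ?D"
      then show "((a \<otimes> d, inv d \<otimes> b) = (a \<otimes> d', inv d' \<otimes> b)) = (d = d')" using c Dc by auto
    next
      fix d assume d: "d \<in> ?D"
      then show "(a \<otimes> d, inv d \<otimes> b) \<in> (A \<times> B) \<inter> ?f -` {x}"
        using c Dc[OF d] x A B by (auto simp: word intro: sg)
    next
      fix y assume y: "y \<in> (A \<times> B) \<inter> ?f -` {x}"
      obtain a' b' where ab: "y = (a', b')" by force
      have m: "a' \<in> A" "b' \<in> B" "a' \<otimes> b' = a \<otimes> b" using y ab x by auto
      have c': "a' \<in> carrier G" "b' \<in> carrier G" using m A B mem_carrier by blast+
      have e: "inv a \<otimes> a' = b \<otimes> inv b'"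
      proof -
        have "inv a \<otimes> a' = inv a \<otimes> (a' \<otimes> b') \<otimes> inv b'" using c c' by (simp add: word)
        also have "\<dots> = b \<otimes> inv b'" unfolding m(3) using c c' by (simp add: word)
        finally show ?thesis .
      qed
      have "inv a \<otimes> a' \<in> A" "b \<otimes> inv b' \<in> B" using m x A B by (auto intro: sg)
      then have "inv a \<otimes> a' \<in> ?D" using e by simp
      moreover have "y = (a \<otimes> (inv a \<otimes> a'), inv (inv a \<otimes> a') \<otimes> b)"
      proof -
        have "inv (inv a \<otimes> a') \<otimes> b = b'" unfolding e using c c' by (simp add: word)
        then show ?thesis using ab c c' by simp
      qed
      ultimately show "\<exists>d\<in>?D. y = (a \<otimes> d, inv d \<otimes> b)" by blast
    qed
    from bij_betw_same_card[OF this] show ?thesis by (rule sym)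
  qed
  have fin: "finite (A \<times> B)" using A B finite_subgroup by simp
  have "card (A \<times> B) = (\<Sum>x\<in>?f ` (A \<times> B). card {y \<in> A \<times> B. ?f y = x})"
    using sum.image_gen[OF fin, of "\<lambda>_. 1::nat" ?f] by simp
  also have "\<dots> = (\<Sum>x\<in>A <#> B. card ?D)"
    unfolding img[symmetric]
  proof (rule sum.cong[OF refl])
    fix x assume "x \<in> A <#> B"
    moreover have "{y \<in> A \<times> B. ?f y = x} = (A \<times> B) \<inter> ?f -` {x}" by auto
    ultimately show "card {y \<in> A \<times> B. ?f y = x} = card ?D" using fib by simp
  qed
  finally have "card A * card B = (\<Sum>x\<in>A <#> B. card ?D)" unfolding card_cartesian_product .
  then show ?thesis unfolding sum_constant by simp
qed

lemma index_Int_factor: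
  assumes "subgroup A G" "subgroup B G" "A <#> B = X" "subgroup X G" "A \<subseteq> X"
  shows "index X A = index B (A \<inter> B)"
proof -
  have D: "subgroup (A \<inter> B) G" using assms subgroups_Inter_pair by blast
  have "card A * card (A \<inter> B) * index X A = card A * card (A \<inter> B) * index B (A \<inter> B)"
    using card_set_mult[OF assms(1,2)] card_index[OF D assms(2)] card_index[OF assms(1,4,5)] assms(3)
    by (simp add: ac_simps)
  then show ?thesis using card_pos[OF D] card_pos[OF assms(1)] by simp
qed

lemma coprime_factorisation:
  assumes "subgroup A G" "subgroup B G" "subgroup X G" "A \<subseteq> X" "B \<subseteq> X"
    and "coprime (card A) (card B)" "card A * card B = card X"
  shows "A \<inter> B = {\<one>}" "A <#> B = X"
proof -
  have D: "subgroup (A \<inter> B) G" using assms subgroups_Inter_pair by blast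
  have "card (A \<inter> B) dvd card A" "card (A \<inter> B) dvd card B"
    using card_dvd[OF D assms(1)] card_dvd[OF D assms(2)] by auto
  then have 1: "card (A \<inter> B) = 1" using assms(6) by (metis coprime_common_divisor_nat)
  then show "A \<inter> B = {\<one>}" using card_1_iff[OF D] by simp
  have "card (A <#> B) = card X" using card_set_mult[OF assms(1,2)] 1 assms(7) by simp
  then show "A <#> B = X"
    using set_mult_subset[OF assms(3-5)] finite_subgroup[OF assms(3)] by (simp add: card_subset_eq)
qed

end

section \<open>Sylow subgroups and the Frattini argument\<close>

text \<open>The orbits of a \<open>p\<close>-group have lengths that are powers of \<open>p\<close>; one of them has length \<open>1\<close> if \<open>p\<close> does not
  divide the size of the set.\<close>

lemma (in group) prime_power_group_fixed_point:
  assumes P: "subgroup P G" "card P = p ^ k" and p: "prime p"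
    and E: "finite E" "\<not> p dvd card E"
    and closed: "\<And>g x. g \<in> P \<Longrightarrow> x \<in> E \<Longrightarrow> f g x \<in> E"
    and one: "\<And>x. x \<in> E \<Longrightarrow> f \<one> x = x"
    and mult: "\<And>g h x. g \<in> P \<Longrightarrow> h \<in> P \<Longrightarrow> x \<in> E \<Longrightarrow> f (g \<otimes> h) x = f g (f h x)"
  shows "\<exists>x\<in>E. \<forall>g\<in>P. f g x = x"
proof -
  let ?H = "G\<lparr>carrier := P\<rparr>" and ?\<phi> = "\<lambda>g. \<lambda>x\<in>E. f g x"
  have H: "group ?H" by (rule subgroup.subgroup_is_group[OF P(1) group_axioms])
  have inv: "f (inv g) (f g x) = x" "f g (f (inv g) x) = x" if "g \<in> P" "x \<in> E" for g x
    using mult[of "inv g" g x] mult[of g "inv g" x] that one P(1) by (simp_all add: sg mem_carrier)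
  have bij: "?\<phi> g \<in> Bij E" if g: "g \<in> P" for g
  proof -
    have "bij_betw (f g) E E"
      by (rule bij_betwI[where g = "f (inv g)"])
         (use g inv closed P(1) in \<open>auto simp: sg\<close>)
    then show ?thesis by (simp add: Bij_def cong: bij_betw_cong)
  qed
  have "?\<phi> \<in> hom ?H (BijGroup E)"
  proof (rule homI)
    fix g h assume "g \<in> carrier ?H" "h \<in> carrier ?H"
    then show "?\<phi> (g \<otimes>\<^bsub>?H\<^esub> h) = ?\<phi> g \<otimes>\<^bsub>BijGroup E\<^esub> ?\<phi> h"
      using bij mult closed by (auto simp: BijGroup_def compose_def)
  qed (use bij in \<open>auto simp: BijGroup_def\<close>)
  then interpret A: group_action ?H E ?\<phi>
    using H group_BijGroup[of E]
    by (simp add: group_action_def group_hom_def group_hom_axioms_def)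
  have "card E = (\<Sum>orb\<in>orbits ?H E ?\<phi>. card orb)"
    using A.disjoint_sum[OF E(1), of "\<lambda>_. 1::nat"] by simp
  then obtain orb where orb: "orb \<in> orbits ?H E ?\<phi>" "\<not> p dvd card orb"
    using E(2) by (metis dvd_sum)
  then obtain x where x: "x \<in> E" "orb = orbit ?H ?\<phi> x" by (auto simp: orbits_def)
  have "card orb dvd p ^ k"
    using A.orbit_stabilizer_theorem[OF x(1)] by (intro dvdI[of _ _ "card (stabilizer ?H ?\<phi> x)"]) (simp add: x(2) P(2) order_def)
  then obtain j where j: "card orb = p ^ j" using divides_primepow_nat[OF p] by blast
  then have "card orb = 1" using orb(2) by (cases j) auto
  then obtain y where y: "orb = {y}" by (auto simp: card_1_singleton_iff)
  have "f g x = y" if "g \<in> P" for g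
    using that y x by (auto simp: orbit_def)
  then have "\<forall>g\<in>P. f g x = x" using one[OF x(1)] P(1) by (metis sg(3))
  then show ?thesis using x(1) by blast
qed

context finite_group
begin

definition sylow_of :: "nat \<Rightarrow> 'a set \<Rightarrow> 'a set \<Rightarrow> bool" where
  "sylow_of p P X \<longleftrightarrow>
     prime p \<and> subgroup P G \<and> P \<subseteq> X \<and> (\<exists>k. card P = p ^ k) \<and> \<not> p dvd index X P"

lemma sylow_ofD:
  assumes "sylow_of p P X"
  shows "prime p" "subgroup P G" "P \<subseteq> X" "\<exists>k. card P = p ^ k" "\<not> p dvd index X P"
    "pi_number {p} (card P)"
  using assms by (auto simp: sylow_of_def pi_number_prime_power)

lemma sylow_exists:
  assumes "prime p" "subgroup X G"
  shows "\<exists>P. sylow_of p P X"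
proof -
  have pos: "card X > 0" by (rule card_pos[OF assms(2)])
  obtain m where m: "card X = p ^ multiplicity p (card X) * m" "\<not> p dvd m"
    using pos assms(1) multiplicity_decompose'[of "card X" p] by (metis neq0_conv not_prime_unit)
  have "group (G\<lparr>carrier := X\<rparr>)" by (rule subgroup.subgroup_is_group[OF assms(2) group_axioms])
  from sylow_thm[OF assms(1) this, of "multiplicity p (card X)" m] m(1) finite_subgroup[OF assms(2)]
  obtain P where "subgroup P (G\<lparr>carrier := X\<rparr>)" "card P = p ^ multiplicity p (card X)"
    by (auto simp: order_def)
  moreover from this have P: "subgroup P G" "P \<subseteq> X" using subgroup_in_iff[OF assms(2)] by auto
  moreover have "index X P = m"
    using card_index[OF P(1) assms(2) P(2)] m(1) \<open>card P = _\<close> card_pos[OF P(1)]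
    by (metis mult_cancel1 less_not_refl)
  ultimately show ?thesis using assms(1) m(2) by (auto simp: sylow_of_def)
qed

lemma sylow_of_nontrivial: "sylow_of p P X \<Longrightarrow> p dvd card X \<Longrightarrow> P \<noteq> {\<one>}"
  using index_triv[of X] by (auto simp: sylow_of_def)

text \<open>A \<open>p\<close>-subgroup acts by multiplication on the cosets of a Sylow \<open>p\<close>-subgroup, whose number is prime to
  \<open>p\<close>.\<close>

lemma sylow_conj:
  assumes X: "subgroup X G" and P: "subgroup P G" "P \<subseteq> X" "card P = p ^ k" and Q: "sylow_of p Q X"
  shows "\<exists>x\<in>X. P \<subseteq> conj_by x Q"
proof -
  note q = sylow_ofD[OF Q]
  let ?H = "G\<lparr>carrier := X\<rparr>"
  interpret H: group ?H by (rule subgroup.subgroup_is_group[OF X group_axioms])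
  have QH: "subgroup Q ?H" using q X by (simp add: subgroup_in_iff)
  let ?E = "rcosets\<^bsub>?H\<^esub> Q"
  have E: "?E = (\<lambda>x. Q #> x) ` X" by (auto simp: RCOSETS_def)
  have "card ?E * card Q = card X" using H.lagrange[OF QH] by (simp add: order_def)
  then have cE: "card ?E = index X Q" using card_pos[OF q(2)] by (simp add: index_def flip: \<open>card ?E * card Q = card X\<close>)
  have Qc: "Q \<subseteq> carrier G" using q(2) by (rule subgroup.subset)
  have Xc: "\<And>x. x \<in> X \<Longrightarrow> x \<in> carrier G" using X mem_carrier by blast
  have Pc: "\<And>x. x \<in> P \<Longrightarrow> x \<in> carrier G" using P mem_carrier by blast
  have "\<exists>C\<in>?E. \<forall>g\<in>P. C #> inv g = C"
  proof (rule prime_power_group_fixed_point[OF P(1,3) q(1)])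
    show "finite ?E" unfolding E using finite_subgroup[OF X] by simp
    show "\<not> p dvd card ?E" using cE q by simp
  next
    fix g C assume "g \<in> P" "C \<in> ?E"
    then show "C #> inv g \<in> ?E"
      unfolding E using P X Qc Xc by (auto simp: coset_mult_assoc intro!: imageI sg)
  next
    fix C assume "C \<in> ?E"
    then show "C #> inv \<one> = C" unfolding E using Qc Xc by (auto simp: coset_mult_assoc)
  next
    fix g h C assume "g \<in> P" "h \<in> P" "C \<in> ?E"
    then show "C #> inv (g \<otimes> h) = C #> inv h #> inv g"
      unfolding E using Qc Xc Pc by (auto simp: coset_mult_assoc inv_mult_group m_assoc)
  qed
  then obtain x where x: "x \<in> X" "\<And>g. g \<in> P \<Longrightarrow> Q #> x #> inv g = Q #> x" unfolding E by auto
  have "g \<in> conj_by (inv x) Q" if g: "g \<in> P" for g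
  proof -
    have c: "x \<in> carrier G" "g \<in> carrier G" using x g Xc Pc by auto
    have "Q #> (x \<otimes> inv (inv g)) = Q #> x"
      using x(2)[of "inv g"] g P c Qc by (simp add: coset_mult_assoc sg)
    then have "x \<otimes> g \<in> Q #> x"
      using rcos_self[of "x \<otimes> g" Q] q(2) c by simp
    then obtain y where y: "y \<in> Q" "x \<otimes> g = y \<otimes> x" by (auto simp: r_coset_def)
    have "g = inv x \<otimes> (x \<otimes> g)" using c by simp
    also have "\<dots> = inv x \<otimes> y \<otimes> inv (inv x)" unfolding y(2) using c y Qc by (auto simp: word)
    finally show ?thesis using y by (auto simp: conj_by_def)
  qed
  then show ?thesis using x X by (blast intro: sg)
qed

text \<open>If all conjugates of \<open>A\<close> under \<open>X\<close> are already conjugate under \<open>M\<close>, then the normaliser of \<open>A\<close>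
  together with \<open>M\<close> accounts for all of \<open>X\<close>. Two cases are used below: Sylow subgroups, and
  complements of an abelian normal subgroup of coprime index.\<close>

lemma Frattini_argument:
  assumes M: "normal_in M X" and Ac: "A \<subseteq> carrier G"
    and conj: "\<And>x. x \<in> X \<Longrightarrow> \<exists>m\<in>M. conj_by x A = conj_by m A"
  shows "M <#> normalizer_in X A = X"
proof
  note m = normal_inD[OF M]
  show "M <#> normalizer_in X A \<subseteq> X"
    by (rule set_mult_subset[OF m(2,3) normalizer_in_subset])
  show "X \<subseteq> M <#> normalizer_in X A"
  proof
    fix x assume x: "x \<in> X"
    obtain y where y: "y \<in> M" "conj_by x A = conj_by y A" using conj[OF x] by blast
    have c: "x \<in> carrier G" "y \<in> carrier G" using x y m mem_carrier by blast+
    have "conj_by (inv y \<otimes> x) A = A"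
      using conj_by_mult[of "inv y" x A] c Ac y conj_by_inv by simp
    moreover have "inv y \<otimes> x \<in> X" using x y m by (auto intro: sg)
    ultimately have "inv y \<otimes> x \<in> normalizer_in X A" by (simp add: normalizer_in_def)
    moreover have "x = y \<otimes> (inv y \<otimes> x)" using c by simp
    ultimately show "x \<in> M <#> normalizer_in X A" using y(1) by (auto simp: set_mult_def)
  qed
qed

lemma Frattini_sylow:
  assumes M: "normal_in M X" and P: "sylow_of p P M"
  shows "M <#> normalizer_in X P = X"
proof (rule Frattini_argument[OF M])
  note m = normal_inD[OF M] and s = sylow_ofD[OF P]
  show Pc: "P \<subseteq> carrier G" using s(2) by (rule subgroup.subset)
  fix x assume x: "x \<in> X"
  have xc: "x \<in> carrier G" using x m mem_carrier by blast
  obtain k where k: "card P = p ^ k" using s(4) by blast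
  have "conj_by x P \<subseteq> M" using conj_by_mono[OF s(3), of x] normal_in_conj_by[OF M x] by simp
  then obtain y where y: "y \<in> M" "conj_by x P \<subseteq> conj_by y P"
    using sylow_conj[OF m(1) subgroup_conj_by[OF s(2) xc] _ _ P, of k] k card_conj_by[OF xc Pc] by auto
  have yc: "y \<in> carrier G" using y m mem_carrier by blast
  have "conj_by x P = conj_by y P"
    using y(2) card_conj_by[OF xc Pc] card_conj_by[OF yc Pc] subgroup_conj_by[OF s(2)] xc yc
    by (intro subgroup_eqI_card) auto
  then show "\<exists>m\<in>M. conj_by x P = conj_by m P" using y by blast
qed

lemma index_set_mult:
  assumes "subgroup A G" "A \<subseteq> X" "normal_in N X"
  shows "index (A <#> N) N = index A (A \<inter> N)"
proof -
  note s = subgroup_set_mult[OF assms] and n = normal_inD[OF assms(3)]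
  have D: "subgroup (A \<inter> N) G" using assms(1) n(1) subgroups_Inter_pair by blast
  have "card N * card (A \<inter> N) * index (A <#> N) N = card N * card (A \<inter> N) * index A (A \<inter> N)"
    using card_set_mult[OF assms(1) n(1)] card_index[OF n(1) s(1,4)] card_index[OF D assms(1)]
    by (simp add: ac_simps)
  then show ?thesis using card_pos[OF D] card_pos[OF n(1)] by simp
qed

lemma card_set_mult_index:
  assumes "subgroup A G" "A \<subseteq> X" "normal_in N X"
  shows "card (A <#> N) = card N * index A (A \<inter> N)"
  using index_set_mult[OF assms] card_index[of N "A <#> N"] subgroup_set_mult[OF assms] normal_inD[OF assms(3)]
  by simp

text \<open>The index of \<open>N\<close> in \<open>A N\<close> divides both the index of \<open>N\<close> in \<open>X\<close> and the order of \<open>A\<close>. It follows that a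
  normal Hall subgroup is characteristic.\<close>

lemma pi_subgroup_le_normal:
  assumes "normal_in N X" "pi_number (- s) (index X N)" "subgroup A G" "A \<subseteq> X" "pi_number s (card A)"
  shows "A \<subseteq> N"
proof -
  note n = normal_inD[OF assms(1)] and t = subgroup_set_mult[OF assms(3,4,1)]
  have D: "subgroup (A \<inter> N) G" using assms(3) n(1) subgroups_Inter_pair by blast
  have "index (A <#> N) N dvd index X N" by (rule index_dvd) (use n t in auto)
  moreover have "index (A <#> N) N dvd card A"
    unfolding index_set_mult[OF assms(3,4,1)] by (rule index_dvd_card) (use D assms in auto)
  ultimately have "index (A <#> N) N = 1"
    using assms pi_number_dvd pi_number_both by metis
  then show ?thesis using index_eq_1[OF n(1) t(1,4)] t(3) by blast
qed

lemma normal_hall_characteristic: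
  assumes "normal_in N X" "pi_number s (card N)" "pi_number (- s) (index X N)" "normal_in X Y"
  shows "normal_in N Y"
  unfolding normal_in_conj_iff
proof (intro conjI ballI)
  note n = normal_inD[OF assms(1)] and x = normal_inD[OF assms(4)]
  show "subgroup N G" "subgroup Y G" "N \<subseteq> Y" using n x by auto
  fix y assume y: "y \<in> Y"
  have yc: "y \<in> carrier G" using y x mem_carrier by blast
  have Nc: "N \<subseteq> carrier G" using n(1) by (rule subgroup.subset)
  have "conj_by y N \<subseteq> X" using conj_by_mono[OF n(3)] normal_in_conj_by[OF assms(4) y] by blast
  then have "conj_by y N \<subseteq> N"
    using pi_subgroup_le_normal[OF assms(1,3) subgroup_conj_by[OF n(1) yc]] card_conj_by[OF yc Nc] assms(2)
    by simp
  then show "conj_by y N = N" by (rule conj_by_eqI[OF n(1) yc])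
qed

definition centralizer_in :: "'a set \<Rightarrow> 'a set \<Rightarrow> 'a set" where
  "centralizer_in X A = {x \<in> X. \<forall>a\<in>A. x \<otimes> a = a \<otimes> x}"

lemma subgroup_centralizer_in:
  assumes "subgroup X G" "A \<subseteq> carrier G"
  shows "subgroup (centralizer_in X A) G"
proof (rule subgroupI)
  show "centralizer_in X A \<subseteq> carrier G" using subgroup.subset[OF assms(1)] by (auto simp: centralizer_in_def)
  show "centralizer_in X A \<noteq> {}"
    using assms by (auto simp: centralizer_in_def subset_eq intro!: exI[of _ \<one>] sg)
  fix x assume x: "x \<in> centralizer_in X A"
  have xc: "x \<in> carrier G" using x assms by (auto simp: centralizer_in_def mem_carrier)
  show "inv x \<in> centralizer_in X A"
    unfolding centralizer_in_def
  proof (intro CollectI conjI ballI)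
    show "inv x \<in> X" using x assms by (auto simp: centralizer_in_def sg)
    fix a assume a: "a \<in> A"
    have ac: "a \<in> carrier G" using a assms by blast
    have "inv x \<otimes> a = inv x \<otimes> (a \<otimes> x) \<otimes> inv x" using xc ac by (simp add: word)
    also have "a \<otimes> x = x \<otimes> a" using x a by (simp add: centralizer_in_def)
    also have "inv x \<otimes> (x \<otimes> a) \<otimes> inv x = a \<otimes> inv x" using xc ac by simp
    finally show "inv x \<otimes> a = a \<otimes> inv x" .
  qed
  fix y assume y: "y \<in> centralizer_in X A"
  have yc: "y \<in> carrier G" using y assms by (auto simp: centralizer_in_def mem_carrier)
  show "x \<otimes> y \<in> centralizer_in X A"
    unfolding centralizer_in_def
  proof (intro CollectI conjI ballI)
    show "x \<otimes> y \<in> X" using x y assms by (auto simp: centralizer_in_def sg)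
    fix a assume a: "a \<in> A"
    have ac: "a \<in> carrier G" using a assms by blast
    have "x \<otimes> y \<otimes> a = x \<otimes> (a \<otimes> y)" using xc ac yc y a by (simp add: m_assoc centralizer_in_def)
    also have "\<dots> = a \<otimes> x \<otimes> y" using xc ac yc x a by (simp add: centralizer_in_def flip: m_assoc)
    finally show "x \<otimes> y \<otimes> a = a \<otimes> (x \<otimes> y)" using xc ac yc by (simp add: m_assoc)
  qed
qed

lemma normal_in_centralizer:
  assumes "normal_in A X"
  shows "normal_in (centralizer_in X A) X"
proof -
  note n = normal_inD[OF assms]
  have Ac: "A \<subseteq> carrier G" using n(1) by (rule subgroup.subset)
  show ?thesis
  proof (rule normal_inI[OF subgroup_centralizer_in[OF n(2) Ac] n(2)])
    show "centralizer_in X A \<subseteq> X" by (auto simp: centralizer_in_def)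
    fix x y assume x: "x \<in> X" and y: "y \<in> centralizer_in X A"
    have c: "x \<in> carrier G" "y \<in> carrier G" using x y n mem_carrier by (auto simp: centralizer_in_def)
    show "x \<otimes> y \<otimes> inv x \<in> centralizer_in X A"
      unfolding centralizer_in_def
    proof (intro CollectI conjI ballI)
      show "x \<otimes> y \<otimes> inv x \<in> X" using x y n by (auto simp: centralizer_in_def intro!: sg)
      fix a assume a: "a \<in> A"
      have ac: "a \<in> carrier G" using a Ac by blast
      let ?b = "inv x \<otimes> a \<otimes> x"
      have b: "?b \<in> A" by (rule normal_inD2[OF assms x a])
      have "x \<otimes> y \<otimes> inv x \<otimes> a = x \<otimes> (y \<otimes> ?b) \<otimes> inv x" using c ac by (simp add: word)
      also have "\<dots> = x \<otimes> (?b \<otimes> y) \<otimes> inv x" using y b by (simp add: centralizer_in_def)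
      also have "\<dots> = a \<otimes> (x \<otimes> y \<otimes> inv x)" using c ac by (simp add: word)
      finally show "x \<otimes> y \<otimes> inv x \<otimes> a = a \<otimes> (x \<otimes> y \<otimes> inv x)" .
    qed
  qed
qed

abbreviation centre :: "'a set \<Rightarrow> 'a set" where
  "centre A \<equiv> centralizer_in A A"

lemma normal_in_centre:
  assumes "normal_in A X" shows "normal_in (centre A) X"
proof -
  have "centre A = A \<inter> centralizer_in X A" using normal_inD[OF assms] by (auto simp: centralizer_in_def)
  then show ?thesis using normal_in_Int[OF assms normal_in_centralizer[OF assms]] by simp
qed

text \<open>The group acts by conjugation on its nontrivial elements, and their number is prime to \<open>p\<close>.\<close>

lemma centre_prime_power_nontrivial:
  assumes "subgroup P G" "card P = p ^ k" "prime p" "P \<noteq> {\<one>}"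
  shows "centre P \<noteq> {\<one>}"
proof -
  let ?E = "P - {\<one>}"
  have Pc: "\<And>x. x \<in> P \<Longrightarrow> x \<in> carrier G" using assms mem_carrier by blast
  have fin: "finite P" by (rule finite_subgroup[OF assms(1)])
  have 1: "\<one> \<in> P" using assms(1) by (rule sg)
  have "k \<noteq> 0" using assms card_1_iff[OF assms(1)] by auto
  then have "p dvd card P" using assms(2) by simp
  moreover have "card P = Suc (card ?E)" using card_Suc_Diff1[OF fin 1] by simp
  ultimately have "\<not> p dvd card ?E"
    using assms(3) dvd_add_left_iff[of p "card ?E" 1] by (auto simp: not_prime_1)
  then have "\<exists>x\<in>?E. \<forall>g\<in>P. g \<otimes> x \<otimes> inv g = x"
  proof (rule prime_power_group_fixed_point[OF assms(1-3), rotated])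
    fix g x assume "g \<in> P" "x \<in> ?E"
    then have gx: "g \<in> P" "x \<in> P" "x \<noteq> \<one>" by auto
    have "x = inv g \<otimes> (g \<otimes> x \<otimes> inv g) \<otimes> g" using gx Pc by (simp add: word)
    then have "g \<otimes> x \<otimes> inv g \<noteq> \<one>" using gx Pc by (metis l_inv r_one inv_closed)
    then show "g \<otimes> x \<otimes> inv g \<in> ?E" using gx assms(1) by (simp add: sg)
  qed (use fin Pc in \<open>auto simp: word\<close>)
  then obtain x where x: "x \<in> P" "x \<noteq> \<one>" "\<And>g. g \<in> P \<Longrightarrow> g \<otimes> x \<otimes> inv g = x" by auto
  have "x \<otimes> g = g \<otimes> x" if "g \<in> P" for g
    using x(3)[OF that] Pc that x(1) by (metis inv_solve_right m_closed)
  then show ?thesis using x(1,2) by (auto simp: centralizer_in_def)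
qed

end

section \<open>Quotient groups\<close>

locale epimorphism = finite_group G + cod: finite_group H
  for G :: "('a, 'b) monoid_scheme" (structure) and H :: "('c, 'd) monoid_scheme" +
  fixes X :: "'a set" and N :: "'a set" and f :: "'a \<Rightarrow> 'c"
  assumes dom: "subgroup X G"
    and onto: "f ` X = carrier H"
    and f_mult: "\<And>x y. x \<in> X \<Longrightarrow> y \<in> X \<Longrightarrow> f (x \<otimes> y) = f x \<otimes>\<^bsub>H\<^esub> f y"
    and f_kernel: "\<And>x. x \<in> X \<Longrightarrow> f x = \<one>\<^bsub>H\<^esub> \<longleftrightarrow> x \<in> N"
    and kernel_subset: "N \<subseteq> X"
begin

lemma f_closed: "x \<in> X \<Longrightarrow> f x \<in> carrier H"
  using onto by blast

lemma f_one: "f \<one> = \<one>\<^bsub>H\<^esub>"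
proof -
  have 1: "\<one> \<in> X" using dom by (rule sg)
  then have "f \<one> \<otimes>\<^bsub>H\<^esub> f \<one> = f \<one>" using f_mult[of \<one> \<one>] by simp
  then show ?thesis using f_closed[OF 1] cod.l_cancel_one by blast
qed

lemma f_inv: "x \<in> X \<Longrightarrow> f (inv x) = inv\<^bsub>H\<^esub> f x"
proof -
  assume x: "x \<in> X"
  have i: "inv x \<in> X" using x dom by (simp add: sg)
  have "f (inv x) \<otimes>\<^bsub>H\<^esub> f x = \<one>\<^bsub>H\<^esub>"
    using f_mult[OF i x] f_one mem_carrier[OF dom x] by simp
  then show ?thesis using cod.inv_equality f_closed x i by metis
qed

definition pre :: "'c set \<Rightarrow> 'a set" where
  "pre B = {x \<in> X. f x \<in> B}"

lemma pre_subset: "pre B \<subseteq> X"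
  by (auto simp: pre_def)

lemma image_pre: "B \<subseteq> carrier H \<Longrightarrow> f ` pre B = B"
  using onto by (fastforce simp: pre_def)

lemma subgroup_pre: "subgroup B H \<Longrightarrow> subgroup (pre B) G"
proof (rule subgroupI)
  assume B: "subgroup B H"
  show "pre B \<subseteq> carrier G" using dom mem_carrier by (auto simp: pre_def)
  have "\<one> \<in> pre B" using dom f_one B by (simp add: pre_def sg cod.sg)
  then show "pre B \<noteq> {}" by blast
  show "inv a \<in> pre B" if "a \<in> pre B" for a
    using that f_inv dom B by (simp add: pre_def sg cod.sg)
  show "a \<otimes> b \<in> pre B" if "a \<in> pre B" "b \<in> pre B" for a b
    using that f_mult dom B by (simp add: pre_def sg cod.sg)
qed

lemma subgroup_kernel: "subgroup N G"
proof -
  have "N = pre {\<one>\<^bsub>H\<^esub>}" using f_kernel kernel_subset by (auto simp: pre_def)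
  then show ?thesis using subgroup_pre[OF cod.triv_subgroup] by simp
qed

lemma kernel_le_pre: "subgroup B H \<Longrightarrow> N \<subseteq> pre B"
  using f_kernel kernel_subset cod.sg(3)[of B H] by (fastforce simp: pre_def)

lemma subgroup_image:
  assumes "subgroup A G" "A \<subseteq> X" shows "subgroup (f ` A) H"
proof (rule cod.subgroupI)
  show "f ` A \<subseteq> carrier H" using assms f_closed by blast
  show "f ` A \<noteq> {}" using sg(3)[OF assms(1)] by blast
  show "inv\<^bsub>H\<^esub> a \<in> f ` A" if "a \<in> f ` A" for a
    using that assms by (auto simp: subset_eq f_inv[symmetric] sg(2))
  show "a \<otimes>\<^bsub>H\<^esub> b \<in> f ` A" if "a \<in> f ` A" "b \<in> f ` A" for a b
    using that assms by (auto simp: subset_eq f_mult[symmetric] sg(1))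
qed

lemma pre_image:
  assumes "subgroup A G" "A \<subseteq> X" "N \<subseteq> A" shows "pre (f ` A) = A"
proof
  show "A \<subseteq> pre (f ` A)" using assms by (auto simp: pre_def)
  show "pre (f ` A) \<subseteq> A"
  proof
    fix x assume "x \<in> pre (f ` A)"
    then obtain a where a: "x \<in> X" "a \<in> A" "f x = f a" by (auto simp: pre_def)
    have aX: "a \<in> X" using a assms by blast
    have c: "x \<in> carrier G" "a \<in> carrier G" using a aX dom mem_carrier by blast+
    have "f (x \<otimes> inv a) = \<one>\<^bsub>H\<^esub>" using a aX f_mult f_inv f_closed dom by (simp add: sg)
    moreover have "x \<otimes> inv a \<in> X" using a aX dom by (simp add: sg)
    ultimately have "x \<otimes> inv a \<in> A" using f_kernel assms by blast
    then have "x \<otimes> inv a \<otimes> a \<in> A" using a assms(1) by (blast intro: sg)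
    then show "x \<in> A" using c by (simp add: m_assoc)
  qed
qed

lemma normal_in_pre: "cod.normal_in B C \<Longrightarrow> normal_in (pre B) (pre C)"
  using cod.normal_inD[of B C] dom
  by (intro normal_inI subgroup_pre) (auto simp: pre_def sg f_mult f_inv)

lemma normal_in_image:
  assumes "normal_in A C" "C \<subseteq> X" shows "cod.normal_in (f ` A) (f ` C)"
proof -
  note n = normal_inD[OF assms(1)]
  show ?thesis
  proof (rule cod.normal_inI)
    show "subgroup (f ` A) H" "subgroup (f ` C) H" using subgroup_image n assms by auto
    show "f ` A \<subseteq> f ` C" using n by blast
    fix x y assume "x \<in> f ` C" "y \<in> f ` A"
    then obtain c a where a: "x = f c" "y = f a" "c \<in> C" "a \<in> A" by blast
    then have "x \<otimes>\<^bsub>H\<^esub> y \<otimes>\<^bsub>H\<^esub> inv\<^bsub>H\<^esub> x = f (c \<otimes> a \<otimes> inv c)"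
      using f_mult f_inv dom n(3) assms(2) by (simp add: sg subset_eq)
    then show "x \<otimes>\<^bsub>H\<^esub> y \<otimes>\<^bsub>H\<^esub> inv\<^bsub>H\<^esub> x \<in> f ` A" using n(4) a by auto
  qed
qed

lemma normal_in_kernel: "normal_in N X"
proof -
  have "N = pre {\<one>\<^bsub>H\<^esub>}" "X = pre (carrier H)"
    using f_kernel kernel_subset f_closed by (auto simp: pre_def)
  then show ?thesis using normal_in_pre[OF cod.normal_in_triv[OF cod.subgroup_self]] by simp
qed

lemma pre_carrier: "pre (carrier H) = X"
  using f_closed by (auto simp: pre_def)

lemma card_pre:
  assumes "subgroup B H" shows "card (pre B) = card N * card B"
proof -
  have fib: "card {x \<in> pre B. f x = y} = card N" if y: "y \<in> B" for y
  proof -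
    have "y \<in> f ` X" using cod.mem_carrier[OF assms y] onto by simp
    then obtain a where a: "a \<in> X" "f a = y" by blast
    have ac: "a \<in> carrier G" using a dom mem_carrier by blast
    have "{x \<in> pre B. f x = y} = (\<lambda>n. n \<otimes> a) ` N"
    proof (rule Set.set_eqI, rule iffI)
      fix x assume "x \<in> {x \<in> pre B. f x = y}"
      then have x: "x \<in> X" "f x = f a" using a by (auto simp: pre_def)
      have "x \<otimes> inv a \<in> X" "f (x \<otimes> inv a) = \<one>\<^bsub>H\<^esub>"
        using a x f_mult f_inv f_closed[OF a(1)] dom by (simp_all add: sg)
      then have "x \<otimes> inv a \<in> N" using f_kernel by blast
      moreover have "x = x \<otimes> inv a \<otimes> a" using ac x dom mem_carrier by (simp add: m_assoc)
      ultimately show "x \<in> (\<lambda>n. n \<otimes> a) ` N" by blast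
    next
      fix x assume "x \<in> (\<lambda>n. n \<otimes> a) ` N"
      then obtain n where n: "n \<in> N" "x = n \<otimes> a" by blast
      then have "n \<in> X" "f n = \<one>\<^bsub>H\<^esub>" using kernel_subset f_kernel by blast+
      then show "x \<in> {x \<in> pre B. f x = y}"
        using n a y f_mult f_closed[OF a(1)] dom by (simp add: pre_def sg)
    qed
    moreover have "inj_on (\<lambda>n. n \<otimes> a) N"
      using ac mem_carrier[OF subgroup_kernel] by (auto intro!: inj_onI)
    ultimately show ?thesis by (simp add: card_image)
  qed
  have fin: "finite (pre B)" using finite_subgroup[OF dom] pre_subset finite_subset by blast
  have "f ` pre B = B" by (rule image_pre[OF subgroup.subset[OF assms]])
  then have "card (pre B) = (\<Sum>y\<in>B. card {x \<in> pre B. f x = y})"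
    using sum.image_gen[OF fin, of "\<lambda>_. 1::nat" f] by simp
  also have "\<dots> = (\<Sum>y\<in>B. card N)" by (rule sum.cong[OF refl fib])
  finally show ?thesis by simp
qed

lemma index_pre: "subgroup B H \<Longrightarrow> subgroup C H \<Longrightarrow> index (pre C) (pre B) = index C B"
  unfolding index_def using card_pre card_pos[OF subgroup_kernel] by simp

lemma card_codomain: "card (carrier H) = index X N"
  using card_pre[OF cod.subgroup_self] card_index[OF subgroup_kernel dom kernel_subset]
    card_pos[OF subgroup_kernel] by (simp add: pre_carrier)

lemma card_image_kernel:
  assumes "subgroup A G" "A \<subseteq> X" "N \<subseteq> A" shows "card (f ` A) = index A N"
  using card_pre[OF subgroup_image[OF assms(1,2)]] pre_image[OF assms]
    card_index[OF subgroup_kernel assms(1,3)] card_pos[OF subgroup_kernel] by simp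

lemma index_image:
  assumes "subgroup A G" "subgroup C G" "A \<subseteq> C" "C \<subseteq> X" "N \<subseteq> A"
  shows "index (f ` C) (f ` A) = index C A"
proof -
  have "N \<subseteq> C" "A \<subseteq> X" using assms by auto
  then show ?thesis
    using index_pre[OF subgroup_image[of A] subgroup_image[of C]] assms pre_image[of A] pre_image[of C] by simp
qed

end

text \<open>Inductions over the group order pass to quotients, so the quotient has to live on the same type as the
  group. A coset is therefore replaced by one of its elements.\<close>

lemma (in finite_group) quotient_on_same_type:
  assumes "normal_in N X"
  obtains H :: "('a, 'b) monoid_scheme" and f where "epimorphism G H X N f"
proof -
  note n = normal_inD[OF assms]
  let ?X = "G\<lparr>carrier := X\<rparr>"
  have nor: "N \<lhd> ?X" using assms normal_in_iff[OF n(2)] by simp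
  interpret Q: group "?X Mod N" by (rule normal.factorgroup_is_group[OF nor])
  define r where "r C = (SOME x. x \<in> C)" for C :: "'a set"
  have C: "carrier (?X Mod N) = (\<lambda>x. N #> x) ` X" by (simp add: carrier_FactGroup)
  have r: "r C \<in> C" if "C \<in> carrier (?X Mod N)" for C
  proof -
    obtain x where "x \<in> X" "C = N #> x" using \<open>C \<in> carrier (?X Mod N)\<close> C by auto
    then have "x \<in> C" using rcos_self n mem_carrier by blast
    then show ?thesis unfolding r_def by (rule someI)
  qed
  have rc: "N #> r C = C" if "C \<in> carrier (?X Mod N)" for C
  proof -
    obtain x where x: "x \<in> X" "C = N #> x" using \<open>C \<in> carrier (?X Mod N)\<close> C by auto
    then show ?thesis using r[OF that] repr_independence[of "r C" N x] n mem_carrier by simp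
  qed
  define f where "f x = r (N #> x)" for x
  define H :: "('a, 'b) monoid_scheme"
    where "H = G\<lparr>carrier := f ` X, monoid.mult := (\<lambda>x y. f (x \<otimes> y)), one := f \<one>\<rparr>"
  have Nc: "N \<subseteq> carrier G" using n(1) by (rule subgroup.subset)
  have inN: "N #> x \<in> carrier (?X Mod N)" if "x \<in> X" for x using that C by auto
  have Xc: "x \<in> carrier G" if "x \<in> X" for x using that n(2) mem_carrier by blast
  have feq: "f x = f y \<longleftrightarrow> N #> x = N #> y" if "x \<in> X" "y \<in> X" for x y
    using rc[OF inN[OF that(1)]] rc[OF inN[OF that(2)]] by (metis f_def)
  have fX: "f x \<in> X" if "x \<in> X" for x
  proof -
    have "f x \<in> N #> x" using r[OF inN[OF that]] by (simp add: f_def)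
    then obtain y where "y \<in> N" "f x = y \<otimes> x" by (auto simp: r_coset_def)
    then show ?thesis using that n by (simp add: subset_eq sg)
  qed
  have mul: "N #> (x \<otimes> y) = (N #> x) <#> (N #> y)" if "x \<in> X" "y \<in> X" for x y
    using normal.rcos_sum[OF nor, of x y] that by simp
  have fm: "f (x \<otimes> y) = f (f x \<otimes> f y)" if "x \<in> X" "y \<in> X" for x y
  proof -
    have "N #> (f x \<otimes> f y) = N #> (x \<otimes> y)"
      using mul[OF fX fX] mul[OF that] that rc[OF inN] by (simp add: f_def)
    then show ?thesis by (simp add: f_def)
  qed
  have ff: "f (f x) = f x" if "x \<in> X" for x
    using rc[OF inN[OF that]] by (simp add: f_def)
  have one: "\<one> \<in> X" using n(2) by (rule sg)
  have fm1: "f (x \<otimes> f y) = f (x \<otimes> y)" "f (f x \<otimes> y) = f (x \<otimes> y)" if "x \<in> X" "y \<in> X" for x y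
    using fm[OF that] fm[OF fX[OF that(1)] that(2)] fm[OF that(1) fX[OF that(2)]] that by (simp_all add: ff)
  have "group H"
  proof (rule groupI)
    fix x y assume "x \<in> carrier H" "y \<in> carrier H"
    then show "x \<otimes>\<^bsub>H\<^esub> y \<in> carrier H" using fX n(2) by (auto simp: H_def intro!: imageI sg)
  next
    show "\<one>\<^bsub>H\<^esub> \<in> carrier H" using one by (simp add: H_def)
  next
    fix x y z assume "x \<in> carrier H" "y \<in> carrier H" "z \<in> carrier H"
    then have X: "x \<in> X" "y \<in> X" "z \<in> X" using fX by (auto simp: H_def)
    then show "x \<otimes>\<^bsub>H\<^esub> y \<otimes>\<^bsub>H\<^esub> z = x \<otimes>\<^bsub>H\<^esub> (y \<otimes>\<^bsub>H\<^esub> z)"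
      using n(2) by (simp add: H_def fm1 sg m_assoc Xc)
  next
    fix x assume "x \<in> carrier H"
    then obtain y where y: "y \<in> X" "x = f y" by (auto simp: H_def)
    show "\<one>\<^bsub>H\<^esub> \<otimes>\<^bsub>H\<^esub> x = x" using y one by (simp add: H_def fm[symmetric] Xc)
    have "f (inv y) \<in> carrier H" using y n(2) by (simp add: H_def sg)
    moreover have "f (inv y) \<otimes>\<^bsub>H\<^esub> x = \<one>\<^bsub>H\<^esub>"
      using y n(2) by (simp add: H_def fm[symmetric] sg Xc)
    ultimately show "\<exists>y\<in>carrier H. y \<otimes>\<^bsub>H\<^esub> x = \<one>\<^bsub>H\<^esub>" by blast
  qed
  moreover have "finite (carrier H)" using finite_subgroup[OF n(2)] by (simp add: H_def)
  ultimately have H: "finite_group H" by (simp add: finite_group_def finite_group_axioms_def)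
  have "epimorphism G H X N f"
    unfolding epimorphism_def epimorphism_axioms_def
  proof (intro conjI allI impI)
    show "finite_group G" by (rule finite_group_axioms)
    show "finite_group H" by (rule H)
    show "subgroup X G" "N \<subseteq> X" using n by auto
    show "f ` X = carrier H" by (simp add: H_def)
    show "f (x \<otimes> y) = f x \<otimes>\<^bsub>H\<^esub> f y" if "x \<in> X" "y \<in> X" for x y
      using fm[OF that] by (simp add: H_def)
    fix x assume x: "x \<in> X"
    have "f x = \<one>\<^bsub>H\<^esub> \<longleftrightarrow> N #> x = N" using feq[OF x one] Nc by (simp add: H_def)
    also have "\<dots> \<longleftrightarrow> x \<in> N"
      using coset_join2[OF Xc[OF x] n(1)] rcos_self[OF Xc[OF x] n(1)] by blast
    finally show "f x = \<one>\<^bsub>H\<^esub> \<longleftrightarrow> x \<in> N" .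
  qed
  then show thesis by (rule that)
qed

section \<open>The Schur-Zassenhaus theorem\<close>

lemma (in comm_group) finprod_hom:
  assumes "h \<in> hom G G" "f \<in> E \<rightarrow> carrier G"
  shows "finprod G (\<lambda>x. h (f x)) E = h (finprod G f E)"
proof -
  interpret h: group_hom G G h by unfold_locales (rule assms(1))
  show ?thesis using assms(2)
  proof (induction E rule: infinite_finite_induct)
    case (insert x E)
    then show ?case by (simp add: Pi_iff)
  qed simp_all
qed

lemma (in group) pow_card_carrier:
  assumes "finite (carrier G)" "a \<in> carrier G"
  shows "a [^] card (carrier G) = \<one>"
  using pow_order_eq_1[OF assms(2)] by (simp add: order_def)

text \<open>Let \<open>A\<close> be an abelian normal subgroup of \<open>X\<close>. For two transversals \<open>t\<close> and \<open>t'\<close> of \<open>A\<close>, let \<open>quot t t'\<close> be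
  the product of all \<open>t C \<otimes> inv (t' C)\<close>, which is an element of \<open>A\<close>. The group \<open>X\<close> acts on the transversals by
  \<open>shift\<close>. The action of \<open>a \<in> A\<close> changes \<open>quot t t'\<close> by the factor \<open>a [^] m\<close>, where \<open>m\<close> is the index of
  \<open>A\<close>. If \<open>m\<close> is prime to the order of \<open>A\<close>, every element of \<open>A\<close> is an \<open>m\<close>-th power of exactly one element.
  So \<open>A\<close> acts simply transitively on the classes of transversals with trivial quotient, the stabilisers \<open>stab t\<close>
  of these classes are complements of \<open>A\<close>, and they are conjugate under \<open>A\<close>. Every complement arises in this
  way, because it is itself a transversal.\<close>

locale coprime_abelian_normal = finite_group +
  fixes A X
  assumes normal: "normal_in A X"
    and commute: "\<And>a b. a \<in> A \<Longrightarrow> b \<in> A \<Longrightarrow> a \<otimes> b = b \<otimes> a"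
    and coprime: "coprime (card A) (index X A)"
begin

abbreviation AG where "AG \<equiv> G\<lparr>carrier := A\<rparr>"

definition cosets :: "'a set set" where
  "cosets = (\<lambda>x. x <# A) ` X"

definition transversal :: "('a set \<Rightarrow> 'a) \<Rightarrow> bool" where
  "transversal t \<longleftrightarrow> (\<forall>C\<in>cosets. t C \<in> C)"

definition quot :: "('a set \<Rightarrow> 'a) \<Rightarrow> ('a set \<Rightarrow> 'a) \<Rightarrow> 'a" where
  "quot t t' = finprod AG (\<lambda>C. t C \<otimes> inv (t' C)) cosets"

definition shift :: "'a \<Rightarrow> ('a set \<Rightarrow> 'a) \<Rightarrow> 'a set \<Rightarrow> 'a" where
  "shift g t C = g \<otimes> t (inv g <# C)"

definition stab :: "('a set \<Rightarrow> 'a) \<Rightarrow> 'a set" where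
  "stab t = {g \<in> X. quot (shift g t) t = \<one>}"

lemmas nA = normal_inD[OF normal]

lemma Ac: "A \<subseteq> carrier G" using nA(1) by (rule subgroup.subset)
lemma Xc: "X \<subseteq> carrier G" using nA(2) by (rule subgroup.subset)

sublocale AG: comm_group AG
proof -
  interpret a: group AG by (rule subgroup.subgroup_is_group[OF nA(1) group_axioms])
  show "comm_group AG" by (rule a.group_comm_groupI) (simp add: commute)
qed

lemma card_cosets: "card cosets = index X A"
proof -
  interpret x: group "G\<lparr>carrier := X\<rparr>" by (rule subgroup.subgroup_is_group[OF nA(2) group_axioms])
  have "subgroup A (G\<lparr>carrier := X\<rparr>)" using nA subgroup_in_iff by blast
  from x.l_lagrange[OF _ this] have "card (lcosets\<^bsub>G\<lparr>carrier := X\<rparr>\<^esub> A) * card A = card X"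
    using finite_subgroup[OF nA(2)] by (simp add: order_def mult.commute)
  moreover have "lcosets\<^bsub>G\<lparr>carrier := X\<rparr>\<^esub> A = cosets" by (auto simp: LCOSETS_def cosets_def)
  ultimately have "card cosets * card A = card X" by simp
  then show ?thesis unfolding index_def using card_pos[OF nA(1)]
    by (metis less_not_refl2 nonzero_mult_div_cancel_right)
qed

lemma cosets_shift:
  assumes "g \<in> X" "C \<in> cosets" shows "g <# C \<in> cosets"
proof -
  obtain x where x: "x \<in> X" "C = x <# A" using assms by (auto simp: cosets_def)
  then have "g <# C = (g \<otimes> x) <# A" using lcos_m_assoc[OF Ac] assms Xc by blast
  then show ?thesis using x assms nA(2) by (auto simp: cosets_def intro: sg)
qed

lemma coset_carrier: "C \<in> cosets \<Longrightarrow> C \<subseteq> X"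
  using nA by (auto simp: cosets_def l_coset_def subset_eq intro!: sg)

lemma shift_inv: "g \<in> X \<Longrightarrow> C \<in> cosets \<Longrightarrow> g <# (inv g <# C) = C" "g \<in> X \<Longrightarrow> C \<in> cosets \<Longrightarrow> inv g <# (g <# C) = C"
  using lcos_m_assoc[of C g "inv g"] lcos_m_assoc[of C "inv g" g] Xc coset_carrier[of C] lcos_mult_one[of C]
  by (auto simp: subset_eq)

lemma coset_quotient:
  assumes "C \<in> cosets" "x \<in> C" "y \<in> C" shows "x \<otimes> inv y \<in> A"
proof -
  obtain z where z: "z \<in> X" "C = z <# A" using assms by (auto simp: cosets_def)
  obtain a b where a: "a \<in> A" "b \<in> A" "x = z \<otimes> a" "y = z \<otimes> b"
    using assms z by (auto simp: l_coset_def)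
  have c: "z \<in> carrier G" "a \<in> carrier G" "b \<in> carrier G" using z a Xc Ac by auto
  have "x \<otimes> inv y = z \<otimes> (a \<otimes> inv b) \<otimes> inv z" using a c by (simp add: word)
  moreover have "a \<otimes> inv b \<in> A" using a nA(1) by (simp add: sg)
  ultimately show ?thesis using nA(4)[OF z(1)] by simp
qed

lemma coset_A_invariant:
  assumes "C \<in> cosets" "a \<in> A" shows "a <# C = C"
proof -
  obtain z where z: "z \<in> X" "C = z <# A" using assms by (auto simp: cosets_def)
  have c: "z \<in> carrier G" "a \<in> carrier G" using z assms Xc Ac by auto
  have 1: "inv z \<otimes> a \<otimes> z \<in> A" by (rule normal_inD2[OF normal z(1) assms(2)])
  have "a <# C = (a \<otimes> z) <# A" unfolding z(2) by (rule lcos_m_assoc[OF Ac c(2,1)])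
  also have "a \<otimes> z = z \<otimes> (inv z \<otimes> a \<otimes> z)" using c by (simp add: word)
  also have "\<dots> <# A = z <# ((inv z \<otimes> a \<otimes> z) <# A)" using lcos_m_assoc[OF Ac c(1), of "inv z \<otimes> a \<otimes> z"] c by simp
  also have "(inv z \<otimes> a \<otimes> z) <# A = A" using coset_join3[OF _ nA(1) 1] 1 Ac by blast
  finally show ?thesis using z by simp
qed

lemma transversalD: "transversal t \<Longrightarrow> C \<in> cosets \<Longrightarrow> t C \<in> C"
  by (simp add: transversal_def)

lemma transversal_X: "transversal t \<Longrightarrow> C \<in> cosets \<Longrightarrow> t C \<in> X"
  using transversalD coset_carrier by blast

lemma transversal_shift:
  assumes "transversal t" "g \<in> X" shows "transversal (shift g t)"
  unfolding transversal_def
proof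
  fix C assume C: "C \<in> cosets"
  have "inv g <# C \<in> cosets" using cosets_shift[OF _ C, of "inv g"] assms nA(2) by (simp add: sg)
  then have "t (inv g <# C) \<in> inv g <# C" by (rule transversalD[OF assms(1)])
  then have "g \<otimes> t (inv g <# C) \<in> g <# (inv g <# C)" by (auto simp: l_coset_def)
  then show "shift g t C \<in> C" using shift_inv(1)[OF assms(2) C] by (simp add: shift_def)
qed

lemma quot_funcset:
  "transversal t \<Longrightarrow> transversal t' \<Longrightarrow> (\<lambda>C. t C \<otimes> inv (t' C)) \<in> cosets \<rightarrow> A"
  using coset_quotient transversalD by blast

lemma quot_closed: "transversal t \<Longrightarrow> transversal t' \<Longrightarrow> quot t t' \<in> A"
  using AG.finprod_closed[of "\<lambda>C. t C \<otimes> inv (t' C)" cosets] quot_funcset by (simp add: quot_def)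

lemma quot_cong:
  assumes "\<And>C. C \<in> cosets \<Longrightarrow> t C = s C" "\<And>C. C \<in> cosets \<Longrightarrow> t' C = s' C" "transversal s" "transversal s'"
  shows "quot t t' = quot s s'"
  unfolding quot_def by (rule AG.finprod_cong') (use assms quot_funcset in auto)

lemma quot_trans:
  assumes "transversal t" "transversal t'" "transversal t''"
  shows "quot t t' \<otimes> quot t' t'' = quot t t''"
proof -
  have "quot t t' \<otimes> quot t' t'' =
      finprod AG (\<lambda>C. (t C \<otimes> inv (t' C)) \<otimes> (t' C \<otimes> inv (t'' C))) cosets"
    unfolding quot_def using AG.finprod_multf[of "\<lambda>C. t C \<otimes> inv (t' C)" cosets "\<lambda>C. t' C \<otimes> inv (t'' C)"]
      quot_funcset assms by simp
  also have "\<dots> = quot t t''"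
    unfolding quot_def
  proof (rule AG.finprod_cong')
    fix C assume "C \<in> cosets"
    then have "t C \<in> carrier G" "t' C \<in> carrier G" "t'' C \<in> carrier G"
      using transversal_X assms Xc by blast+
    then show "t C \<otimes> inv t' C \<otimes> (t' C \<otimes> inv t'' C) = t C \<otimes> inv t'' C" by (simp add: word)
  qed (use assms quot_funcset in auto)
  finally show ?thesis .
qed

lemma quot_self: "transversal t \<Longrightarrow> quot t t = \<one>"
  using AG.finprod_one_eqI[of cosets "\<lambda>C. t C \<otimes> inv (t C)"] transversal_X[of t] Xc
  by (simp add: quot_def subset_eq)

lemma quot_shift:
  assumes "transversal t" "transversal t'" "g \<in> X"
  shows "quot (shift g t) (shift g t') = g \<otimes> quot t t' \<otimes> inv g"
proof -
  have gc: "g \<in> carrier G" "inv g \<in> X" using assms(3) Xc nA(2) by (auto simp: sg)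
  let ?h = "\<lambda>a. g \<otimes> a \<otimes> inv g" and ?q = "\<lambda>C. t C \<otimes> inv (t' C)"
  have inj: "inj_on (\<lambda>C. inv g <# C) cosets"
    by (rule inj_on_inverseI[of _ "\<lambda>C. g <# C"]) (rule shift_inv(1)[OF assms(3)])
  have img: "(\<lambda>C. inv g <# C) ` cosets = cosets"
  proof
    show "(\<lambda>C. inv g <# C) ` cosets \<subseteq> cosets" using cosets_shift[OF gc(2)] by blast
    show "cosets \<subseteq> (\<lambda>C. inv g <# C) ` cosets"
    proof
      fix C assume "C \<in> cosets"
      then show "C \<in> (\<lambda>C. inv g <# C) ` cosets"
        using cosets_shift[OF assms(3)] shift_inv(2)[OF assms(3)] by (metis image_eqI)
    qed
  qed
  have hom: "?h \<in> hom AG AG"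
  proof (rule homI)
    show "?h a \<in> carrier AG" if "a \<in> carrier AG" for a using that nA(4)[OF assms(3)] by simp
    show "?h (a \<otimes>\<^bsub>AG\<^esub> b) = ?h a \<otimes>\<^bsub>AG\<^esub> ?h b" if "a \<in> carrier AG" "b \<in> carrier AG" for a b
      using that Ac gc(1) by (simp add: word subset_eq)
  qed
  have q: "?q \<in> cosets \<rightarrow> carrier AG" using quot_funcset assms by simp
  have "quot (shift g t) (shift g t') = finprod AG (\<lambda>C. ?h (?q (inv g <# C))) cosets"
    unfolding quot_def
  proof (rule AG.finprod_cong')
    show "(\<lambda>C. ?h (?q (inv g <# C))) \<in> cosets \<rightarrow> carrier AG"
      using quot_funcset[OF assms(1,2)] cosets_shift[OF gc(2)] nA(4)[OF assms(3)] by auto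
    fix C assume "C \<in> cosets"
    then have "inv g <# C \<in> cosets" by (rule cosets_shift[OF gc(2)])
    then have "t (inv g <# C) \<in> carrier G" "t' (inv g <# C) \<in> carrier G"
      using transversal_X assms Xc by blast+
    then show "shift g t C \<otimes> inv shift g t' C = ?h (?q (inv g <# C))"
      using gc by (simp add: shift_def word)
  qed simp
  also have "\<dots> = ?h (finprod AG (\<lambda>C. ?q (inv g <# C)) cosets)"
    by (rule AG.finprod_hom[OF hom]) (use q img in auto)
  also have "finprod AG (\<lambda>C. ?q (inv g <# C)) cosets = quot t t'"
    unfolding quot_def using AG.finprod_reindex[of ?q "\<lambda>C. inv g <# C" cosets] inj img q by simp
  finally show ?thesis .
qed

lemma quot_shift_A:
  assumes "transversal t" "a \<in> A"
  shows "quot (shift a t) t = a [^] index X A"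
proof -
  have "quot (shift a t) t = finprod AG (\<lambda>C. a) cosets"
    unfolding quot_def
  proof (rule AG.finprod_cong')
    fix C assume C: "C \<in> cosets"
    have "inv a <# C = C" by (rule coset_A_invariant[OF C]) (use assms nA(1) in \<open>simp add: sg\<close>)
    moreover have "t C \<in> carrier G" using transversal_X[OF assms(1) C] Xc by blast
    ultimately show "shift a t C \<otimes> inv t C = a" using assms Ac by (auto simp: shift_def word)
  qed (use assms in auto)
  also have "\<dots> = a [^] card cosets"
    using AG.finprod_const[of a cosets] assms(2) nat_pow_consistent by simp
  finally show ?thesis by (simp add: card_cosets)
qed

lemma shift_mult:
  assumes "transversal t" "g \<in> X" "h \<in> X" "C \<in> cosets"
  shows "shift (g \<otimes> h) t C = shift g (shift h t) C"
proof -
  have c: "g \<in> carrier G" "h \<in> carrier G" using assms Xc by auto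
  have C: "C \<subseteq> carrier G" using coset_carrier[OF assms(4)] Xc by blast
  have "inv (g \<otimes> h) <# C = inv h <# (inv g <# C)"
    using lcos_m_assoc[OF C, of "inv h" "inv g"] c by (simp add: inv_mult_group)
  moreover have "t (inv h <# (inv g <# C)) \<in> carrier G"
    using transversal_X[OF assms(1) cosets_shift[OF _ cosets_shift[OF _ assms(4)]]] assms nA(2) Xc
    by (auto simp: sg)
  ultimately show ?thesis using c by (simp add: shift_def m_assoc)
qed

lemma root_exists:
  assumes "c \<in> A" shows "\<exists>a\<in>A. a [^] index X A = c"
proof -
  have "card A > 0" by (rule card_pos[OF nA(1)])
  then obtain x y where xy: "index X A * x = card A * y + 1"
    using coprime_bezout_strong[of "index X A" "card A"] coprime
    by (metis coprime_commute mult_cancel_left bezout_nat coprime_iff_gcd_eq_1 index_pos[OF nA(1,2,3)] less_not_refl2)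
  have cc: "c \<in> carrier G" using assms Ac by blast
  have p: "c [^] card A = \<one>"
    using AG.pow_card_carrier[of c] assms finite_subgroup[OF nA(1)] nat_pow_consistent by simp
  have "(c [^] x) [^] index X A = c [^] (card A * y + 1)"
    using cc xy by (simp add: nat_pow_pow mult.commute)
  also have "\<dots> = (c [^] card A) [^] y \<otimes> c" using cc by (simp add: nat_pow_mult[symmetric] nat_pow_pow)
  also have "\<dots> = c" using cc p by simp
  finally have "(c [^] x) [^] index X A = c" .
  moreover have "c [^] x \<in> A"
    using AG.nat_pow_closed[of c x] assms nat_pow_consistent by simp
  ultimately show ?thesis by blast
qed

lemma quot_shift_mult:
  assumes "transversal t" "g \<in> X" "h \<in> X"
  shows "quot (shift (g \<otimes> h) t) t = g \<otimes> quot (shift h t) t \<otimes> inv g \<otimes> quot (shift g t) t"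
proof -
  have "quot (shift (g \<otimes> h) t) t = quot (shift g (shift h t)) t"
    by (rule quot_cong) (use assms shift_mult transversal_shift in auto)
  also have "\<dots> = quot (shift g (shift h t)) (shift g t) \<otimes> quot (shift g t) t"
    using quot_trans[of "shift g (shift h t)" "shift g t" t] assms transversal_shift by simp
  finally show ?thesis using quot_shift[of "shift h t" t g] assms transversal_shift by simp
qed

lemma stab_subset: "stab t \<subseteq> X"
  by (auto simp: stab_def)

lemma subgroup_stab:
  assumes "transversal t" shows "subgroup (stab t) G"
proof (rule subgroupI)
  show "stab t \<subseteq> carrier G" using stab_subset Xc by blast
  have "quot (shift \<one> t) t = \<one>"
    using quot_shift_A[OF assms, of \<one>] nA(1) by (simp add: sg)
  then show "stab t \<noteq> {}" using nA(2) sg(3) by (auto simp: stab_def)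
  fix g assume g: "g \<in> stab t"
  have gX: "g \<in> X" "inv g \<in> X" using g nA(2) by (auto simp: stab_def sg)
  have gc: "g \<in> carrier G" using gX Xc by blast
  have q: "quot (shift (inv g) t) t \<in> carrier G"
    using quot_closed[OF transversal_shift[OF assms gX(2)] assms] Ac by blast
  have "\<one> = g \<otimes> quot (shift (inv g) t) t \<otimes> inv g \<otimes> \<one>"
    using quot_shift_mult[OF assms gX] g gc \<open>quot (shift \<one> t) t = \<one>\<close> by (simp add: stab_def)
  then have "quot (shift (inv g) t) t = inv g \<otimes> \<one> \<otimes> g"
    using gc q by (simp add: word inv_solve_left')
  then show "inv g \<in> stab t" using gX gc by (simp add: stab_def)
  fix h assume h: "h \<in> stab t"
  have hX: "h \<in> X" using h by (auto simp: stab_def)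
  show "g \<otimes> h \<in> stab t"
    using quot_shift_mult[OF assms gX(1) hX] g h gc hX gX nA(2) by (simp add: stab_def sg)
qed

lemma card_stab:
  assumes "transversal t" shows "card (stab t) = index X A"
proof -
  have 1: "A \<inter> stab t = {\<one>}"
  proof -
    have "a = \<one>" if a: "a \<in> A" "a \<in> stab t" for a
    proof -
      have e: "a [^] index X A = \<one>" using quot_shift_A[OF assms a(1)] a(2) by (simp add: stab_def)
      have ac: "a \<in> carrier G" using a Ac by blast
      have p: "a [^] card A = \<one>"
        using AG.pow_card_carrier[of a] a finite_subgroup[OF nA(1)] nat_pow_consistent by simp
      have "ord a dvd card A" "ord a dvd index X A" using pow_eq_id[OF ac] e p by auto
      then have "ord a = 1" using coprime by (metis coprime_common_divisor_nat)
      then show ?thesis using ord_eq_1[OF ac] by simp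
    qed
    then show ?thesis using sg(3)[OF nA(1)] sg(3)[OF subgroup_stab[OF assms]] by blast
  qed
  have "X \<subseteq> A <#> stab t"
  proof
    fix g assume g: "g \<in> X"
    have q: "quot (shift g t) t \<in> A" using quot_closed transversal_shift assms g by blast
    then obtain a where a: "a \<in> A" "a [^] index X A = inv (quot (shift g t) t)"
      using root_exists sg(2)[OF nA(1)] by blast
    have aX: "a \<in> X" using a nA(3) by blast
    have c: "a \<in> carrier G" "g \<in> carrier G" "quot (shift g t) t \<in> carrier G" using aX g Xc q Ac by blast+
    have "quot (shift (a \<otimes> g) t) t = a \<otimes> quot (shift g t) t \<otimes> inv a \<otimes> inv (quot (shift g t) t)"
      using quot_shift_mult[OF assms aX g] quot_shift_A[OF assms a(1)] a(2) by simp
    also have "a \<otimes> quot (shift g t) t = quot (shift g t) t \<otimes> a" by (rule commute[OF a(1) q])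
    finally have "quot (shift (a \<otimes> g) t) t = \<one>" using c by (simp add: word)
    then have "a \<otimes> g \<in> stab t" using aX g nA(2) by (simp add: stab_def sg)
    moreover have "g = inv a \<otimes> (a \<otimes> g)" using c by simp
    ultimately show "g \<in> A <#> stab t" using sg(2)[OF nA(1) a(1)] by (auto simp: set_mult_def)
  qed
  then have "A <#> stab t = X" using set_mult_subset[OF nA(2,3) stab_subset] by blast
  then have "card X = card A * card (stab t)"
    using card_set_mult[OF nA(1) subgroup_stab[OF assms]] 1 by simp
  then show ?thesis using card_pos[OF nA(1)] by (simp add: index_def)
qed

lemma complement_is_stab:
  assumes B: "subgroup B G" "B \<subseteq> X" "card B = index X A"
  shows "\<exists>t. transversal t \<and> stab t = B"
proof -
  have "coprime (card A) (card B)" "card A * card B = card X"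
    using coprime B(3) card_index[OF nA(1-3)] by auto
  then have AB1: "A \<inter> B = {\<one>}" and AB: "A <#> B = X"
    using coprime_factorisation[OF nA(1) B(1) nA(2,3) B(2)] by auto
  have ex: "\<exists>b. b \<in> B \<and> b \<in> C" if "C \<in> cosets" for C
  proof -
    obtain x where x: "x \<in> X" "C = x <# A" using \<open>C \<in> cosets\<close> by (auto simp: cosets_def)
    then obtain a b where ab: "a \<in> A" "b \<in> B" "x = a \<otimes> b" using AB by (auto simp: set_mult_def)
    have c: "a \<in> carrier G" "b \<in> carrier G" using ab Ac B Xc by blast+
    have "b = x \<otimes> (inv b \<otimes> inv a \<otimes> b)" using ab c by (simp add: word)
    moreover have "inv b \<otimes> inv a \<otimes> b \<in> A"
      by (rule normal_inD2[OF normal]) (use ab B nA in \<open>auto simp: sg\<close>)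
    ultimately show ?thesis using x ab by (auto simp: l_coset_def)
  qed
  define t where "t C = (SOME b. b \<in> B \<and> b \<in> C)" for C
  have t: "t C \<in> B \<and> t C \<in> C" if "C \<in> cosets" for C
    using someI_ex[OF ex[OF that]] by (simp add: t_def)
  have tr: "transversal t" using t by (simp add: transversal_def)
  have uniq: "b = b'" if "C \<in> cosets" "b \<in> C" "b' \<in> C" "b \<in> B" "b' \<in> B" for b b' C
  proof -
    have "b \<otimes> inv b' \<in> A \<inter> B" using coset_quotient[OF that(1-3)] that B(1) by (simp add: sg)
    then have "b \<otimes> inv b' = \<one>" using AB1 by blast
    moreover have "b \<in> carrier G" "b' \<in> carrier G" using that B mem_carrier by blast+
    ultimately show ?thesis by (metis inv_equality inv_inv inv_closed)
  qed
  have "B \<subseteq> stab t"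
  proof
    fix b assume b: "b \<in> B"
    then have bX: "b \<in> X" using B by blast
    have "shift b t C = t C" if C: "C \<in> cosets" for C
    proof (rule uniq[OF C])
      show "shift b t C \<in> C" using transversal_shift[OF tr bX] C by (rule transversalD)
      have "inv b <# C \<in> cosets" using cosets_shift[OF _ C] bX nA(2) by (simp add: sg)
      then show "shift b t C \<in> B" using t b B(1) by (simp add: shift_def sg)
    qed (use t C in auto)
    then have "quot (shift b t) t = quot t t" by (intro quot_cong) (use tr in auto)
    then show "b \<in> stab t" using bX quot_self[OF tr] by (simp add: stab_def)
  qed
  then have "B = stab t" using subgroup_eqI_card[OF B(1) subgroup_stab[OF tr]] card_stab[OF tr] B(3) by simp
  then show ?thesis using tr by blast
qed

lemma complement_exists: "\<exists>B. subgroup B G \<and> B \<subseteq> X \<and> card B = index X A"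
proof -
  define t where "t C = (SOME b. b \<in> C)" for C :: "'a set"
  have "t C \<in> C" if "C \<in> cosets" for C
  proof -
    obtain x where x: "x \<in> X" "C = x <# A" using \<open>C \<in> cosets\<close> by (auto simp: cosets_def)
    have "x \<in> C" unfolding x(2) by (rule lcos_self[OF _ nA(1)]) (use x Xc in blast)
    then show ?thesis unfolding t_def by (rule someI)
  qed
  then have "transversal t" by (simp add: transversal_def)
  then show ?thesis using subgroup_stab card_stab stab_subset by blast
qed

lemma complements_conjugate:
  assumes B: "subgroup B G" "B \<subseteq> X" "card B = index X A"
    and B': "subgroup B' G" "B' \<subseteq> X" "card B' = index X A"
  shows "\<exists>a\<in>A. conj_by a B = B'"
proof -
  obtain t where t: "transversal t" "stab t = B" using complement_is_stab[OF B] by blast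
  obtain t' where t': "transversal t'" "stab t' = B'" using complement_is_stab[OF B'] by blast
  have q: "quot t t' \<in> A" by (rule quot_closed[OF t(1) t'(1)])
  then obtain a where a: "a \<in> A" "a [^] index X A = inv (quot t t')"
    using root_exists sg(2)[OF nA(1)] by blast
  have aX: "a \<in> X" using a nA(3) by blast
  have ac: "a \<in> carrier G" using a Ac by blast
  let ?s = "shift a t"
  have s: "transversal ?s" by (rule transversal_shift[OF t(1) aX])
  have st: "quot ?s t' = \<one>"
    using quot_trans[OF s t(1) t'(1)] quot_shift_A[OF t(1) a(1)] a(2) q Ac by (metis l_inv subsetD)
  have ts: "quot t' ?s = \<one>"
    using quot_trans[OF t'(1) s t'(1)] st quot_self[OF t'(1)] quot_closed[OF t'(1) s] Ac
    by (metis r_one subsetD)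
  have "conj_by a B \<subseteq> B'"
  proof
    fix h assume "h \<in> conj_by a B"
    then obtain g where g: "g \<in> B" "h = a \<otimes> g \<otimes> inv a" by (auto simp: conj_by_def)
    have gX: "g \<in> X" using g B by blast
    have gc: "g \<in> carrier G" using gX Xc by blast
    have hX: "h \<in> X" unfolding g(2) using gX aX nA(2) by (simp add: sg)
    have hc: "h \<in> carrier G" using hX Xc by blast
    have h: "h \<otimes> a = a \<otimes> g" using g(2) ac gc by (simp add: word)
    have tg: "transversal (shift g t)" by (rule transversal_shift[OF t(1) gX])
    have 1: "quot (shift h ?s) ?s = \<one>"
    proof -
      have "quot (shift h ?s) ?s = quot (shift a (shift g t)) ?s"
      proof (rule quot_cong)
        fix C assume C: "C \<in> cosets"
        show "shift h ?s C = shift a (shift g t) C"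
          using shift_mult[OF t(1) hX aX C] shift_mult[OF t(1) aX gX C] h by simp
      qed (use s tg transversal_shift aX in auto)
      also have "\<dots> = a \<otimes> quot (shift g t) t \<otimes> inv a" by (rule quot_shift[OF tg t(1) aX])
      also have "quot (shift g t) t = \<one>" using g(1) t(2) by (auto simp: stab_def)
      finally show ?thesis using ac by simp
    qed
    have th: "transversal (shift h t')" "transversal (shift h ?s)"
      using transversal_shift[OF _ hX] t'(1) s by auto
    have 2: "quot (shift h t') (shift h ?s) = \<one>"
      using quot_shift[OF t'(1) s hX] ts hc by simp
    have "quot (shift h t') t' = quot (shift h t') (shift h ?s) \<otimes> (quot (shift h ?s) ?s \<otimes> quot ?s t')"
      using quot_trans[OF th(2) s t'(1)] quot_trans[OF th t'(1)] by simp
    then have "quot (shift h t') t' = \<one>" using 1 2 st by simp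
    then show "h \<in> B'" using hX t'(2) by (auto simp: stab_def)
  qed
  moreover have "card (conj_by a B) = card B'"
    using card_conj_by[OF ac] B B' subgroup.subset by metis
  ultimately have "conj_by a B = B'"
    using subgroup_eqI_card[OF subgroup_conj_by[OF B(1) ac] B'(1)] by blast
  then show ?thesis using a(1) by blast
qed

end

context finite_group
begin

text \<open>A conjugate of a complement \<open>B\<close> of \<open>A\<close> in the normal subgroup \<open>M\<close> is again such a complement, hence a
  conjugate under \<open>A\<close>.\<close>

lemma Frattini_complement:
  assumes A: "normal_in A X" "\<And>a b. a \<in> A \<Longrightarrow> b \<in> A \<Longrightarrow> a \<otimes> b = b \<otimes> a"
    and M: "normal_in M X" "A \<subseteq> M" "coprime (card A) (index M A)"
    and B: "subgroup B G" "B \<subseteq> M" "card B = index M A"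
  shows "A <#> normalizer_in X B = X"
proof (rule Frattini_argument[OF A(1)])
  note m = normal_inD[OF M(1)]
  show Bc: "B \<subseteq> carrier G" using B(1) by (rule subgroup.subset)
  interpret coprime_abelian_normal G A M
    by unfold_locales (use A M normal_in_between[OF A(1) m(1) M(2) m(3)] in auto)
  fix x assume x: "x \<in> X"
  have xc: "x \<in> carrier G" using x m mem_carrier by blast
  have "conj_by x B \<subseteq> M" using conj_by_mono[OF B(2)] normal_in_conj_by[OF M(1) x] by blast
  then obtain a where "a \<in> A" "conj_by a B = conj_by x B"
    using complements_conjugate[OF B subgroup_conj_by[OF B(1) xc]] card_conj_by[OF xc Bc] B(3) by auto
  then show "\<exists>a\<in>A. conj_by x B = conj_by a B" by metis
qed

end

text \<open>A Sylow subgroup \<open>P\<close> of \<open>N\<close> either has a proper normaliser, which contains a complement by the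
  Frattini argument and induction, or it is normal. In the second case its centre is an abelian normal subgroup: a
  complement modulo the centre has a complement of the centre.\<close>

theorem Schur_Zassenhaus:
  fixes G :: "('a, 'b) monoid_scheme"
  assumes "finite_group G" "group.normal_in G N X" "coprime (card N) (index X N)"
  shows "\<exists>B. subgroup B G \<and> B \<subseteq> X \<and> card B = index X N"
  using assms
proof (induction "card X" arbitrary: G N X rule: less_induct)
  case less
  interpret finite_group G by (rule less.prems(1))
  note N = less.prems(2) and cop = less.prems(3)
  note n = normal_inD[OF N]
  show ?case
  proof (cases "N = {\<one>\<^bsub>G\<^esub>}")
    case True
    then show ?thesis using n by (auto simp: index_triv)
  next
    case False
    obtain p where p: "prime p" "p dvd card N" using nontrivial_prime_divisor[OF n(1) False] by blast
    obtain P where P: "sylow_of p P N" using sylow_exists[OF p(1) n(1)] by blast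
    note s = sylow_ofD[OF P]
    have Pne: "P \<noteq> {\<one>\<^bsub>G\<^esub>}" by (rule sylow_of_nontrivial[OF P p(2)])
    let ?Y = "normalizer_in X P"
    have PX: "P \<subseteq> X" using s(3) n(3) by blast
    have Y: "subgroup ?Y G" "?Y \<subseteq> X" using subgroup_normalizer_in[OF n(2) PX] normalizer_in_subset by auto
    show ?thesis
    proof (cases "?Y = X")
      case False
      have lt: "card ?Y < card X"
        using False Y finite_subgroup[OF n(2)] by (metis psubsetI psubset_card_mono)
      have NY: "normal_in (N \<inter> ?Y) ?Y" by (rule normal_in_restrict[OF N Y])
      have ind: "index X N = index ?Y (N \<inter> ?Y)"
        by (rule index_Int_factor[OF n(1) Y(1) Frattini_sylow[OF N P] n(2,3)])
      have "card (N \<inter> ?Y) dvd card N"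
        by (rule card_dvd) (use normal_inD(1)[OF NY] n in auto)
      then have "coprime (card (N \<inter> ?Y)) (index ?Y (N \<inter> ?Y))"
        using cop ind by (metis coprime_divisors dvd_refl)
      from less.hyps[OF lt less.prems(1) NY this] show ?thesis using Y ind by auto
    next
      case True
      have PnX: "normal_in P X" using True normalizer_in_eq_iff[OF n(2) s(2) PX] by simp
      define Z where "Z = centre P"
      have Z: "normal_in Z X" unfolding Z_def by (rule normal_in_centre[OF PnX])
      note z = normal_inD[OF Z]
      have ZN: "Z \<subseteq> N" using s(3) by (auto simp: Z_def centralizer_in_def)
      have "Z \<noteq> {\<one>\<^bsub>G\<^esub>}"
        unfolding Z_def using s centre_prime_power_nontrivial[OF s(2) _ p(1) Pne] by blast
      obtain H :: "('a, 'b) monoid_scheme" and f where ep: "epimorphism G H X Z f"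
        using quotient_on_same_type[OF Z] by blast
      interpret e: epimorphism G H X Z f by (rule ep)
      have nH: "e.cod.normal_in (f ` N) (carrier H)"
        using e.normal_in_image[OF N] e.onto by simp
      have cZ: "card Z > 1" using card_pos[OF z(1)] card_1_iff[OF z(1)] \<open>Z \<noteq> _\<close> by linarith
      have lt: "card (carrier H) < card X"
        using card_index[OF z(1-3)] index_pos[OF z(1-3)] cZ by (simp add: e.card_codomain)
      have ind: "index (carrier H) (f ` N) = index X N"
        using e.index_image[OF n(1,2,3) _ ZN] e.onto by simp
      have cN: "card N = card Z * index N Z" by (rule card_index[OF z(1) n(1) ZN])
      have "card (f ` N) = index N Z" by (rule e.card_image_kernel[OF n(1,3) ZN])
      then have "coprime (card (f ` N)) (index (carrier H) (f ` N))"
        using cop ind cN by simp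
      from less.hyps[OF lt e.cod.finite_group_axioms nH this] ind
      obtain B where B: "subgroup B H" "card B = index X N" by auto
      let ?C = "e.pre B"
      have C: "subgroup ?C G" "?C \<subseteq> X" "Z \<subseteq> ?C"
        using e.subgroup_pre[OF B(1)] e.pre_subset e.kernel_le_pre[OF B(1)] by auto
      have ZC: "normal_in Z ?C" by (rule normal_in_between[OF Z C(1,3,2)])
      have iC: "index ?C Z = index X N"
        using e.card_pre[OF B(1)] B(2) card_pos[OF z(1)] by (simp add: index_def)
      interpret coprime_abelian_normal G Z ?C
      proof unfold_locales
        show "normal_in Z ?C" by (rule ZC)
        show "coprime (card Z) (index ?C Z)" using cop cN iC by simp
        show "a \<otimes>\<^bsub>G\<^esub> b = b \<otimes>\<^bsub>G\<^esub> a" if "a \<in> Z" "b \<in> Z" for a b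
          using that unfolding Z_def centralizer_in_def by blast
      qed
      obtain B' where "subgroup B' G" "B' \<subseteq> ?C" "card B' = index ?C Z"
        using complement_exists by blast
      then show ?thesis unfolding iC using C(2) by (intro exI[of _ B']) simp
    qed
  qed
qed

context finite_group
begin

text \<open>A complement of \<open>N / Q\<close> in \<open>X / Q\<close>.\<close>

lemma Schur_Zassenhaus_relative:
  assumes "normal_in Q X" "normal_in N X" "Q \<subseteq> N" "coprime (index N Q) (index X N)"
  shows "\<exists>B. subgroup B G \<and> Q \<subseteq> B \<and> B \<subseteq> X \<and> card B = card Q * index X N"
proof -
  note n = normal_inD[OF assms(2)]
  obtain H :: "('a, 'b) monoid_scheme" and f where ep: "epimorphism G H X Q f"
    using quotient_on_same_type[OF assms(1)] by blast
  interpret e: epimorphism G H X Q f by (rule ep)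
  have nH: "e.cod.normal_in (f ` N) (carrier H)"
    using e.normal_in_image[OF assms(2)] e.onto by simp
  have ind: "index (carrier H) (f ` N) = index X N"
    using e.index_image[OF n(1,2,3) _ assms(3)] e.onto by simp
  have "card (f ` N) = index N Q" by (rule e.card_image_kernel[OF n(1,3) assms(3)])
  then have "\<exists>B. subgroup B H \<and> B \<subseteq> carrier H \<and> card B = index X N"
    using Schur_Zassenhaus[OF e.cod.finite_group_axioms nH] assms(4) ind by simp
  then obtain B where "subgroup B H" "card B = index X N" by blast
  then show ?thesis using e.subgroup_pre e.pre_subset e.kernel_le_pre e.card_pre by metis
qed

end

context finite_group
begin

lemma index_Int_dvd:
  assumes "normal_in N X" "subgroup M G" "N \<subseteq> M" "M \<subseteq> X" "subgroup Y G" "Y \<subseteq> X"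
  shows "index (M \<inter> Y) (N \<inter> Y) dvd index M N"
proof -
  note n = normal_inD[OF assms(1)]
  have MY: "subgroup (M \<inter> Y) G" using assms subgroups_Inter_pair by blast
  have NM: "normal_in N M" by (rule normal_in_between[OF assms(1,2,3,4)])
  have "index ((M \<inter> Y) <#> N) N = index (M \<inter> Y) (M \<inter> Y \<inter> N)"
    by (rule index_set_mult[OF MY _ NM]) blast
  moreover have "M \<inter> Y \<inter> N = N \<inter> Y" using assms(3) by blast
  moreover have "index ((M \<inter> Y) <#> N) N dvd index M N"
    by (rule index_dvd(1)) (use subgroup_set_mult[OF MY _ NM] n assms in auto)
  ultimately show ?thesis by simp
qed

lemma index_normal_Int_dvd:
  assumes "normal_in N X" "subgroup R G" "R \<subseteq> X"
  shows "index N (N \<inter> R) dvd index X R"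
proof -
  note n = normal_inD[OF assms(1)] and t = subgroup_set_mult[OF assms(2,3,1)]
  have D: "subgroup (N \<inter> R) G" using assms n subgroups_Inter_pair by blast
  have "card R * card (N \<inter> R) * index (R <#> N) R = card R * card (N \<inter> R) * index N (N \<inter> R)"
    using card_set_mult[OF assms(2) n(1)] card_index[OF D n(1)] card_index[OF assms(2) t(1,3)]
    by (simp add: ac_simps Int_commute)
  then have "index (R <#> N) R = index N (N \<inter> R)" using card_pos[OF D] card_pos[OF assms(2)] by simp
  then show ?thesis using index_dvd(1)[of R "R <#> N" X] t n assms by simp
qed

section \<open>Maximal subgroups and maximal chains\<close>

definition maximal_in :: "'a set \<Rightarrow> 'a set \<Rightarrow> bool" where
  "maximal_in M X \<longleftrightarrow> subgroup M G \<and> subgroup X G \<and> M \<subset> X \<and>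
     (\<forall>K. subgroup K G \<longrightarrow> M \<subseteq> K \<longrightarrow> K \<subseteq> X \<longrightarrow> K = M \<or> K = X)"

lemma maximal_inD:
  assumes "maximal_in M X"
  shows "subgroup M G" "subgroup X G" "M \<subseteq> X" "M \<noteq> X"
    "\<And>K. subgroup K G \<Longrightarrow> M \<subseteq> K \<Longrightarrow> K \<subseteq> X \<Longrightarrow> K = M \<or> K = X"
  using assms by (auto simp: maximal_in_def)

lemma maximal_exists:
  assumes "subgroup A G" "subgroup X G" "A \<subseteq> X" "A \<noteq> X"
  shows "\<exists>M. A \<subseteq> M \<and> maximal_in M X"
proof -
  let ?F = "{M. subgroup M G \<and> A \<subseteq> M \<and> M \<subset> X}"
  have "finite ?F" by (rule finite_subset[of _ "Pow X"]) (use finite_subgroup[OF assms(2)] in auto)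
  moreover have "A \<in> ?F" using assms by auto
  ultimately have "\<exists>M\<in>?F. A \<subseteq> M \<and> (\<forall>K\<in>?F. M \<subseteq> K \<longrightarrow> M = K)"
    by (rule finite_has_maximal2)
  then obtain M where M0: "M \<in> ?F" "\<forall>K\<in>?F. M \<subseteq> K \<longrightarrow> M = K" by (elim bexE conjE)
  then have M: "subgroup M G" "A \<subseteq> M" "M \<subset> X"
    "\<And>K. subgroup K G \<Longrightarrow> A \<subseteq> K \<Longrightarrow> K \<subset> X \<Longrightarrow> M \<subseteq> K \<Longrightarrow> M = K" by simp_all
  have "K = M \<or> K = X" if "subgroup K G" "M \<subseteq> K" "K \<subseteq> X" for K
    using M(4)[OF that(1) _ _ that(2)] M(2) that by (cases "K = X") auto
  then have "maximal_in M X" unfolding maximal_in_def using M(1,3) assms(2) by simp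
  then show ?thesis using M by blast
qed

lemma maximal_set_mult:
  assumes "maximal_in M X" "normal_in N X" "\<not> N \<subseteq> M"
  shows "M <#> N = X"
proof -
  note m = maximal_inD[OF assms(1)]
  note s = subgroup_set_mult[OF m(1,3) assms(2)]
  show ?thesis using m(5)[OF s(1,3,2)] s(4) assms(3) by auto
qed

lemma maximal_index_dvd:
  assumes "maximal_in M X" "normal_in N X" "\<not> N \<subseteq> M"
  shows "index X M = index N (M \<inter> N)"
  using index_Int_factor[OF maximal_inD(1)[OF assms(1)] normal_inD(1)[OF assms(2)] maximal_set_mult[OF assms]]
    maximal_inD[OF assms(1)] by simp

text \<open>\<open>maximal_chain X k A\<close> says that \<open>A\<close> is a \<open>k\<close>-maximal subgroup of \<open>X\<close>, where \<open>X\<close> itself is \<open>0\<close>-maximal.\<close>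

inductive maximal_chain :: "'a set \<Rightarrow> nat \<Rightarrow> 'a set \<Rightarrow> bool" for X where
  maximal_chain_0: "subgroup X G \<Longrightarrow> maximal_chain X 0 X"
| maximal_chain_Suc: "maximal_in A B \<Longrightarrow> maximal_chain X k B \<Longrightarrow> maximal_chain X (Suc k) A"

lemma maximal_chainD:
  assumes "maximal_chain X k A"
  shows "subgroup A G" "subgroup X G" "A \<subseteq> X"
proof -
  from assms have "subgroup A G \<and> subgroup X G \<and> A \<subseteq> X"
    by induction (auto dest: maximal_inD)
  then show "subgroup A G" "subgroup X G" "A \<subseteq> X" by auto
qed

lemma maximal_chain_1: "maximal_in A X \<Longrightarrow> maximal_chain X 1 A"
  using maximal_chain_Suc[OF _ maximal_chain_0] maximal_inD(2) by simp

lemma maximal_chain_trans: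
  "maximal_chain B i A \<Longrightarrow> maximal_chain X j B \<Longrightarrow> maximal_chain X (i + j) A"
  by (induction rule: maximal_chain.induct) (auto intro: maximal_chain_Suc)

lemma maximal_chain_split:
  "maximal_chain X (i + j) A \<Longrightarrow> \<exists>B. maximal_chain B i A \<and> maximal_chain X j B"
proof (induction i arbitrary: A)
  case 0
  then show ?case using maximal_chain_0[OF maximal_chainD(1)] by auto
next
  case (Suc i)
  from Suc.prems obtain C where C: "maximal_in A C" "maximal_chain X (i + j) C"
    by (auto elim: maximal_chain.cases)
  from Suc.IH[OF C(2)] C(1) show ?case by (blast intro: maximal_chain_Suc)
qed

lemma maximal_chain_exists:
  assumes "subgroup A G" "subgroup X G" "A \<subseteq> X"
  shows "\<exists>k. maximal_chain X k A"
  using assms(2,3)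
proof (induction "card X" arbitrary: X rule: less_induct)
  case less
  show ?case
  proof (cases "A = X")
    case True then show ?thesis using maximal_chain_0[OF assms(1)] by blast
  next
    case False
    obtain M where M: "A \<subseteq> M" "maximal_in M X" using maximal_exists[OF assms(1) less.prems False] by blast
    note m = maximal_inD[OF M(2)]
    have "card M < card X" using m finite_subgroup[OF m(2)] by (metis psubsetI psubset_card_mono)
    then obtain k where "maximal_chain M k A" using less.hyps m(1) M(1) by blast
    then show ?thesis using maximal_chain_trans[OF _ maximal_chain_1[OF M(2)]] by blast
  qed
qed

lemma maximal_chain_exists_proper:
  assumes "subgroup A G" "subgroup X G" "A \<subseteq> X" "A \<noteq> X"
  shows "\<exists>k. maximal_chain X (Suc k) A"
proof -
  obtain k where k: "maximal_chain X k A" using maximal_chain_exists[OF assms(1-3)] by blast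
  then have "k \<noteq> 0" using assms(4) by (auto elim: maximal_chain.cases)
  then show ?thesis using k by (metis not0_implies_Suc)
qed

end

section \<open>Series with factors belonging to the classes of a partition\<close>

locale classed_group = finite_group +
  fixes S :: "nat set set"
  assumes class_exists: "prime p \<Longrightarrow> \<exists>s\<in>S. p \<in> s"
    and class_unique: "s \<in> S \<Longrightarrow> t \<in> S \<Longrightarrow> p \<in> s \<Longrightarrow> p \<in> t \<Longrightarrow> s = t"
begin

definition prime_classes :: "nat \<Rightarrow> nat set set" where
  "prime_classes n = {s \<in> S. \<exists>p\<in>s. prime p \<and> p dvd n}"

lemma prime_classes_mult: "prime_classes (m * n) = prime_classes m \<union> prime_classes n"
  by (auto simp: prime_classes_def prime_dvd_mult_iff)

lemma prime_classes_1 [simp]: "prime_classes (Suc 0) = {}"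
  by (auto simp: prime_classes_def)

lemma prime_classes_pi_number: "s \<in> S \<Longrightarrow> pi_number s n \<Longrightarrow> prime_classes n \<subseteq> {s}"
  unfolding prime_classes_def pi_number_def by (auto dest: class_unique)

lemma class_disjoint: "s \<in> S \<Longrightarrow> t \<in> S \<Longrightarrow> s \<noteq> t \<Longrightarrow> s \<inter> t = {}"
  using class_unique by blast

lemma pi_number_class_neq: "s \<in> S \<Longrightarrow> t \<in> S \<Longrightarrow> s \<noteq> t \<Longrightarrow> pi_number t n \<Longrightarrow> pi_number (- s) n"
  using class_disjoint by (auto elim!: pi_number_mono)

lemma finite_prime_classes:
  assumes "n > 0" shows "finite (prime_classes n)"
proof (rule finite_subset)
  show "prime_classes n \<subseteq> (\<lambda>p. THE s. s \<in> S \<and> p \<in> s) ` {p. p dvd n}"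
  proof
    fix s assume "s \<in> prime_classes n"
    then obtain p where p: "s \<in> S" "p \<in> s" "p dvd n" by (auto simp: prime_classes_def)
    then have "(THE s. s \<in> S \<and> p \<in> s) = s" by (intro the_equality) (auto dest: class_unique)
    then show "s \<in> (\<lambda>p. THE s. s \<in> S \<and> p \<in> s) ` {p. p dvd n}" using p(3) by force
  qed
  show "finite ((\<lambda>p. THE s. s \<in> S \<and> p \<in> s) ` {p. p dvd n})" using assms by simp
qed

lemma pi_number_prime_class:
  assumes "prime p" obtains s where "s \<in> S" "pi_number s (p ^ k)"
proof -
  obtain s where "s \<in> S" "p \<in> s" using class_exists[OF assms] by blast
  then show thesis using pi_number_mono[OF pi_number_prime_power[OF assms, of k], of s] that by simp
qed

text \<open>A Sylow subgroup that is not contained in \<open>M\<close> generates the group together with \<open>M\<close>, so the index is a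
  prime power.\<close>

lemma maximal_normal_index_primary:
  assumes "maximal_in M X" "normal_in M X"
  shows "\<exists>s\<in>S. pi_number s (index X M)"
proof -
  note m = maximal_inD[OF assms(1)]
  have "index X M \<noteq> 1" using index_eq_1[OF m(1-3)] m(4) by simp
  then obtain p where p: "prime p" "p dvd index X M" using prime_factor_nat by blast
  obtain P where P: "sylow_of p P X" using sylow_exists[OF p(1) m(2)] by blast
  note q = sylow_ofD[OF P]
  have "\<not> P \<subseteq> M"
  proof
    assume "P \<subseteq> M"
    then have "index X M dvd index X P" using index_dvd(2)[OF q(2) m(1,2)] m(3) by simp
    then show False using p(2) q(5) by (meson dvd_trans)
  qed
  note t = subgroup_set_mult[OF q(2,3) assms(2)]
  have "P <#> M = X" using m(5)[OF t(1,4,2)] t(3) \<open>\<not> P \<subseteq> M\<close> by auto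
  then have "index X M = index P (P \<inter> M)" using index_set_mult[OF q(2,3) assms(2)] by simp
  moreover have "subgroup (P \<inter> M) G" by (rule subgroups_Inter_pair[OF q(2) m(1)])
  ultimately have d: "index X M dvd card P" using index_dvd_card[OF _ q(2)] by simp
  obtain k where "card P = p ^ k" using q(4) by blast
  moreover obtain s where "s \<in> S" "pi_number s (p ^ k)" using pi_number_prime_class[OF p(1)] by blast
  ultimately show ?thesis using d pi_number_dvd by metis
qed

inductive soluble_series :: "'a set \<Rightarrow> 'a set \<Rightarrow> bool" for X where
  soluble_series_triv: "subgroup X G \<Longrightarrow> soluble_series X {\<one>}"
| soluble_series_step: "soluble_series X N \<Longrightarrow> normal_in M X \<Longrightarrow> N \<subseteq> M \<Longrightarrow> s \<in> S \<Longrightarrow>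
    pi_number s (index M N) \<Longrightarrow> soluble_series X M"

lemma soluble_series_normal: "soluble_series X N \<Longrightarrow> normal_in N X"
  by (induction rule: soluble_series.induct) (auto intro: normal_in_triv)

lemma soluble_series_restrict:
  assumes "soluble_series X N" "subgroup Y G" "Y \<subseteq> X"
  shows "soluble_series Y (N \<inter> Y)"
  using assms(1)
proof induction
  case soluble_series_triv
  have "{\<one>} \<inter> Y = {\<one>}" using sg(3)[OF assms(2)] by blast
  then show ?case using soluble_series.soluble_series_triv[OF assms(2)] by simp
next
  case (soluble_series_step N M s)
  note n = soluble_series_normal[OF soluble_series_step(1)] and m = normal_inD[OF soluble_series_step(2)]
  have "index (M \<inter> Y) (N \<inter> Y) dvd index M N"
    by (rule index_Int_dvd[OF n]) (use m assms soluble_series_step in auto)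
  then show ?case
    using soluble_series.soluble_series_step[OF soluble_series_step.IH
        normal_in_restrict[OF soluble_series_step(2) assms(2,3)] _ soluble_series_step(4)]
      soluble_series_step pi_number_dvd by blast
qed

lemma soluble_series_subgroup:
  "soluble_series X X \<Longrightarrow> subgroup Y G \<Longrightarrow> Y \<subseteq> X \<Longrightarrow> soluble_series Y Y"
  using soluble_series_restrict[of X X Y] by (simp add: Int_absorb1)

text \<open>Consider the first term \<open>K\<close> of the series that is not contained in \<open>M\<close>. Then \<open>M K\<close> is the whole group,
  and the index of \<open>M\<close> divides the order of a factor.\<close>

lemma soluble_maximal_index:
  assumes "soluble_series X X" "maximal_in M X"
  shows "\<exists>s\<in>S. pi_number s (index X M)"
proof -
  note m = maximal_inD[OF assms(2)]
  have "N \<subseteq> M \<or> (\<exists>s\<in>S. pi_number s (index X M))" if "soluble_series X N" for N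
    using that
  proof induction
    case soluble_series_triv
    then show ?case using sg(3)[OF m(1)] by simp
  next
    case (soluble_series_step N K s)
    show ?case
    proof (cases "N \<subseteq> M \<and> \<not> K \<subseteq> M")
      case True
      note k = normal_inD[OF soluble_series_step(2)]
      note n = normal_inD[OF soluble_series_normal[OF soluble_series_step(1)]]
      have D: "subgroup (M \<inter> K) G" by (rule subgroups_Inter_pair[OF m(1) k(1)])
      have "index K (M \<inter> K) dvd index K N"
        by (rule index_dvd(2)) (use D n k True soluble_series_step in auto)
      then show ?thesis
        using maximal_index_dvd[OF assms(2) soluble_series_step(2)] True soluble_series_step(4,5)
          pi_number_dvd by metis
    qed (use soluble_series_step in auto)
  qed
  from this[OF assms(1)] m show ?thesis by auto
qed

lemma card_prime_classes_maximal_chain: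
  "maximal_chain X k A \<Longrightarrow> soluble_series X X \<Longrightarrow> card (prime_classes (index X A)) \<le> k"
proof (induction k arbitrary: X)
  case 0
  then have "A = X" by (auto elim: maximal_chain.cases)
  then show ?case using index_self[OF maximal_chainD(1)[OF 0(1)]] by simp
next
  case (Suc k)
  obtain B where B: "maximal_chain B k A" "maximal_chain X 1 B"
    using maximal_chain_split[of X k 1 A] Suc.prems(1) by auto
  have "maximal_in B X" using B(2) by (auto elim!: maximal_chain.cases)
  note m = maximal_inD[OF this] and c = maximal_chainD[OF B(1)]
  obtain s where s: "s \<in> S" "pi_number s (index X B)"
    using soluble_maximal_index[OF Suc.prems(2) \<open>maximal_in B X\<close>] by blast
  have IH: "card (prime_classes (index B A)) \<le> k"
    by (rule Suc.IH[OF B(1) soluble_series_subgroup[OF Suc.prems(2) m(1,3)]])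
  have "prime_classes (index X A) \<subseteq> insert s (prime_classes (index B A))"
    using index_trans[OF c(1) m(1,2) c(3) m(3)] prime_classes_pi_number[OF s] by (auto simp: prime_classes_mult)
  moreover have "finite (prime_classes (index B A))" using finite_prime_classes index_pos[OF c(1) c(2) c(3)] by blast
  ultimately have "card (prime_classes (index X A)) \<le> Suc (card (prime_classes (index B A)))"
    using card_mono[of "insert s (prime_classes (index B A))" "prime_classes (index X A)"]
    by (simp add: card_insert_if split: if_splits)
  then show ?case using IH by simp
qed

lemma soluble_proper_normal:
  assumes "soluble_series X X" "X \<noteq> {\<one>}"
  shows "\<exists>K s. normal_in K X \<and> K \<noteq> X \<and> s \<in> S \<and> pi_number s (index X K)"
proof -
  have "M = {\<one>} \<or> (\<exists>K s. normal_in K X \<and> K \<subset> M \<and> s \<in> S \<and> pi_number s (index M K))"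
    if "soluble_series X M" for M
    using that
  proof induction
    case (soluble_series_step N M s)
    show ?case
    proof (cases "N = M")
      case False
      then have "N \<subset> M" using soluble_series_step(3) by blast
      then show ?thesis using soluble_series_step(4,5) soluble_series_normal[OF soluble_series_step(1)] by blast
    qed (use soluble_series_step in simp)
  qed simp
  from this[OF assms(1)] assms(2) show ?thesis by blast
qed

text \<open>The terms of a dispersive series are normal Hall subgroups: no class occurs in two nontrivial factors.\<close>

inductive dispersive_series :: "'a set \<Rightarrow> 'a set \<Rightarrow> bool" for X where
  dispersive_series_triv: "subgroup X G \<Longrightarrow> dispersive_series X {\<one>}"
| dispersive_series_step: "dispersive_series X N \<Longrightarrow> normal_in M X \<Longrightarrow> N \<subseteq> M \<Longrightarrow> s \<in> S \<Longrightarrow>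
    pi_number s (index M N) \<Longrightarrow> pi_number (- s) (card N) \<Longrightarrow> pi_number (- s) (index X M) \<Longrightarrow>
    dispersive_series X M"

lemma dispersive_series_normal: "dispersive_series X N \<Longrightarrow> normal_in N X"
  by (induction rule: dispersive_series.induct) (auto intro: normal_in_triv)

lemma dispersive_series_restrict:
  assumes "dispersive_series X N" "subgroup Y G" "Y \<subseteq> X"
  shows "dispersive_series Y (N \<inter> Y)"
  using assms(1)
proof induction
  case dispersive_series_triv
  have "{\<one>} \<inter> Y = {\<one>}" using sg(3)[OF assms(2)] by blast
  then show ?case using dispersive_series.dispersive_series_triv[OF assms(2)] by simp
next
  case (dispersive_series_step N M s)
  note nn = dispersive_series_normal[OF dispersive_series_step(1)]
  note n = normal_inD[OF nn] and m = normal_inD[OF dispersive_series_step(2)]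
  have 1: "index (M \<inter> Y) (N \<inter> Y) dvd index M N"
    by (rule index_Int_dvd[OF nn]) (use m assms dispersive_series_step in auto)
  have "index (X \<inter> Y) (M \<inter> Y) dvd index X M"
    by (rule index_Int_dvd[OF dispersive_series_step(2)]) (use m assms in auto)
  then have 2: "index Y (M \<inter> Y) dvd index X M" using assms(3) by (simp add: Int_absorb1)
  have "subgroup (N \<inter> Y) G" using n assms subgroups_Inter_pair by blast
  then have 3: "card (N \<inter> Y) dvd card N" using n by (intro card_dvd) auto
  show ?case
    by (rule dispersive_series.dispersive_series_step[OF dispersive_series_step.IH
        normal_in_restrict[OF dispersive_series_step(2) assms(2,3)] _ dispersive_series_step(4)
        pi_number_dvd[OF dispersive_series_step(5) 1] pi_number_dvd[OF dispersive_series_step(6) 3]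
        pi_number_dvd[OF dispersive_series_step(7) 2]])
       (use dispersive_series_step in auto)
qed

lemma dispersive_series_subgroup:
  "dispersive_series X X \<Longrightarrow> subgroup Y G \<Longrightarrow> Y \<subseteq> X \<Longrightarrow> dispersive_series Y Y"
  using dispersive_series_restrict[of X X Y] by (simp add: Int_absorb1)

definition hall_in :: "nat set \<Rightarrow> 'a set \<Rightarrow> 'a set \<Rightarrow> bool" where
  "hall_in s R X \<longleftrightarrow> subgroup R G \<and> subgroup X G \<and> R \<subseteq> X \<and>
     pi_number s (card R) \<and> pi_number (- s) (index X R)"

lemma hall_inD:
  assumes "hall_in s R X"
  shows "subgroup R G" "subgroup X G" "R \<subseteq> X" "pi_number s (card R)" "pi_number (- s) (index X R)"
  using assms by (auto simp: hall_in_def)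

lemma dispersive_normal_hall:
  assumes "dispersive_series X M" "M \<noteq> {\<one>}"
  shows "\<exists>Q s. s \<in> S \<and> Q \<noteq> {\<one>} \<and> normal_in Q X \<and> hall_in s Q X"
  using assms
proof induction
  case (dispersive_series_step N M s)
  show ?case
  proof (cases "N = {\<one>}")
    case True
    then have "hall_in s M X"
      using dispersive_series_step normal_inD[OF dispersive_series_step(2)] by (auto simp: hall_in_def index_triv)
    then show ?thesis using dispersive_series_step by blast
  qed (use dispersive_series_step in blast)
qed simp

section \<open>Subnormality with respect to the classes\<close>

text \<open>The core of \<open>A\<close> in \<open>B\<close> is replaced by an arbitrary normal subgroup \<open>D\<close> of \<open>B\<close> that is contained in \<open>A\<close>:
  its index in \<open>B\<close> is a multiple of the index of the core.\<close>

inductive class_subnormal :: "'a set \<Rightarrow> 'a set \<Rightarrow> bool" for X where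
  class_subnormal_refl: "subgroup X G \<Longrightarrow> class_subnormal X X"
| class_subnormal_normal: "class_subnormal X B \<Longrightarrow> normal_in A B \<Longrightarrow> class_subnormal X A"
| class_subnormal_primary: "class_subnormal X B \<Longrightarrow> subgroup A G \<Longrightarrow> A \<subseteq> B \<Longrightarrow> normal_in D B \<Longrightarrow>
    D \<subseteq> A \<Longrightarrow> s \<in> S \<Longrightarrow> pi_number s (index B D) \<Longrightarrow> class_subnormal X A"

lemma class_subnormalD:
  assumes "class_subnormal X A"
  shows "subgroup A G" "subgroup X G" "A \<subseteq> X"
proof -
  from assms have "subgroup A G \<and> subgroup X G \<and> A \<subseteq> X"
    by induction (auto dest: normal_inD)
  then show "subgroup A G" "subgroup X G" "A \<subseteq> X" by auto
qed

lemma class_subnormal_restrict: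
  assumes "class_subnormal X A" "subgroup Y G" "Y \<subseteq> X"
  shows "class_subnormal Y (A \<inter> Y)"
  using assms(1)
proof induction
  case class_subnormal_refl
  then show ?case using class_subnormal.class_subnormal_refl[OF assms(2)] assms(3) by (simp add: Int_absorb1)
next
  case (class_subnormal_normal B A)
  have BY: "subgroup (B \<inter> Y) G" using class_subnormalD(1)[OF class_subnormal_normal(1)] assms(2) subgroups_Inter_pair by blast
  have "normal_in (A \<inter> (B \<inter> Y)) (B \<inter> Y)" by (rule normal_in_restrict[OF class_subnormal_normal(2) BY]) blast
  moreover have "A \<inter> (B \<inter> Y) = A \<inter> Y" using normal_inD(3)[OF class_subnormal_normal(2)] by blast
  ultimately show ?case using class_subnormal.class_subnormal_normal[OF class_subnormal_normal.IH] by simp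
next
  case (class_subnormal_primary B A D s)
  note d = normal_inD[OF class_subnormal_primary(4)]
  have BY: "subgroup (B \<inter> Y) G" and AY: "subgroup (A \<inter> Y) G"
    using d class_subnormal_primary(2) assms(2) subgroups_Inter_pair by auto
  have "normal_in (D \<inter> (B \<inter> Y)) (B \<inter> Y)" by (rule normal_in_restrict[OF class_subnormal_primary(4) BY]) blast
  moreover have e: "D \<inter> (B \<inter> Y) = D \<inter> Y" using d(3) by blast
  moreover have "index (B \<inter> (B \<inter> Y)) (D \<inter> (B \<inter> Y)) dvd index B D"
    by (rule index_Int_dvd[OF class_subnormal_primary(4)]) (use d BY in auto)
  ultimately show ?case
    using class_subnormal.class_subnormal_primary[OF class_subnormal_primary.IH AY, of "D \<inter> Y" s]
      class_subnormal_primary pi_number_dvd by (auto simp: Int_absorb1 subset_eq)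
qed

lemma class_subnormal_maximal:
  assumes "class_subnormal X V" "maximal_in V X"
  shows "\<exists>D s. normal_in D X \<and> D \<subseteq> V \<and> s \<in> S \<and> pi_number s (index X D)"
  using assms
proof induction
  case class_subnormal_refl
  then show ?case using maximal_inD(4) by blast
next
  case (class_subnormal_normal B A)
  note b = class_subnormalD[OF class_subnormal_normal(1)]
  have "B = A \<or> B = X"
    using maximal_inD(5)[OF class_subnormal_normal(4) b(1) normal_inD(3)[OF class_subnormal_normal(2)] b(3)] .
  then show ?case
  proof
    assume "B = X"
    then have n: "normal_in A X" using class_subnormal_normal(2) by simp
    then show ?thesis using maximal_normal_index_primary[OF class_subnormal_normal(4)] by blast
  qed (use class_subnormal_normal in blast)
next
  case (class_subnormal_primary B A D s)
  note b = class_subnormalD[OF class_subnormal_primary(1)]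
  have "B = A \<or> B = X"
    using maximal_inD(5)[OF class_subnormal_primary(9) b(1) class_subnormal_primary(3) b(3)] .
  then show ?case using class_subnormal_primary by blast
qed

text \<open>Consider a step from \<open>B\<close> to \<open>A\<close> with \<open>B / D\<close> belonging to the class \<open>t\<close>. If \<open>t \<noteq> s\<close>, then \<open>B \<inter> R\<close> lies in
  \<open>D\<close> and hence in \<open>A\<close>; if \<open>t = s\<close>, then \<open>B = (B \<inter> R) D\<close>. The lemma implies that a subnormal subgroup whose
  order belongs to \<open>s\<close> lies in every Hall subgroup for \<open>s\<close>, in particular in all the conjugates of one of
  them.\<close>

lemma class_subnormal_hall:
  assumes "class_subnormal X A" "hall_in s R X" "s \<in> S"
  shows "pi_number (- s) (index A (A \<inter> R))"
  using assms(1)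
proof induction
  case class_subnormal_refl
  then show ?case using hall_inD[OF assms(2)] by (simp add: Int_absorb1)
next
  case (class_subnormal_normal B A)
  note b = class_subnormalD[OF class_subnormal_normal(1)] and h = hall_inD[OF assms(2)]
  have BR: "subgroup (B \<inter> R) G" by (rule subgroups_Inter_pair[OF b(1) h(1)])
  have "index A (A \<inter> (B \<inter> R)) dvd index B (B \<inter> R)"
    by (rule index_normal_Int_dvd[OF class_subnormal_normal(2) BR]) blast
  moreover have "A \<inter> (B \<inter> R) = A \<inter> R" using normal_inD(3)[OF class_subnormal_normal(2)] by blast
  ultimately show ?case using class_subnormal_normal.IH pi_number_dvd by metis
next
  case (class_subnormal_primary B A D t)
  note b = class_subnormalD[OF class_subnormal_primary(1)] and h = hall_inD[OF assms(2)]
  note d = normal_inD[OF class_subnormal_primary(4)]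
  let ?Y = "B \<inter> R"
  have Y: "subgroup ?Y G" by (rule subgroups_Inter_pair[OF b(1) h(1)])
  have AY: "subgroup (A \<inter> R) G" by (rule subgroups_Inter_pair[OF class_subnormal_primary(2) h(1)])
  have AR: "A \<inter> R = A \<inter> ?Y" using class_subnormal_primary(3) by blast
  show ?case
  proof (cases "t = s")
    case False
    have cY: "pi_number s (card ?Y)" using pi_number_dvd[OF h(4) card_dvd[OF Y h(1)]] by blast
    have "pi_number (- s) (index B D)"
      by (rule pi_number_class_neq[OF assms(3) class_subnormal_primary(6) _ class_subnormal_primary(7)]) (use False in blast)
    then have "?Y \<subseteq> D" by (rule pi_subgroup_le_normal[OF class_subnormal_primary(4) _ Y _ cY]) blast
    then have "A \<inter> R = ?Y" using class_subnormal_primary(3,5) by blast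
    moreover have "index A ?Y dvd index B ?Y"
      by (rule index_dvd(1)) (use Y class_subnormal_primary b \<open>A \<inter> R = ?Y\<close> in auto)
    ultimately show ?thesis using class_subnormal_primary.IH pi_number_dvd by metis
  next
    case True
    note m = subgroup_set_mult[OF Y _ class_subnormal_primary(4)]
    have "index B (?Y <#> D) dvd index B D" "index B (?Y <#> D) dvd index B ?Y"
      by (rule index_dvd(2), use m b d Y in auto)+
    then have "index B (?Y <#> D) = 1"
      using class_subnormal_primary(7) class_subnormal_primary.IH pi_number_dvd pi_number_both True by metis
    then have YD: "?Y <#> D = B" using index_eq_1[OF m(1) b(1)] m(2) by auto
    have "?Y <#> A = B"
    proof
      show "?Y <#> A \<subseteq> B" by (rule set_mult_subset[OF b(1) _ class_subnormal_primary(3)]) blast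
      show "B \<subseteq> ?Y <#> A" using mono_set_mult[of ?Y ?Y D A G] class_subnormal_primary(5) YD by blast
    qed
    then have "index B ?Y = index A (A \<inter> R)"
      using index_Int_factor[OF Y class_subnormal_primary(2) _ b(1)] AR by (simp add: Int_commute)
    then show ?thesis using class_subnormal_primary.IH by simp
  qed
qed

end

section \<open>Groups all of whose maximal subgroups are subnormal\<close>

context classed_group
begin

text \<open>This holds if all maximal subgroups of \<open>L\<close> are \<open>\<sigma>\<close>-subnormal (\<open>class_subnormal_maximal\<close>). In this form the
  condition is easily transferred to quotients.\<close>

definition primary_cores :: "'a set \<Rightarrow> bool" where
  "primary_cores L \<longleftrightarrow> (\<forall>V. maximal_in V L \<longrightarrow>
     (\<exists>D s. normal_in D L \<and> D \<subseteq> V \<and> s \<in> S \<and> pi_number s (index L D)))"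

lemma primary_coresD:
  assumes "primary_cores L" "maximal_in V L"
  obtains D s where "normal_in D L" "D \<subseteq> V" "s \<in> S" "pi_number s (index L D)"
  using assms unfolding primary_cores_def by blast

lemma pi_number_other_classes:
  assumes "pi_number (- \<Union>(S - {s})) n" shows "pi_number s n"
  unfolding pi_number_def
proof (intro conjI allI impI)
  show "n > 0" using assms by (rule pi_number_pos)
  fix p assume p: "prime p" "p dvd n"
  obtain t where "t \<in> S" "p \<in> t" using class_exists[OF p(1)] by blast
  moreover have "p \<notin> \<Union>(S - {s})" using assms p by (auto simp: pi_number_def)
  ultimately show "p \<in> s" by blast
qed

lemma class_in_or_disjoint:
  assumes "T \<subseteq> S" "s \<in> S"
  shows "s \<in> T \<or> s \<inter> \<Union>T = {}"
  using assms class_unique by blast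

end

lemma (in classed_group) primary_cores_quotient:
  assumes "epimorphism G H L Z f" "primary_cores L"
  shows "classed_group.primary_cores H S (carrier H)"
proof -
  interpret e: epimorphism G H L Z f by (rule assms(1))
  interpret c: classed_group H S
    by unfold_locales (use class_exists class_unique in auto)
  note z = normal_inD[OF e.normal_in_kernel]
  show ?thesis
    unfolding c.primary_cores_def
  proof (intro allI impI)
    fix V assume V: "e.cod.maximal_in V (carrier H)"
    note v = e.cod.maximal_inD[OF V]
    have ZV: "Z \<subseteq> e.pre V" by (rule e.kernel_le_pre[OF v(1)])
    have "maximal_in (e.pre V) L"
      unfolding maximal_in_def
    proof (intro conjI allI impI)
      show "subgroup (e.pre V) G" by (rule e.subgroup_pre[OF v(1)])
      show "subgroup L G" by (rule z(2))
      have "e.pre V \<noteq> L" using e.image_pre[OF v(3)] e.onto v(4) by metis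
      then show "e.pre V \<subset> L" using e.pre_subset by blast
      fix K assume K: "subgroup K G" "e.pre V \<subseteq> K" "K \<subseteq> L"
      have "V \<subseteq> f ` K" using e.image_pre[OF v(3)] K(2) by (metis image_mono)
      then have "f ` K = V \<or> f ` K = carrier H"
        using v(5)[OF e.subgroup_image[OF K(1,3)]] e.f_closed K(3) by blast
      moreover have "e.pre (f ` K) = K" by (rule e.pre_image[OF K(1,3)]) (use ZV K in blast)
      ultimately show "K = e.pre V \<or> K = L" using e.pre_carrier by metis
    qed
    then obtain D s where D: "normal_in D L" "D \<subseteq> e.pre V" "s \<in> S" "pi_number s (index L D)"
      using primary_coresD[OF assms(2)] by blast
    note d = normal_inD[OF D(1)]
    let ?D = "D <#> Z"
    have nD: "normal_in ?D L" by (rule normal_in_set_mult[OF D(1) e.normal_in_kernel])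
    note dz = normal_inD[OF nD] and t = subgroup_set_mult[OF d(1,3) e.normal_in_kernel]
    have "?D \<subseteq> e.pre V" by (rule set_mult_subset[OF e.subgroup_pre[OF v(1)] D(2) ZV])
    then have "f ` ?D \<subseteq> V" by (auto simp: e.pre_def)
    moreover have "e.cod.normal_in (f ` ?D) (carrier H)" using e.normal_in_image[OF nD] e.onto by simp
    moreover have "index (carrier H) (f ` ?D) = index L ?D"
      using e.index_image[OF dz(1,2,3) _ t(4)] e.onto by simp
    moreover have "index L ?D dvd index L D" by (rule index_dvd(2)[OF d(1) dz(1,2) t(3) dz(3)])
    ultimately show "\<exists>D s. e.cod.normal_in D (carrier H) \<and> D \<subseteq> V \<and> s \<in> S \<and> pi_number s (index (carrier H) D)"
      using D(3,4) pi_number_dvd by metis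
  qed
qed

text \<open>Let \<open>\<pi>\<close> be the union of the classes in \<open>T\<close> and \<open>W\<close> the least normal subgroup of \<open>\<pi>'\<close>-index. If the
  prime \<open>q \<notin> \<pi>\<close> divides the order of \<open>W\<close>, the Frattini argument shows that a Sylow \<open>q\<close>-subgroup of \<open>W\<close> is
  normal. Its centre \<open>Z\<close> is an abelian normal \<open>\<pi>'\<close>-subgroup, and \<open>L / Z\<close> has a normal Hall \<open>\<pi>\<close>-subgroup by
  induction. Its preimage is \<open>Z\<close> times a Hall \<open>\<pi>\<close>-subgroup, whose normaliser is again seen to be \<open>L\<close>.\<close>

lemma primary_cores_normal_hall:
  fixes G :: "('a, 'b) monoid_scheme"
  assumes "classed_group G S" "classed_group.primary_cores G S L" "subgroup L G" "T \<subseteq> S"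
  shows "\<exists>W. group.normal_in G W L \<and> pi_number (\<Union>T) (card W) \<and> pi_number (- \<Union>T) (index L W)"
  using assms(1-3)
proof (induction "card L" arbitrary: G L rule: less_induct)
  case less
  interpret classed_group G S by (rule less.prems(1))
  note cores = less.prems(2) and L = less.prems(3) and T = assms(4)
  let ?\<pi> = "\<Union>T"
  let ?P = "\<lambda>W. normal_in W L \<and> pi_number (- ?\<pi>) (index L W)"
  have "?P L" using normal_in_self[OF L] index_self[OF L] by simp
  then obtain W where W: "?P W" and Wmin: "\<And>M. ?P M \<Longrightarrow> card W \<le> card M"
    using exists_least_lemma[of "\<lambda>n. \<exists>W. ?P W \<and> card W = n"] ex_has_least_nat[of ?P L card] by blast
  note w = normal_inD[OF conjunct1[OF W]]
  have least: "W \<subseteq> M" if "normal_in M L" "pi_number (- ?\<pi>) (index L M)" for M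
  proof -
    note m = normal_inD[OF that(1)]
    have n: "normal_in (W \<inter> M) L" by (rule normal_in_Int[OF conjunct1[OF W] that(1)])
    have "index W (W \<inter> M) dvd index L M" by (rule index_normal_Int_dvd[OF conjunct1[OF W] m(1,3)])
    then have "?P (W \<inter> M)"
      using n index_trans[OF normal_inD(1)[OF n] w(1,2) _ w(3)] W that(2) by (auto simp: pi_number_mult pi_number_dvd)
    then have "card W \<le> card (W \<inter> M)" by (rule Wmin)
    then have "W \<inter> M = W" using finite_subgroup[OF w(1)] by (simp add: card_seteq)
    then show ?thesis by blast
  qed
  show ?case
  proof (cases "pi_number ?\<pi> (card W)")
    case True
    then show ?thesis using W by blast
  next
    case False
    then obtain q where q: "prime q" "q dvd card W" "q \<notin> ?\<pi>"
      using card_pos[OF w(1)] by (auto simp: pi_number_def)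
    obtain Q where Q: "sylow_of q Q W" using sylow_exists[OF q(1) w(1)] by blast
    note s = sylow_ofD[OF Q]
    have QL: "Q \<subseteq> L" using s(3) w(3) by blast
    have "normalizer_in L Q = L"
    proof (rule ccontr)
      assume "normalizer_in L Q \<noteq> L"
      then obtain V where V: "normalizer_in L Q \<subseteq> V" "maximal_in V L"
        using maximal_exists[OF subgroup_normalizer_in[OF L QL] L normalizer_in_subset] by blast
      note v = maximal_inD[OF V(2)]
      obtain D c where D: "normal_in D L" "D \<subseteq> V" "c \<in> S" "pi_number c (index L D)"
        using primary_coresD[OF cores V(2)] by blast
      note d = normal_inD[OF D(1)]
      \<comment> \<open>Either way the normal subgroup \<open>W \<inter> D\<close> contains \<open>Q\<close>.\<close>
      have "Q \<subseteq> D"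
      proof (cases "q \<in> c")
        case True
        then have "c \<inter> ?\<pi> = {}" using class_in_or_disjoint[OF T D(3)] q(3) by blast
        then have "pi_number (- ?\<pi>) (index L D)" using D(4) by (auto elim!: pi_number_mono)
        then show ?thesis using least[OF D(1)] s(3) by blast
      next
        case False
        then have "pi_number (- {q}) (index L D)" using D(4) by (auto elim!: pi_number_mono)
        then show ?thesis by (rule pi_subgroup_le_normal[OF D(1) _ s(2) QL s(6)])
      qed
      then have QM: "Q \<subseteq> W \<inter> D" using s(3) by blast
      have nM: "normal_in (W \<inter> D) L" by (rule normal_in_Int[OF conjunct1[OF W] D(1)])
      note m = normal_inD[OF nM]
      have "index (W \<inter> D) Q dvd index W Q" by (rule index_dvd(1)[OF s(2) m(1) w(1) QM]) blast
      then have "sylow_of q Q (W \<inter> D)" using s QM by (auto simp: sylow_of_def)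
      from Frattini_sylow[OF nM this] have "L \<subseteq> V"
        using set_mult_subset[OF v(1) _ V(1), of "W \<inter> D"] D(2) by blast
      then show False using v by blast
    qed
    then have QnL: "normal_in Q L" using normalizer_in_eq_iff[OF L s(2) QL] by simp
    define Z where "Z = centre Q"
    have Z: "normal_in Z L" unfolding Z_def by (rule normal_in_centre[OF QnL])
    note z = normal_inD[OF Z]
    have Zcomm: "a \<otimes>\<^bsub>G\<^esub> b = b \<otimes>\<^bsub>G\<^esub> a" if "a \<in> Z" "b \<in> Z" for a b
      using that unfolding Z_def centralizer_in_def by blast
    have "Z \<subseteq> Q" by (auto simp: Z_def centralizer_in_def)
    then have "pi_number {q} (card Z)" using pi_number_dvd[OF s(6) card_dvd[OF z(1) s(2)]] by blast
    then have cZ: "pi_number (- ?\<pi>) (card Z)" by (rule pi_number_mono) (use q(3) in blast)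
    have "Q \<noteq> {\<one>\<^bsub>G\<^esub>}" by (rule sylow_of_nontrivial[OF Q q(2)])
    then have "Z \<noteq> {\<one>\<^bsub>G\<^esub>}"
      unfolding Z_def using s(4) centre_prime_power_nontrivial[OF s(2) _ q(1)] by blast
    then have Zgt: "card Z > 1" using card_pos[OF z(1)] card_1_iff[OF z(1)] by linarith
    obtain H :: "('a, 'b) monoid_scheme" and f where ep: "epimorphism G H L Z f"
      using quotient_on_same_type[OF Z] by blast
    interpret e: epimorphism G H L Z f by (rule ep)
    have cH: "classed_group H S" by unfold_locales (use class_exists class_unique in auto)
    have lt: "card (carrier H) < card L"
      using card_index[OF z(1-3)] index_pos[OF z(1-3)] Zgt by (simp add: e.card_codomain)
    from less.hyps[OF lt cH primary_cores_quotient[OF ep cores] e.cod.subgroup_self]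
    obtain W' where W': "e.cod.normal_in W' (carrier H)" "pi_number ?\<pi> (card W')"
      "pi_number (- ?\<pi>) (index (carrier H) W')" by blast
    note w' = e.cod.normal_inD[OF W'(1)]
    let ?W = "e.pre W'"
    have nW: "normal_in ?W L" using e.normal_in_pre[OF W'(1)] by (simp add: e.pre_carrier)
    note ww = normal_inD[OF nW]
    have ZW: "Z \<subseteq> ?W" by (rule e.kernel_le_pre[OF w'(1)])
    have iWZ: "index ?W Z = card W'"
      using e.card_pre[OF w'(1)] card_pos[OF z(1)] by (simp add: index_def)
    have iLW: "pi_number (- ?\<pi>) (index L ?W)"
      using e.index_pre[OF w'(1) e.cod.subgroup_self] W'(3) by (simp add: e.pre_carrier)
    have nZW: "normal_in Z ?W" by (rule normal_in_between[OF Z ww(1) ZW ww(3)])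
    have cop: "coprime (card Z) (index ?W Z)"
      using pi_number_coprime[OF W'(2) cZ] iWZ by (simp add: coprime_commute)
    obtain X where X: "subgroup X G" "X \<subseteq> ?W" "card X = index ?W Z"
      using Schur_Zassenhaus[OF finite_group_axioms nZW cop] by blast
    have piX: "pi_number ?\<pi> (card X)" using W'(2) X(3) iWZ by simp
    have XL: "X \<subseteq> L" using X ww by blast
    have "index ?W X = card Z"
      using card_index[OF X(1) ww(1) X(2)] card_index[OF z(1) ww(1) ZW] X(3) card_pos[OF X(1)]
      by (metis mult.commute mult_cancel1 not_gr_zero)
    then have iLX: "pi_number (- ?\<pi>) (index L X)"
      using index_trans[OF X(1) ww(1,2) X(2) ww(3)] cZ iLW by (simp add: pi_number_mult)
    have "normalizer_in L X = L"
    proof (rule ccontr)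
      assume "normalizer_in L X \<noteq> L"
      then obtain V where V: "normalizer_in L X \<subseteq> V" "maximal_in V L"
        using maximal_exists[OF subgroup_normalizer_in[OF L XL] L normalizer_in_subset] by blast
      note v = maximal_inD[OF V(2)]
      obtain D c where D: "normal_in D L" "D \<subseteq> V" "c \<in> S" "pi_number c (index L D)"
        using primary_coresD[OF cores V(2)] by blast
      note d = normal_inD[OF D(1)]
      have XV: "X \<subseteq> V" using V(1) normal_inD(3)[OF normal_in_normalizer[OF L X(1) XL]] by blast
      show False
      proof (cases "c \<in> T")
        case True
        have "index L V dvd index L X" "index L V dvd index L D"
          by (rule index_dvd(2)[OF X(1) v(1,2) XV v(3)] index_dvd(2)[OF d(1) v(1,2) D(2) v(3)])+
        moreover have "pi_number ?\<pi> (index L D)" using D(4) by (rule pi_number_mono) (use True in blast)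
        ultimately have "index L V = 1" using iLX pi_number_dvd pi_number_both by metis
        then show False using index_eq_1[OF v(1-3)] v(4) by simp
      next
        case False
        then have "c \<inter> ?\<pi> = {}" using class_in_or_disjoint[OF T D(3)] by blast
        then have "pi_number (- ?\<pi>) (index L D)" using D(4) by (auto elim!: pi_number_mono)
        then have XD: "X \<subseteq> D" by (rule pi_subgroup_le_normal[OF D(1) _ X(1) XL piX])
        let ?A = "Z \<inter> D" and ?M = "?W \<inter> D"
        have nA: "normal_in ?A L" by (rule normal_in_Int[OF Z D(1)])
        have nM: "normal_in ?M L" by (rule normal_in_Int[OF nW D(1)])
        note a = normal_inD[OF nA] and m = normal_inD[OF nM]
        have "coprime (card X) (card Z)" by (rule pi_number_coprime[OF piX cZ])
        moreover have "card X * card Z = card ?W"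
          using card_index[OF z(1) ww(1) ZW] X(3) by (simp add: mult.commute)
        ultimately have XZ: "X \<inter> Z = {\<one>\<^bsub>G\<^esub>}" "X <#>\<^bsub>G\<^esub> Z = ?W"
          using coprime_factorisation[OF X(1) z(1) ww(1) X(2) ZW] by auto
        have "X <#>\<^bsub>G\<^esub> ?A = ?M" using Dedekind_law[OF d(1) XD subgroup.subset[OF z(1)]] XZ(2) by simp
        moreover have "X \<inter> ?A = {\<one>\<^bsub>G\<^esub>}" using XZ(1) XD by blast
        ultimately have "card ?M = card X * card ?A" using card_set_mult[OF X(1) a(1)] by simp
        then have iM: "card X = index ?M ?A" using card_pos[OF a(1)] by (simp add: index_def)
        have "card ?A dvd card Z" by (rule card_dvd[OF a(1) z(1)]) blast
        then have "pi_number (- ?\<pi>) (card ?A)" using cZ pi_number_dvd by blast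
        then have "coprime (card ?A) (index ?M ?A)"
          using pi_number_coprime[OF piX] iM by (simp add: coprime_commute)
        from Frattini_complement[OF nA _ nM _ this X(1) _ iM]
        have "?A <#>\<^bsub>G\<^esub> normalizer_in L X = L" using Zcomm ZW X(2) XD by blast
        then have "L \<subseteq> V" using set_mult_subset[OF v(1) _ V(1), of ?A] D(2) by blast
        then show False using v by blast
      qed
    qed
    then have "normal_in X L" using normalizer_in_eq_iff[OF L X(1) XL] by simp
    then show ?thesis using piX iLX by blast
  qed
qed

context classed_group
begin

text \<open>For a class \<open>s\<close>, let \<open>Y\<close> be the normal Hall subgroup of \<open>L\<close> for the other classes, so that \<open>Y \<inter> B\<close> has an
  index in \<open>B\<close> that belongs to \<open>s\<close>. If \<open>Y \<inter> B\<close> were not contained in \<open>A\<close> for any \<open>s\<close>, the index of \<open>A\<close> in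
  \<open>B\<close> would be prime to every class.\<close>

lemma primary_cores_maximal_subnormal:
  assumes "primary_cores L" "subgroup L G" "subgroup B G" "B \<subseteq> L" "maximal_in A B"
  shows "\<exists>D s. normal_in D B \<and> D \<subseteq> A \<and> s \<in> S \<and> pi_number s (index B D)"
proof (rule ccontr)
  assume neg: "\<not> ?thesis"
  note a = maximal_inD[OF assms(5)]
  have no: "pi_number (- s) (index B A)" if s: "s \<in> S" for s
  proof -
    let ?T = "S - {s}"
    obtain Y where Y: "normal_in Y L" "pi_number (\<Union>?T) (card Y)" "pi_number (- \<Union>?T) (index L Y)"
      using primary_cores_normal_hall[OF classed_group_axioms assms(1,2), of ?T] by blast
    note y = normal_inD[OF Y(1)]
    have nY: "normal_in (Y \<inter> B) B" by (rule normal_in_restrict[OF Y(1) assms(3,4)])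
    have "index (L \<inter> B) (Y \<inter> B) dvd index L Y"
      by (rule index_Int_dvd[OF Y(1)]) (use y assms in auto)
    then have "pi_number (- \<Union>?T) (index B (Y \<inter> B))"
      using Y(3) assms(4) pi_number_dvd by (simp add: Int_absorb1)
    then have "pi_number s (index B (Y \<inter> B))" by (rule pi_number_other_classes)
    then have "\<not> Y \<inter> B \<subseteq> A" using neg nY s by blast
    then have "index B A = index (Y \<inter> B) (A \<inter> (Y \<inter> B))" by (rule maximal_index_dvd[OF assms(5) nY])
    moreover have "index (Y \<inter> B) (A \<inter> (Y \<inter> B)) dvd card (Y \<inter> B)"
      by (rule index_dvd_card) (use normal_inD(1)[OF nY] a subgroups_Inter_pair in auto)
    moreover have "card (Y \<inter> B) dvd card Y"
      by (rule card_dvd[OF normal_inD(1)[OF nY] y(1)]) blast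
    ultimately have "pi_number (\<Union>?T) (index B A)" using Y(2) pi_number_dvd by metis
    then show ?thesis by (rule pi_number_mono) (use class_unique s in blast)
  qed
  have "index B A \<noteq> 1" using index_eq_1[OF a(1-3)] a(4) by simp
  then obtain p where p: "prime p" "p dvd index B A" using prime_factor_nat by blast
  obtain s where "s \<in> S" "p \<in> s" using class_exists[OF p(1)] by blast
  then show False using no[of s] p by (auto simp: pi_number_def)
qed

text \<open>A chain of length \<open>n + 2\<close> from \<open>A\<close> to \<open>X\<close> passes through an \<open>n\<close>-maximal subgroup \<open>L\<close> and an
  \<open>(n + 1)\<close>-maximal subgroup \<open>B\<close> of \<open>L\<close>. All maximal subgroups of \<open>L\<close> are subnormal, so \<open>A\<close> is subnormal
  in \<open>B\<close>, and \<open>B\<close> is subnormal in \<open>X\<close>.\<close>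

lemma maximal_chains_subnormal_Suc:
  assumes "\<And>A. maximal_chain X (Suc n) A \<Longrightarrow> class_subnormal X A"
    and "maximal_chain X (Suc (Suc n)) A"
  shows "class_subnormal X A"
proof -
  from assms(2) obtain B where B: "maximal_in A B" "maximal_chain X (Suc n) B"
    by (auto elim: maximal_chain.cases)
  from B(2) obtain L where L: "maximal_in B L" "maximal_chain X n L"
    by (auto elim: maximal_chain.cases)
  note b = maximal_inD[OF B(1)] and l = maximal_inD[OF L(1)]
  have LX: "subgroup X G" "L \<subseteq> X" using maximal_chainD[OF L(2)] by auto
  have "primary_cores L"
    unfolding primary_cores_def
  proof (intro allI impI)
    fix V assume V: "maximal_in V L"
    have "class_subnormal X V" by (rule assms(1)[OF maximal_chain_Suc[OF V L(2)]])
    from class_subnormal_restrict[OF this l(2) LX(2)]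
    have "class_subnormal L V" using maximal_inD(3)[OF V] by (simp add: Int_absorb2)
    then show "\<exists>D s. normal_in D L \<and> D \<subseteq> V \<and> s \<in> S \<and> pi_number s (index L D)"
      using V by (rule class_subnormal_maximal)
  qed
  then obtain D s where "normal_in D B" "D \<subseteq> A" "s \<in> S" "pi_number s (index B D)"
    using primary_cores_maximal_subnormal[OF _ l(2,1,3) B(1)] by blast
  then show ?thesis
    using class_subnormal_primary[OF assms(1)[OF B(2)] b(1,3)] by blast
qed

lemma long_maximal_chains_subnormal:
  assumes "\<And>A. maximal_chain X (Suc n) A \<Longrightarrow> class_subnormal X A"
    and "n < k" "maximal_chain X k A"
  shows "class_subnormal X A"
proof -
  have "\<forall>A. maximal_chain X (Suc (n + j)) A \<longrightarrow> class_subnormal X A" for j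
  proof (induction j)
    case (Suc j)
    then show ?case using maximal_chains_subnormal_Suc[of X "n + j"] by auto
  qed (use assms(1) in simp)
  from this[of "k - Suc n"] assms(2,3) show ?thesis by simp
qed

end

section \<open>A minimal group that is not dispersive\<close>

context finite_group
begin

lemma normalizer_in_eqI:
  assumes "subgroup X G" "subgroup A G" "A \<subseteq> X" "B <#> C = X" "B \<subseteq> X" "C \<subseteq> X"
    and "\<And>b. b \<in> B \<Longrightarrow> conj_by b A = A" "\<And>c. c \<in> C \<Longrightarrow> conj_by c A = A"
  shows "normal_in A X"
proof -
  have "B \<subseteq> normalizer_in X A" "C \<subseteq> normalizer_in X A"
    using assms by (auto simp: normalizer_in_def)
  then have "X \<subseteq> normalizer_in X A"
    using set_mult_subset[OF subgroup_normalizer_in[OF assms(1,3)]] assms(4) by blast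
  then show ?thesis using normalizer_in_eq_iff[OF assms(1-3)] normalizer_in_subset by blast
qed

end

context classed_group
begin

lemma hall_in_subgroup:
  assumes "hall_in s R X" "subgroup Y G" "R \<subseteq> Y" "Y \<subseteq> X"
  shows "hall_in s R Y"
  using assms pi_number_dvd[OF hall_inD(5)[OF assms(1)] index_dvd(1)[of R Y X]] hall_inD[OF assms(1)]
  by (auto simp: hall_in_def)

lemma normal_pi_subgroup_le_hall:
  assumes "normal_in N X" "pi_number s (card N)" "hall_in s R X"
  shows "N \<subseteq> R"
proof -
  note n = normal_inD[OF assms(1)] and h = hall_inD[OF assms(3)]
  have D: "subgroup (N \<inter> R) G" by (rule subgroups_Inter_pair[OF n(1) h(1)])
  have "index N (N \<inter> R) dvd index X R" by (rule index_normal_Int_dvd[OF assms(1) h(1,3)])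
  moreover have "index N (N \<inter> R) dvd card N" by (rule index_dvd_card[OF D n(1)]) blast
  ultimately have "index N (N \<inter> R) = 1"
    using assms(2) h(5) pi_number_dvd pi_number_both by metis
  then show ?thesis using index_eq_1[OF D n(1)] by blast
qed

lemma class_subnormal_le_hall:
  assumes "class_subnormal X A" "pi_number s (card A)" "hall_in s R X" "s \<in> S"
  shows "A \<subseteq> R"
proof -
  note a = class_subnormalD[OF assms(1)] and h = hall_inD[OF assms(3)]
  have D: "subgroup (A \<inter> R) G" by (rule subgroups_Inter_pair[OF a(1) h(1)])
  have "index A (A \<inter> R) dvd card A" by (rule index_dvd_card[OF D a(1)]) blast
  then have "index A (A \<inter> R) = 1"
    using class_subnormal_hall[OF assms(1,3,4)] assms(2) pi_number_dvd pi_number_both by metis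
  then show ?thesis using index_eq_1[OF D a(1)] by blast
qed

lemma hall_in_conj:
  assumes "hall_in s R X" "x \<in> X" shows "hall_in s (conj_by x R) X"
proof -
  note h = hall_inD[OF assms(1)]
  have xc: "x \<in> carrier G" using assms(2) h(2) mem_carrier by blast
  have "card (conj_by x R) = card R" by (rule card_conj_by[OF xc subgroup.subset[OF h(1)]])
  then show ?thesis
    using h subgroup_conj_by[OF h(1) xc] conj_by_subset[OF h(2) assms(2) h(3)]
    by (simp add: hall_in_def index_def)
qed

text \<open>\<open>R0\<close> is the intersection of the conjugates of \<open>R\<close>. All of these are Hall subgroups and contain the
  subnormal subgroups whose order belongs to \<open>s\<close>.\<close>

lemma hall_core_exists:
  assumes R: "hall_in s R X" and s: "s \<in> S"
  obtains R0 where "normal_in R0 X" "R0 \<subseteq> R"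
    "\<And>A. class_subnormal X A \<Longrightarrow> pi_number s (card A) \<Longrightarrow> A \<subseteq> R0"
proof -
  note h = hall_inD[OF R]
  let ?F = "(\<lambda>x. conj_by x R) ` X"
  have one: "\<one> \<in> X" using h(2) by (rule sg)
  have sub: "subgroup (\<Inter>?F) G"
    by (rule subgroups_Inter) (use hall_inD(1)[OF hall_in_conj[OF R]] one in auto)
  have R0R: "\<Inter>?F \<subseteq> R" using one conj_by_one[OF subgroup.subset[OF h(1)]] by force
  have Xc: "\<And>x. x \<in> X \<Longrightarrow> x \<in> carrier G" using h(2) mem_carrier by blast
  have Rc: "R \<subseteq> carrier G" by (rule subgroup.subset[OF h(1)])
  have "normal_in (\<Inter>?F) X"
  proof (rule normal_inI[OF sub h(2)])
    show "\<Inter>?F \<subseteq> X" using R0R h(3) by blast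
    fix x y assume x: "x \<in> X" and y: "y \<in> \<Inter>?F"
    show "x \<otimes> y \<otimes> inv x \<in> \<Inter>?F"
    proof (rule InterI)
      fix C assume "C \<in> ?F"
      then obtain z where z: "z \<in> X" "C = conj_by z R" by blast
      have "inv x \<otimes> z \<in> X" using x z h(2) by (simp add: sg)
      then have "y \<in> conj_by (inv x \<otimes> z) R" using y by blast
      then have "x \<otimes> y \<otimes> inv x \<in> conj_by x (conj_by (inv x \<otimes> z) R)" by (auto simp: conj_by_def)
      also have "\<dots> = conj_by z R"
        using conj_by_mult[of x "inv x \<otimes> z" R] Xc x z Rc by simp
      finally show "x \<otimes> y \<otimes> inv x \<in> C" using z by simp
    qed
  qed
  moreover have "A \<subseteq> \<Inter>?F" if "class_subnormal X A" "pi_number s (card A)" for A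
    using class_subnormal_le_hall[OF that hall_in_conj[OF R] s] by blast
  ultimately show thesis using that R0R by blast
qed

lemma normal_hall_in_characteristic:
  "hall_in s R Y \<Longrightarrow> normal_in R Y \<Longrightarrow> normal_in Y X \<Longrightarrow> normal_in R X"
  by (rule normal_hall_characteristic) (auto simp: hall_in_def)

end

text \<open>The induction will provide these properties of a group of least order without a dispersive series, and
  they turn out to hold for the trivial group only.\<close>

locale minimal_nondispersive = classed_group +
  fixes X and n :: nat
  assumes soluble: "soluble_series X X"
    and n_le: "n \<le> card (prime_classes (card X))"
    and long_chains: "\<And>k A. n < k \<Longrightarrow> maximal_chain X k A \<Longrightarrow> class_subnormal X A"
    and proper: "\<And>Y. subgroup Y G \<Longrightarrow> Y \<subseteq> X \<Longrightarrow> Y \<noteq> X \<Longrightarrow> dispersive_series Y Y"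
    and no_normal_hall: "\<And>s Q. s \<in> S \<Longrightarrow> normal_in Q X \<Longrightarrow> hall_in s Q X \<Longrightarrow> Q = {\<one>}"
begin

lemma X: "subgroup X G"
  using normal_inD(1)[OF soluble_series_normal[OF soluble]] .

end

text \<open>Here \<open>K\<close> is a proper normal subgroup whose index belongs to the class \<open>a\<close>. In a dispersive series of \<open>K\<close>
  the first factor \<open>Q\<close> must belong to \<open>a\<close> too, since otherwise it would be a normal Hall subgroup of \<open>X\<close>; and
  \<open>K / E\<close> is the last factor.\<close>

locale minimal_nondispersive_series = minimal_nondispersive +
  fixes a b :: "nat set" and K E Q
  assumes ab: "a \<in> S" "b \<in> S" "a \<noteq> b"
    and nK: "normal_in K X" and nE: "normal_in E X" and nQ: "normal_in Q X"
    and QE: "Q \<subseteq> E" and EK: "E \<subseteq> K" and K_proper: "K \<noteq> X" and E_proper: "E \<noteq> K" and Q_ne: "Q \<noteq> {\<one>}"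
    and card_Q: "pi_number a (card Q)" and index_KQ: "pi_number (- a) (index K Q)"
    and index_XK: "pi_number a (index X K)"
    and index_KE: "pi_number b (index K E)" and card_E: "pi_number (- b) (card E)"
begin

lemmas K = normal_inD[OF nK] and E = normal_inD[OF nE] and Q = normal_inD[OF nQ]

lemma QK: "Q \<subseteq> K" using QE EK by blast

lemma card_Q_b: "pi_number (- b) (card Q)"
  by (rule pi_number_dvd[OF card_E card_dvd[OF Q(1) E(1) QE]])

lemma index_XK_b: "pi_number (- b) (index X K)"
  by (rule pi_number_class_neq[OF ab(2,1) _ index_XK]) (use ab in blast)

lemma index_KE_a: "pi_number (- a) (index K E)"
  by (rule pi_number_class_neq[OF ab(1,2) _ index_KE]) (use ab in blast)

lemma index_EQ: "pi_number (- a) (index E Q)" "pi_number (- b) (index E Q)"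
  by (rule pi_number_dvd[OF index_KQ index_dvd(1)[OF Q(1) E(1) K(1) QE EK]],
      rule pi_number_dvd[OF card_E index_dvd_card[OF Q(1) E(1) QE]])

lemma card_X: "card X = card Q * index E Q * index K E * index X K"
  using card_index[OF Q(1) E(1) QE] card_index[OF E(1) K(1) EK] card_index[OF K(1-3)] by simp

lemma index_XE: "index X E = index X K * index K E"
  by (rule index_trans[OF E(1) K(1,2) EK K(3)])

lemma index_KE_ne: "index K E \<noteq> 1"
  using index_eq_1[OF E(1) K(1) EK] E_proper by simp

lemma index_XK_ne: "index X K \<noteq> 1"
  using index_eq_1[OF K(1,2,3)] K_proper by simp

lemma normal_hall_False:
  assumes "s \<in> S" "normal_in Y X" "hall_in s R Y" "hall_in s R X" "normal_in R Y" "R \<noteq> {\<one>}"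
  shows False
  using no_normal_hall[OF assms(1) normal_hall_in_characteristic[OF assms(3,5,2)] assms(4)] assms(6) by blast

subsection \<open>Hall subgroups for the class of the top factor\<close>

context
  fixes H assumes H: "hall_in a H X"
begin

lemmas h = hall_inD[OF H]

lemma Q_le_H: "Q \<subseteq> H"
  by (rule normal_pi_subgroup_le_hall[OF nQ card_Q H])

lemma hall_a_ne: "H \<noteq> {\<one>}"
  using Q_le_H Q_ne sg(3)[OF Q(1)] by blast

lemma hall_a_Int: "Y \<subseteq> K \<Longrightarrow> H \<inter> Y \<subseteq> Q"
proof -
  assume Y: "Y \<subseteq> K"
  have D: "subgroup (H \<inter> K) G" by (rule subgroups_Inter_pair[OF h(1) K(1)])
  have "card (H \<inter> K) dvd card H" by (rule card_dvd[OF D h(1)]) blast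
  then have "H \<inter> K \<subseteq> Q"
    using pi_subgroup_le_normal[OF normal_in_between[OF nQ K(1) QK K(3)] index_KQ D] h(4) pi_number_dvd
    by blast
  then show ?thesis using Y by blast
qed

lemma hall_a_not_normal: "\<not> normal_in H X"
  using no_normal_hall[OF ab(1) _ H] hall_a_ne by blast

text \<open>The subgroup \<open>H E\<close> is proper, hence it has a nontrivial normal Hall subgroup. If that belonged to a
  class other than \<open>a\<close>, it would lie in \<open>E\<close> and be a normal Hall subgroup of \<open>X\<close>.\<close>

lemma hall_a_normalized_by_E: "normal_in H (H <#> E)"
proof -
  let ?T = "H <#> E"
  note t = subgroup_set_mult[OF h(1,3) nE]
  have TE: "index ?T E = index H (H \<inter> E)" by (rule index_set_mult[OF h(1,3) nE])
  have "subgroup (H \<inter> E) G" by (rule subgroups_Inter_pair[OF h(1) E(1)])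
  then have "index H (H \<inter> E) dvd card H" by (rule index_dvd_card[OF _ h(1)]) blast
  then have TEa: "pi_number a (index ?T E)" using h(4) TE pi_number_dvd by simp
  have "?T \<noteq> X"
  proof
    assume "?T = X"
    then have "pi_number a (index K E)"
      using TEa index_XE by (simp add: pi_number_mult)
    then show False using index_KE_a index_KE_ne pi_number_both by blast
  qed
  then have disp: "dispersive_series ?T ?T" using proper[OF t(1,2)] by blast
  have "?T \<noteq> {\<one>}" using t(3) hall_a_ne sg(3)[OF h(1)] by blast
  then obtain Y s where Y: "s \<in> S" "Y \<noteq> {\<one>}" "normal_in Y ?T" "hall_in s Y ?T"
    using dispersive_normal_hall[OF disp] by blast
  note y = hall_inD[OF Y(4)]
  show ?thesis
  proof (cases "s = a")
    case True
    have HT: "hall_in a H ?T" by (rule hall_in_subgroup[OF H t(1,3,2)])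
    have "Y \<subseteq> H" by (rule normal_pi_subgroup_le_hall[OF Y(3) _ HT]) (use y True in simp)
    moreover have "H \<subseteq> Y" by (rule pi_subgroup_le_normal[OF Y(3) _ h(1) t(3) h(4)]) (use y True in simp)
    ultimately show ?thesis using Y(3) by simp
  next
    case False
    have "pi_number (- s) (index ?T E)"
      by (rule pi_number_class_neq[OF Y(1) ab(1) False TEa])
    then have YE: "Y \<subseteq> E" by (rule pi_subgroup_le_normal[OF t(5) _ y(1,3,4)])
    have "card Y \<noteq> 1" using card_1_iff[OF y(1)] Y(2) by simp
    have "s \<noteq> b"
    proof
      assume "s = b"
      moreover have "pi_number (- b) (card Y)" by (rule pi_number_dvd[OF card_E card_dvd[OF y(1) E(1) YE]])
      ultimately show False using y(4) \<open>card Y \<noteq> 1\<close> pi_number_both by blast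
    qed
    have YinE: "hall_in s Y E" by (rule hall_in_subgroup[OF Y(4) E(1) YE t(4)])
    have "pi_number (- s) (index K E)"
      by (rule pi_number_class_neq[OF Y(1) ab(2) \<open>s \<noteq> b\<close> index_KE])
    moreover have "pi_number (- s) (index X K)"
      by (rule pi_number_class_neq[OF Y(1) ab(1) False index_XK])
    ultimately have "pi_number (- s) (index X Y)"
      using index_trans[OF y(1) E(1,2) YE E(3)] hall_inD(5)[OF YinE] index_XE by (simp add: pi_number_mult)
    then have "hall_in s Y X" using y(1,4) YE E by (auto simp: hall_in_def)
    moreover have "normal_in Y E" by (rule normal_in_between[OF Y(3) E(1) YE t(4)])
    ultimately show ?thesis using normal_hall_False[OF Y(1) nE YinE] Y(2) by blast
  qed
qed

lemma hall_a_conj_E: "e \<in> E \<Longrightarrow> conj_by e H = H"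
  using normal_in_conj_by[OF hall_a_normalized_by_E] subgroup_set_mult(4)[OF h(1,3) nE] by blast

lemma hall_a_not_normalized:
  assumes "B <#> E = X" "B \<subseteq> X" "\<And>x. x \<in> B \<Longrightarrow> conj_by x H = H"
  shows False
  using normalizer_in_eqI[OF X h(1,3) assms(1,2) E(3) assms(3) hall_a_conj_E] hall_a_not_normal by blast

end

subsection \<open>Hall subgroups for the class of the last factor\<close>

context
  fixes R assumes R: "hall_in b R X"
begin

lemmas r = hall_inD[OF R]

lemma R_le_K: "R \<subseteq> K"
  by (rule pi_subgroup_le_normal[OF nK index_XK_b r(1,3,4)])

lemma card_R: "card R = index K E"
proof -
  have "card R * index X R = index K E * (card E * index X K)"
    using card_index[OF r(1,2,3)] card_index[OF E(1) K(1) EK] card_index[OF K(1-3)] by (simp add: ac_simps)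
  then show ?thesis
    by (rule pi_number_cofactor(1)[OF _ r(4) index_KE r(5)]) (simp add: pi_number_mult card_E index_XK_b)
qed

lemma hall_b_ne: "R \<noteq> {\<one>}"
  using card_R index_KE_ne card_1_iff[OF r(1)] by simp

lemma hall_b_factorisation: "R \<inter> E = {\<one>}" "R <#> E = K"
proof -
  have "card R * card E = card K" using card_R card_index[OF E(1) K(1) EK] by simp
  moreover have "coprime (card R) (card E)" by (rule pi_number_coprime[OF r(4) card_E])
  ultimately show "R \<inter> E = {\<one>}" "R <#> E = K"
    using coprime_factorisation[OF r(1) E(1) K(1) R_le_K EK] by auto
qed

lemma hall_b_not_normal_in: "normal_in Y X \<Longrightarrow> \<not> normal_in R Y"
proof
  assume Y: "normal_in Y X" "normal_in R Y"
  note y = normal_inD[OF Y(1)]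
  have "hall_in b R Y" by (rule hall_in_subgroup[OF R y(1) normal_inD(3)[OF Y(2)] y(3)])
  then show False using normal_hall_False[OF ab(2) Y(1) _ R Y(2)] hall_b_ne by blast
qed

lemma hall_b_not_subnormal: "\<not> class_subnormal X R"
proof
  assume sn: "class_subnormal X R"
  obtain R0 where R0: "normal_in R0 X" "R0 \<subseteq> R"
    "\<And>A. class_subnormal X A \<Longrightarrow> pi_number b (card A) \<Longrightarrow> A \<subseteq> R0"
    using hall_core_exists[OF R ab(2)] by blast
  then have "R0 = R" using sn r(4) by blast
  then show False using R0(1) hall_b_not_normal_in[OF normal_in_self[OF X]] by simp
qed

lemma hall_b_chain_length: "maximal_chain X k R \<Longrightarrow> k \<le> n"
  using long_chains[of k R] hall_b_not_subnormal by force

lemma hall_b_set_mult_Q: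
  shows "subgroup (R <#> Q) G" "R \<subseteq> R <#> Q" "Q \<subseteq> R <#> Q" "R <#> Q \<subseteq> K" "R \<noteq> R <#> Q"
proof -
  note t = subgroup_set_mult[OF r(1,3) nQ]
  show "subgroup (R <#> Q) G" "R \<subseteq> R <#> Q" "Q \<subseteq> R <#> Q" using t by auto
  show "R <#> Q \<subseteq> K" by (rule set_mult_subset[OF K(1) R_le_K QK])
  show "R \<noteq> R <#> Q"
  proof
    assume "R = R <#> Q"
    then have "Q \<subseteq> R \<inter> E" using t(4) QE by blast
    then show False using hall_b_factorisation(1) Q_ne sg(3)[OF Q(1)] by auto
  qed
qed

text \<open>Every class other than \<open>a\<close> and \<open>b\<close> is responsible for a step between \<open>R Q\<close> and \<open>K\<close>, and \<open>a\<close> for at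
  least two more steps of a maximal chain from \<open>R\<close> to \<open>X\<close>. As such a chain has length at most \<open>n\<close>, there is no
  room for any further step.\<close>

lemma card_classes_le:
  assumes "maximal_chain K k (R <#> Q)"
  shows "n \<le> k + 2"
proof -
  note q = hall_b_set_mult_Q
  have k: "card (prime_classes (index K (R <#> Q))) \<le> k"
    by (rule card_prime_classes_maximal_chain[OF assms soluble_series_subgroup[OF soluble K(1,3)]])
  have "index (R <#> Q) Q dvd card R"
    unfolding index_set_mult[OF r(1,3) nQ]
    by (rule index_dvd_card[OF _ r(1)]) (use subgroups_Inter_pair[OF r(1) Q(1)] in auto)
  then have 1: "prime_classes (index (R <#> Q) Q) \<subseteq> {b}"
    using pi_number_dvd[OF r(4)] prime_classes_pi_number[OF ab(2)] by blast
  have "card X = card Q * index (R <#> Q) Q * index K (R <#> Q) * index X K"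
    using card_index[OF Q(1) q(1,3)] card_index[OF q(1) K(1) q(4)] card_index[OF K(1-3)] by simp
  then have "prime_classes (card X) \<subseteq> insert a (insert b (prime_classes (index K (R <#> Q))))"
    using prime_classes_pi_number[OF ab(1) card_Q] prime_classes_pi_number[OF ab(1) index_XK] 1
    by (auto simp: prime_classes_mult)
  moreover have "finite (prime_classes (index K (R <#> Q)))"
    by (rule finite_prime_classes[OF index_pos[OF q(1) K(1) q(4)]])
  ultimately have "card (prime_classes (card X)) \<le> Suc (Suc (card (prime_classes (index K (R <#> Q)))))"
    using card_mono[of "insert a (insert b (prime_classes (index K (R <#> Q))))" "prime_classes (card X)"]
    by (simp add: card_insert_if split: if_splits)
  then show ?thesis using n_le k by simp
qed

lemma hall_b_chain:
  assumes "maximal_chain (R <#> Q) i R" "maximal_chain K k (R <#> Q)" "maximal_chain X j K"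
  shows "i = 1" "j = 1" "n = k + 2"
proof -
  have "maximal_chain X (i + k + j) R"
    by (rule maximal_chain_trans[OF maximal_chain_trans[OF assms(1,2)] assms(3)])
  then have "i + k + j \<le> n" by (rule hall_b_chain_length)
  moreover have "n \<le> k + 2" by (rule card_classes_le[OF assms(2)])
  moreover have "i \<noteq> 0" using assms(1) hall_b_set_mult_Q(5) by (auto elim: maximal_chain.cases)
  moreover have "j \<noteq> 0" using assms(3) K_proper by (auto elim: maximal_chain.cases)
  ultimately show "i = 1" "j = 1" "n = k + 2" by auto
qed

lemma hall_b_chain_exact:
  obtains k where "maximal_chain K k (R <#> Q)" "n = k + 2"
    and "maximal_in R (R <#> Q)" "maximal_in K X" "maximal_chain X n R"
proof -
  note q = hall_b_set_mult_Q
  obtain i k j where c: "maximal_chain (R <#> Q) i R" "maximal_chain K k (R <#> Q)" "maximal_chain X j K"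
    using maximal_chain_exists[OF r(1) q(1,2)] maximal_chain_exists[OF q(1) K(1) q(4)]
      maximal_chain_exists[OF K(1-3)] by blast
  note e = hall_b_chain[OF c]
  have 1: "maximal_in A Y" if "maximal_chain Y 1 A" for A Y
    using that by (auto elim!: maximal_chain.cases)
  have "maximal_chain X n R"
    using maximal_chain_trans[OF maximal_chain_trans[OF c(1,2)] c(3)] e by simp
  then show thesis using that[OF c(2) e(3)] 1[of "R <#> Q" R] 1[of X K] c(1,3) e(1,2) by simp
qed

text \<open>So the maximal subgroups of \<open>R\<close> are \<open>(n + 1)\<close>-maximal in \<open>X\<close> and lie in the normal core \<open>R\<^sub>0\<close> of \<open>R\<close>,
  which is therefore the only maximal subgroup of \<open>R\<close>. This forces \<open>R\<close> to be an abelian group of prime power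
  order.\<close>

lemma hall_b_unique_maximal:
  obtains R0 where "normal_in R0 X" "R0 \<subseteq> R" "R0 \<noteq> R"
    "\<And>A. subgroup A G \<Longrightarrow> A \<subseteq> R \<Longrightarrow> A \<noteq> R \<Longrightarrow> A \<subseteq> R0"
proof -
  obtain R0 where R0: "normal_in R0 X" "R0 \<subseteq> R"
    "\<And>A. class_subnormal X A \<Longrightarrow> pi_number b (card A) \<Longrightarrow> A \<subseteq> R0"
    using hall_core_exists[OF R ab(2)] by blast
  have ne: "R0 \<noteq> R" using R0(1) hall_b_not_normal_in[OF normal_in_self[OF X]] by blast
  have "A \<subseteq> R0" if A: "subgroup A G" "A \<subseteq> R" "A \<noteq> R" for A
  proof -
    obtain M where M: "A \<subseteq> M" "maximal_in M R" using maximal_exists[OF A(1) r(1) A(2,3)] by blast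
    obtain k where "maximal_chain X n R" using hall_b_chain_exact by blast
    then have "class_subnormal X M"
      using long_chains[of "Suc n" M] maximal_chain_Suc[OF M(2)] by simp
    moreover have "pi_number b (card M)"
      by (rule pi_number_dvd[OF r(4) card_dvd[OF _ r(1)]]) (use maximal_inD[OF M(2)] in auto)
    ultimately show ?thesis using R0(3) M(1) by blast
  qed
  then show thesis using that R0 ne by blast
qed

lemma hall_b_commute:
  assumes "x \<in> R" "y \<in> R" shows "x \<otimes> y = y \<otimes> x"
proof -
  obtain R0 where R0: "normal_in R0 X" "R0 \<subseteq> R" "R0 \<noteq> R"
    "\<And>A. subgroup A G \<Longrightarrow> A \<subseteq> R \<Longrightarrow> A \<noteq> R \<Longrightarrow> A \<subseteq> R0"
    using hall_b_unique_maximal by blast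
  obtain z where z: "z \<in> R" "z \<notin> R0" using R0(2,3) by blast
  have Rc: "R \<subseteq> carrier G" by (rule subgroup.subset[OF r(1)])
  have 1: "centralizer_in R {z} = R"
  proof (rule ccontr)
    assume "centralizer_in R {z} \<noteq> R"
    moreover have "subgroup (centralizer_in R {z}) G"
      by (rule subgroup_centralizer_in[OF r(1)]) (use z Rc in blast)
    moreover have "centralizer_in R {z} \<subseteq> R" by (auto simp: centralizer_in_def)
    ultimately have "centralizer_in R {z} \<subseteq> R0" using R0(4) by blast
    moreover have "z \<in> centralizer_in R {z}" using z by (auto simp: centralizer_in_def)
    ultimately show False using z by blast
  qed
  have "centre R = R"
  proof (rule ccontr)
    assume "centre R \<noteq> R"
    moreover have "subgroup (centre R) G" by (rule subgroup_centralizer_in[OF r(1) Rc])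
    moreover have "centre R \<subseteq> R" by (auto simp: centralizer_in_def)
    ultimately have "centre R \<subseteq> R0" using R0(4) by blast
    moreover have "z \<in> centre R"
      unfolding centralizer_in_def
    proof (intro CollectI conjI ballI)
      fix y assume "y \<in> R"
      then have "y \<in> centralizer_in R {z}" using 1 by simp
      then show "z \<otimes> y = y \<otimes> z" by (auto simp: centralizer_in_def)
    qed (rule z(1))
    ultimately show False using z by blast
  qed
  then have "x \<in> centre R" using assms by simp
  then show ?thesis using assms by (auto simp: centralizer_in_def)
qed

lemma hall_b_prime_power:
  obtains p k where "prime p" "card R = p ^ k"
proof -
  obtain R0 where R0: "normal_in R0 X" "R0 \<subseteq> R" "R0 \<noteq> R"
    "\<And>A. subgroup A G \<Longrightarrow> A \<subseteq> R \<Longrightarrow> A \<noteq> R \<Longrightarrow> A \<subseteq> R0"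
    using hall_b_unique_maximal by blast
  note r0 = normal_inD[OF R0(1)]
  have "index R R0 \<noteq> 1" using index_eq_1[OF r0(1) r(1) R0(2)] R0(3) by simp
  then obtain p where p: "prime p" "p dvd index R R0" using prime_factor_nat by blast
  obtain P where P: "sylow_of p P R" using sylow_exists[OF p(1) r(1)] by blast
  note s = sylow_ofD[OF P]
  have "P = R"
  proof (rule ccontr)
    assume "P \<noteq> R"
    then have "P \<subseteq> R0" using R0(4) s by blast
    then have "index R R0 dvd index R P" by (rule index_dvd(2)[OF s(2) r0(1) r(1) _ R0(2)])
    then show False using s(5) p(2) dvd_trans by blast
  qed
  then show thesis using s(4) that p(1) by blast
qed

end

subsection \<open>At least three classes\<close>

text \<open>Suppose \<open>Q \<noteq> E\<close>. A complement \<open>B / Q\<close> of \<open>E / Q\<close> in \<open>X / Q\<close> is proper, hence it has a nontrivial normal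
  Hall subgroup, for the class \<open>a\<close> or \<open>b\<close>. A Hall subgroup for \<open>a\<close> is normalised by \<open>E\<close>, so it cannot be normal
  in \<open>B\<close>. So let \<open>R\<close> be the normal Hall subgroup of \<open>B\<close> for \<open>b\<close> and \<open>H\<close> a complement. The centraliser \<open>C\<close> of
  \<open>E / Q\<close> is normal in \<open>X\<close> and contains \<open>H\<close>. If \<open>R\<close> is contained in \<open>C\<close>, then \<open>R Q\<close> and also \<open>R\<close> is normal
  in \<open>K\<close>. Otherwise \<open>[R, H]\<close> is contained in the maximal subgroup \<open>R\<^sub>0\<close> of \<open>R\<close>, and \<open>H\<close> is normal in \<open>B\<close> by
  the Frattini argument.\<close>

lemma E_eq_Q: "E = Q"
proof (rule ccontr)
  assume EQ: "E \<noteq> Q"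
  have EQ1: "index E Q \<noteq> 1" using index_eq_1[OF Q(1) E(1) QE] EQ by simp
  have XEab: "pi_number (a \<union> b) (index X E)"
    using index_XK index_KE by (auto simp: index_XE pi_number_mult elim: pi_number_mono)
  have EQab: "pi_number (- (a \<union> b)) (index E Q)" using index_EQ by (auto simp: pi_number_def)
  have cop: "coprime (index E Q) (index X E)"
    using pi_number_coprime[OF XEab EQab] by (simp add: coprime_commute)
  obtain B where B: "subgroup B G" "Q \<subseteq> B" "B \<subseteq> X" "card B = card Q * index X E"
    using Schur_Zassenhaus_relative[OF nQ nE QE cop] by blast
  have cX: "card X = card B * index E Q" using card_X B(4) index_XE by simp
  have iXB: "index X B = index E Q" using cX card_pos[OF B(1)] by (simp add: index_def)
  have "B \<noteq> X" using cX EQ1 card_pos[OF X] by auto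
  have BE: "B <#> E = X"
  proof -
    have D: "subgroup (B \<inter> E) G" by (rule subgroups_Inter_pair[OF B(1) E(1)])
    have QD: "Q \<subseteq> B \<inter> E" using B(2) QE by blast
    have "index (B \<inter> E) Q dvd index E Q" by (rule index_dvd(1)[OF Q(1) D E(1) QD]) blast
    moreover have "index (B \<inter> E) Q dvd index B Q" by (rule index_dvd(1)[OF Q(1) D B(1) QD]) blast
    moreover have "index B Q = index X E" using B(4) card_pos[OF Q(1)] by (simp add: index_def)
    ultimately have "index (B \<inter> E) Q = 1" using cop by (metis coprime_common_divisor_nat)
    then have "B \<inter> E = Q" using index_eq_1[OF Q(1) D QD] by simp
    then have "card (B <#> E) = card X"
      using card_set_mult_index[OF B(1,3) nE] \<open>index B Q = _\<close> card_index[OF E(1-3)] by simp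
    then show ?thesis
      using set_mult_subset[OF X B(3) E(3)] finite_subgroup[OF X] by (simp add: card_subset_eq)
  qed
  have "B \<noteq> {\<one>}" using B(2) Q_ne sg(3)[OF Q(1)] by blast
  then obtain R s where R: "s \<in> S" "R \<noteq> {\<one>}" "normal_in R B" "hall_in s R B"
    using dispersive_normal_hall[OF proper[OF B(1,3) \<open>B \<noteq> X\<close>]] by blast
  note rr = hall_inD[OF R(4)]
  have hallX: "hall_in c Y X" if "hall_in c Y B" "c = a \<or> c = b" for c Y
  proof -
    note y = hall_inD[OF that(1)]
    have "pi_number (- c) (index X Y)"
      using index_trans[OF y(1) B(1) X y(3) B(3)] iXB index_EQ y(5) that(2) by (auto simp: pi_number_mult)
    then show ?thesis using y B X by (auto simp: hall_in_def)
  qed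
  have "s = a \<or> s = b"
  proof (rule ccontr)
    assume ns: "\<not> ?thesis"
    have "pi_number (- s) (card Q)" "pi_number (- s) (index X K)" "pi_number (- s) (index K E)"
      using pi_number_class_neq[OF R(1) ab(1)] pi_number_class_neq[OF R(1) ab(2)] ns card_Q index_XK index_KE by auto
    then have "pi_number (- s) (card B)" by (simp add: B(4) index_XE pi_number_mult)
    then have "pi_number (- s) (card R)" using card_dvd[OF rr(1,2,3)] pi_number_dvd by blast
    then show False using rr(4) R(2) card_1_iff[OF rr(1)] pi_number_both by blast
  qed
  moreover have "s \<noteq> a"
  proof
    assume s: "s = a"
    then have "hall_in a R X" using hallX R(4) by simp
    then show False
      by (rule hall_a_not_normalized[OF _ BE B(3)]) (rule normal_in_conj_by[OF R(3)])
  qed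
  ultimately have sb: "s = b" by blast
  have Rb: "hall_in b R X" and RB: "hall_in b R B" using hallX R(4) sb by auto
  have iBR: "index B R = card Q * index X K"
  proof (rule pi_number_cofactor(2)[where m = "card R" and m' = "index K E"])
    show "card R * index B R = index K E * (card Q * index X K)"
      using card_index[OF rr(1,2,3)] B(4) index_XE by (simp add: ac_simps)
    show "pi_number (- b) (card Q * index X K)" using card_Q_b index_XK_b by (simp add: pi_number_mult)
  qed (use rr sb index_KE in auto)
  have copR: "coprime (card R) (index B R)" by (rule pi_number_coprime) (use rr sb in auto)
  obtain H where H: "subgroup H G" "H \<subseteq> B" "card H = index B R"
    using Schur_Zassenhaus[OF finite_group_axioms R(3) copR] by blast
  have "card R * card H = card B" using H(3) card_index[OF rr(1,2,3)] by simp
  then have HR: "H \<inter> R = {\<one>}" "H <#> R = B"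
    using coprime_factorisation[OF H(1) rr(1) B(1) H(2) rr(3)] copR H(3)
    by (auto simp: mult.commute coprime_commute)
  have "index B H = card R"
    using \<open>card R * card H = card B\<close> card_pos[OF H(1)] by (simp add: index_def flip: \<open>card R * card H = card B\<close>)
  moreover have "pi_number (- a) (card R)"
    by (rule pi_number_class_neq[OF ab(1,2)]) (use ab rr sb in auto)
  moreover have "pi_number a (card H)" using H(3) iBR card_Q index_XK by (simp add: pi_number_mult)
  ultimately have "hall_in a H B" using H B by (auto simp: hall_in_def)
  then have Ha: "hall_in a H X" using hallX by simp
  have HX: "H \<subseteq> X" using H(2) B(3) by blast
  have RX: "R \<subseteq> X" using rr(3) B(3) by blast
  have Xc: "\<And>x. x \<in> X \<Longrightarrow> x \<in> carrier G" using X mem_carrier by blast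
  obtain F :: "('a, 'b) monoid_scheme" and f where ep: "epimorphism G F X Q f"
    using quotient_on_same_type[OF nQ] by blast
  interpret e: epimorphism G F X Q f by (rule ep)
  define C where "C = e.pre (e.cod.centralizer_in (carrier F) (f ` E))"
  have nC: "normal_in C X"
    using e.normal_in_pre[OF e.cod.normal_in_centralizer[of "f ` E" "carrier F"]] e.normal_in_image[OF nE] e.onto
    by (simp add: C_def e.pre_carrier)
  note c = normal_inD[OF nC]
  have C_iff: "g \<in> C \<longleftrightarrow> (\<forall>y\<in>E. g \<otimes> y \<otimes> inv g \<otimes> inv y \<in> Q)" if g: "g \<in> X" for g
  proof -
    have "f g \<otimes>\<^bsub>F\<^esub> f y = f y \<otimes>\<^bsub>F\<^esub> f g \<longleftrightarrow> g \<otimes> y \<otimes> inv g \<otimes> inv y \<in> Q" if y: "y \<in> E" for y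
    proof -
      have yX: "y \<in> X" using y E(3) by blast
      have cl: "f g \<in> carrier F" "f y \<in> carrier F" using e.f_closed g yX by auto
      have "g \<otimes> y \<otimes> inv g \<otimes> inv y = (g \<otimes> y) \<otimes> inv (y \<otimes> g)" using Xc g yX by (simp add: word)
      moreover have "(g \<otimes> y) \<otimes> inv (y \<otimes> g) \<in> X" "g \<otimes> y \<in> X" "y \<otimes> g \<in> X" using g yX X by (auto intro!: sg)
      ultimately have "g \<otimes> y \<otimes> inv g \<otimes> inv y \<in> Q \<longleftrightarrow> f (g \<otimes> y) \<otimes>\<^bsub>F\<^esub> inv\<^bsub>F\<^esub> (f (y \<otimes> g)) = \<one>\<^bsub>F\<^esub>"
        using e.f_kernel[of "(g \<otimes> y) \<otimes> inv (y \<otimes> g)"] e.f_mult e.f_inv X by (simp add: sg)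
      also have "\<dots> \<longleftrightarrow> f (g \<otimes> y) = f (y \<otimes> g)"
        using e.f_closed[OF \<open>g \<otimes> y \<in> X\<close>] e.f_closed[OF \<open>y \<otimes> g \<in> X\<close>]
        by (metis e.cod.inv_closed e.cod.inv_equality e.cod.inv_inv e.cod.r_inv)
      finally show ?thesis using e.f_mult g yX by simp
    qed
    then show ?thesis using g e.f_closed[OF g] by (auto simp: C_def e.pre_def e.cod.centralizer_in_def)
  qed
  have HC: "H \<subseteq> C"
  proof
    fix x assume x: "x \<in> H"
    have "x \<otimes> y \<otimes> inv x \<otimes> inv y \<in> Q" if y: "y \<in> E" for y
    proof -
      have cl: "x \<in> carrier G" "y \<in> carrier G" using Xc HX x E(3) y by auto
      have "x \<otimes> y \<otimes> inv x \<in> E" using E(4) HX x y by blast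
      then have 1: "x \<otimes> y \<otimes> inv x \<otimes> inv y \<in> E" using y E(1) by (simp add: sg)
      have "y \<otimes> inv x \<otimes> inv y \<in> H"
        using hall_a_conj_E[OF Ha y] x H(1) by (auto simp: conj_by_def sg)
      then have "x \<otimes> (y \<otimes> inv x \<otimes> inv y) \<in> H" using x H(1) by (simp add: sg)
      then have "x \<otimes> y \<otimes> inv x \<otimes> inv y \<in> H" using cl by (simp add: word)
      then show ?thesis using 1 hall_a_Int[OF Ha EK] by blast
    qed
    then show "x \<in> C" using C_iff HX x by blast
  qed
  show False
  proof (cases "R \<subseteq> C")
    case True
    note q = hall_b_set_mult_Q[OF Rb]
    have nRQ: "normal_in (R <#> Q) K"
    proof (rule normalizer_in_eqI[OF K(1) q(1,4) hall_b_factorisation(2)[OF Rb] R_le_K[OF Rb] EK])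
      show "conj_by x (R <#> Q) = R <#> Q" if "x \<in> R" for x
        by (rule normal_in_conj_by[OF normal_in_self[OF q(1)]]) (use that q(2) in blast)
      fix y assume y: "y \<in> E"
      have sub: "conj_by y (R <#> Q) \<subseteq> R <#> Q"
      proof
        fix z assume "z \<in> conj_by y (R <#> Q)"
        then obtain x w where x: "x \<in> R" "w \<in> Q" "z = y \<otimes> (x \<otimes> w) \<otimes> inv y"
          by (auto simp: conj_by_def set_mult_def)
        have cl: "x \<in> carrier G" "y \<in> carrier G" "w \<in> carrier G"
          using Xc x y E(3) RX Q(3) by auto
        have "x \<in> C" using True x by blast
        then have "x \<otimes> y \<otimes> inv x \<otimes> inv y \<in> Q" using C_iff RX x y by blast
        then have "inv (x \<otimes> y \<otimes> inv x \<otimes> inv y) \<in> Q" using Q(1) by (simp add: sg)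
        then have 1: "y \<otimes> x \<otimes> inv y \<otimes> inv x \<in> R <#> Q" using cl q(3) by (simp add: word subset_eq)
        have "y \<otimes> w \<otimes> inv y \<in> R <#> Q" using Q(4) E(3) y x q(3) by blast
        moreover have "z = (y \<otimes> x \<otimes> inv y \<otimes> inv x) \<otimes> x \<otimes> (y \<otimes> w \<otimes> inv y)" using x cl by (simp add: word)
        moreover have "x \<in> R <#> Q" using x q(2) by blast
        ultimately show "z \<in> R <#> Q" using 1 q(1) by (simp add: sg)
      qed
      then show "conj_by y (R <#> Q) = R <#> Q" using conj_by_eqI[OF q(1)] Xc y E(3) by blast
    qed
    have "R <#> Q \<subseteq> B" by (rule set_mult_subset[OF B(1) rr(3) B(2)])
    then have "normal_in R (R <#> Q)" using normal_in_between[OF R(3) q(1,2)] by blast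
    then have "normal_in R K"
      using normal_hall_in_characteristic[OF hall_in_subgroup[OF RB q(1,2) \<open>R <#> Q \<subseteq> B\<close>] _ nRQ] by blast
    then show False using hall_b_not_normal_in[OF Rb nK] by blast
  next
    case False
    obtain R0 where R0: "normal_in R0 X" "R0 \<subseteq> R" "R0 \<noteq> R"
      "\<And>A. subgroup A G \<Longrightarrow> A \<subseteq> R \<Longrightarrow> A \<noteq> R \<Longrightarrow> A \<subseteq> R0"
      using hall_b_unique_maximal[OF Rb] by blast
    note r0 = normal_inD[OF R0(1)]
    have RC: "R \<inter> C \<subseteq> R0"
      by (rule R0(4)[OF subgroups_Inter_pair[OF rr(1) c(1)]]) (use False in blast)+
    have R0B: "R0 \<subseteq> B" using R0(2) rr(3) by blast
    have nR0: "normal_in R0 B" by (rule normal_in_between[OF R0(1) B(1) R0B B(3)])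
    let ?M = "H <#> R0"
    note m = subgroup_set_mult[OF H(1,2) nR0]
    have comm: "x \<otimes> h \<otimes> inv x \<in> ?M" if x: "x \<in> R" and h: "h \<in> H" for x h
    proof -
      have cl: "x \<in> carrier G" "h \<in> carrier G" using Xc x h RX HX by auto
      have "h \<otimes> inv x \<otimes> inv h \<in> R" using normal_inD(4)[OF R(3), of h "inv x"] h H(2) x rr(1) by (auto simp: sg)
      then have "x \<otimes> (h \<otimes> inv x \<otimes> inv h) \<in> R" using x rr(1) by (simp add: sg)
      moreover have "x \<otimes> h \<otimes> inv x \<in> C" using c(4) RX x HC h by blast
      then have "x \<otimes> h \<otimes> inv x \<otimes> inv h \<in> C" using HC h c(1) by (auto simp: sg)
      ultimately have "x \<otimes> h \<otimes> inv x \<otimes> inv h \<in> R0" using RC cl by (auto simp: word)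
      then have "x \<otimes> h \<otimes> inv x \<otimes> inv h \<in> ?M" using m(4) by blast
      moreover have "h \<in> ?M" using m(3) h by blast
      ultimately have "x \<otimes> h \<otimes> inv x \<otimes> inv h \<otimes> h \<in> ?M" using m(1) by (simp add: sg)
      then show ?thesis using cl by (simp add: word)
    qed
    have nM: "normal_in ?M B"
    proof (rule normalizer_in_eqI[OF B(1) m(1,2) HR(2) H(2) rr(3)])
      show "conj_by x ?M = ?M" if "x \<in> H" for x
        by (rule normal_in_conj_by[OF normal_in_self[OF m(1)]]) (use that m(3) in blast)
      fix x assume x: "x \<in> R"
      have "conj_by x ?M \<subseteq> ?M"
      proof
        fix z assume "z \<in> conj_by x ?M"
        then obtain h w where h: "h \<in> H" "w \<in> R0" "z = x \<otimes> (h \<otimes> w) \<otimes> inv x"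
          by (auto simp: conj_by_def set_mult_def)
        have cl: "x \<in> carrier G" "h \<in> carrier G" "w \<in> carrier G" using Xc x h RX HX r0(3) by auto
        have "x \<otimes> w \<otimes> inv x \<in> ?M" using r0(4) RX x h(2) m(4) by blast
        moreover have "z = (x \<otimes> h \<otimes> inv x) \<otimes> (x \<otimes> w \<otimes> inv x)" using h cl by (simp add: word)
        ultimately show "z \<in> ?M" using comm[OF x h(1)] m(1) by (simp add: sg)
      qed
      then show "conj_by x ?M = ?M" using conj_by_eqI[OF m(1)] Xc RX x by blast
    qed
    have "H \<inter> R0 = {\<one>}" using HR(1) R0(2) sg(3)[OF H(1)] sg(3)[OF r0(1)] by blast
    then have iM: "card H = index ?M R0"
      using index_set_mult[OF H(1,2) nR0] by (simp add: index_triv)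
    have "card R0 dvd card R" by (rule card_dvd[OF r0(1) rr(1) R0(2)])
    then have "coprime (card R0) (index ?M R0)"
      using copR iM H(3) by (metis coprime_divisors dvd_refl)
    from Frattini_complement[OF nR0 _ nM m(4) this H(1) m(3) iM]
    have Fr: "R0 <#> normalizer_in B H = B"
      using hall_b_commute[OF Rb] R0(2) by blast
    have sN: "subgroup (normalizer_in B H) G" by (rule subgroup_normalizer_in[OF B(1) H(2)])
    have "R \<subseteq> normalizer_in B H"
    proof (rule ccontr)
      assume "\<not> ?thesis"
      then have "normalizer_in B H \<inter> R \<subseteq> R0"
        using R0(4)[OF subgroups_Inter_pair[OF sN rr(1)]] by blast
      moreover have "B \<inter> R = R0 <#> (normalizer_in B H \<inter> R)"
        using Dedekind_law[OF rr(1) R0(2) subgroup.subset[OF sN]] Fr by simp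
      ultimately have "R \<subseteq> R0" using set_mult_subset[OF r0(1) order_refl] rr(3) by blast
      then show False using R0(2,3) by blast
    qed
    moreover have "H \<subseteq> normalizer_in B H" using normal_inD(3)[OF normal_in_normalizer[OF B(1) H(1,2)]] .
    ultimately have "B \<subseteq> normalizer_in B H" using set_mult_subset[OF sN] HR(2) by blast
    then show False
      using hall_a_not_normalized[OF Ha BE B(3)] by (auto simp: normalizer_in_def)
  qed
qed

end

subsection \<open>Frobenius groups acting on an abelian group\<close>

lemma (in comm_group) finprod_swap:
  assumes "finite A" "\<And>x y. x \<in> A \<Longrightarrow> y \<in> B \<Longrightarrow> f x y \<in> carrier G"
  shows "finprod G (\<lambda>x. finprod G (f x) B) A = finprod G (\<lambda>y. finprod G (\<lambda>x. f x y) A) B"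
  using assms
proof (induction A rule: finite_induct)
  case (insert z A)
  have z: "f z \<in> B \<rightarrow> carrier G" using insert.prems by auto
  have A: "(\<lambda>y. finprod G (\<lambda>x. f x y) A) \<in> B \<rightarrow> carrier G" using insert.prems by (auto intro!: finprod_closed)
  have "finprod G (\<lambda>x. finprod G (f x) B) (insert z A) =
      finprod G (f z) B \<otimes> finprod G (\<lambda>y. finprod G (\<lambda>x. f x y) A) B"
    using insert by (subst finprod_insert) (auto intro!: finprod_closed)
  also have "\<dots> = finprod G (\<lambda>y. f z y \<otimes> finprod G (\<lambda>x. f x y) A) B"
    using finprod_multf[OF z A] by simp
  also have "\<dots> = finprod G (\<lambda>y. finprod G (\<lambda>x. f x y) (insert z A)) B"
    by (rule finprod_cong') (use insert in \<open>auto simp: Pi_iff intro!: finprod_closed\<close>)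
  finally show ?case .
qed simp

context finite_group
begin

lemma comm_group_subgroup:
  assumes "subgroup Q G" "\<And>x y. x \<in> Q \<Longrightarrow> y \<in> Q \<Longrightarrow> x \<otimes> y = y \<otimes> x"
  shows "comm_group (G\<lparr>carrier := Q\<rparr>)"
proof -
  interpret q: group "G\<lparr>carrier := Q\<rparr>" by (rule subgroup.subgroup_is_group[OF assms(1) group_axioms])
  show ?thesis by (rule q.group_comm_groupI) (simp add: assms(2))
qed

lemma conj_fixed_commute:
  assumes "x \<in> carrier G" "v \<in> carrier G" "x \<otimes> v \<otimes> inv x = v" shows "v \<otimes> x = x \<otimes> v"
proof -
  have "v \<otimes> x = x \<otimes> v \<otimes> inv x \<otimes> x" using assms(3) by simp
  then show ?thesis using assms(1,2) by (simp add: m_assoc)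
qed

lemma conjugation_hom:
  assumes "subgroup Q G" "g \<in> carrier G" "\<And>v. v \<in> Q \<Longrightarrow> g \<otimes> v \<otimes> inv g \<in> Q"
  shows "(\<lambda>v. g \<otimes> v \<otimes> inv g) \<in> hom (G\<lparr>carrier := Q\<rparr>) (G\<lparr>carrier := Q\<rparr>)"
  using assms mem_carrier[OF assms(1)] by (intro homI) (simp_all add: word)

lemma conjugates_product_centralizes:
  assumes Q: "subgroup Q G" "\<And>x y. x \<in> Q \<Longrightarrow> y \<in> Q \<Longrightarrow> x \<otimes> y = y \<otimes> x"
    and A: "subgroup A G" "\<And>x v. x \<in> A \<Longrightarrow> v \<in> Q \<Longrightarrow> x \<otimes> v \<otimes> inv x \<in> Q"
    and v: "v \<in> Q"
  shows "finprod (G\<lparr>carrier := Q\<rparr>) (\<lambda>x. x \<otimes> v \<otimes> inv x) A \<in> centralizer_in Q A"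
proof -
  let ?Q = "G\<lparr>carrier := Q\<rparr>" and ?f = "\<lambda>x. x \<otimes> v \<otimes> inv x"
  interpret q: comm_group ?Q by (rule comm_group_subgroup[OF Q])
  let ?p = "finprod ?Q ?f A"
  have f: "?f \<in> A \<rightarrow> Q" using A v by blast
  have p: "?p \<in> Q" using q.finprod_closed[of ?f A] f by simp
  have Ac: "\<And>x. x \<in> A \<Longrightarrow> x \<in> carrier G" and Qc: "\<And>x. x \<in> Q \<Longrightarrow> x \<in> carrier G"
    using A Q mem_carrier by blast+
  have "?p \<otimes> c = c \<otimes> ?p" if c: "c \<in> A" for c
  proof -
    have inj: "inj_on (\<lambda>x. c \<otimes> x) A" using Ac c by (auto intro!: inj_onI)
    have img: "(\<lambda>x. c \<otimes> x) ` A = A"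
      by (rule endo_inj_surj[OF finite_subgroup[OF A(1)] _ inj]) (use c A(1) in \<open>auto simp: sg\<close>)
    have "c \<otimes> ?p \<otimes> inv c = finprod ?Q (\<lambda>x. c \<otimes> ?f x \<otimes> inv c) A"
      using q.finprod_hom[OF conjugation_hom[OF Q(1) Ac[OF c] A(2)[OF c]], of ?f A] f by simp
    also have "\<dots> = finprod ?Q (\<lambda>x. ?f (c \<otimes> x)) A"
    proof (rule q.finprod_cong')
      show "(\<lambda>x. ?f (c \<otimes> x)) \<in> A \<rightarrow> carrier ?Q" using A v c by (auto simp: sg)
      show "c \<otimes> ?f x \<otimes> inv c = ?f (c \<otimes> x)" if "x \<in> A" for x
        using that Ac[OF c] Ac[OF that] Qc[OF v] by (simp add: word)
    qed simp
    also have "\<dots> = ?p" using q.finprod_reindex[of ?f "\<lambda>x. c \<otimes> x" A] inj f by (simp add: img)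
    finally have "c \<otimes> ?p \<otimes> inv c = ?p" .
    then show ?thesis by (rule conj_fixed_commute[OF Ac[OF c] Qc[OF p]])
  qed
  then show ?thesis using p by (auto simp: centralizer_in_def)
qed

text \<open>The product of all \<open>(r u r\<inverse>) v (r u r\<inverse>)\<inverse>\<close> is computed in two ways. For fixed \<open>r\<close>, the product over
  \<open>u\<close> is centralised by \<open>r U r\<inverse>\<close>, hence trivial. For fixed \<open>u \<noteq> 1\<close>, the commutators \<open>r u r\<inverse> u\<inverse>\<close> run
  through \<open>R\<close>, so the product over \<open>r\<close> is centralised by \<open>R\<close>, hence trivial as well. The factor that
  remains, for \<open>u = 1\<close>, is \<open>v\<close> to the power \<open>|R|\<close>.\<close>

lemma Frobenius_group_action_trivial:
  assumes Q: "subgroup Q G" "\<And>x y. x \<in> Q \<Longrightarrow> y \<in> Q \<Longrightarrow> x \<otimes> y = y \<otimes> x"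
    and R: "subgroup R G" "\<And>x v. x \<in> R \<Longrightarrow> v \<in> Q \<Longrightarrow> x \<otimes> v \<otimes> inv x \<in> Q"
    and U: "subgroup U G" "\<And>x v. x \<in> U \<Longrightarrow> v \<in> Q \<Longrightarrow> x \<otimes> v \<otimes> inv x \<in> Q"
    and UR: "\<And>u x. u \<in> U \<Longrightarrow> x \<in> R \<Longrightarrow> u \<otimes> x \<otimes> inv u \<in> R"
    and free: "\<And>u. u \<in> U \<Longrightarrow> u \<noteq> \<one> \<Longrightarrow> centralizer_in R {u} = {\<one>}"
    and CR: "centralizer_in Q R = {\<one>}" and CU: "centralizer_in Q U = {\<one>}"
    and cop: "coprime (card R) (card Q)"
  shows "Q = {\<one>}"
proof -
  let ?Q = "G\<lparr>carrier := Q\<rparr>"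
  interpret q: comm_group ?Q by (rule comm_group_subgroup[OF Q])
  have Rc: "\<And>x. x \<in> R \<Longrightarrow> x \<in> carrier G" and Qc: "\<And>x. x \<in> Q \<Longrightarrow> x \<in> carrier G"
    and Uc: "\<And>x. x \<in> U \<Longrightarrow> x \<in> carrier G"
    using R Q U mem_carrier by blast+
  have prodR: "finprod ?Q (\<lambda>x. x \<otimes> v \<otimes> inv x) R = \<one>" if "v \<in> Q" for v
    using conjugates_product_centralizes[OF Q R that] CR by blast
  have prodU: "finprod ?Q (\<lambda>x. x \<otimes> v \<otimes> inv x) U = \<one>" if "v \<in> Q" for v
    using conjugates_product_centralizes[OF Q U that] CU by blast
  have "v = \<one>" if v: "v \<in> Q" for v
  proof -
    note vc = Qc[OF v]
    define f where "f r u = (r \<otimes> u \<otimes> inv r) \<otimes> v \<otimes> inv (r \<otimes> u \<otimes> inv r)" for r u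
    have inner: "u \<otimes> (inv r \<otimes> v \<otimes> r) \<otimes> inv u \<in> Q" if "r \<in> R" "u \<in> U" for r u
      using U(2)[OF that(2) R(2)[OF sg(2)[OF R(1) that(1)] v]] Rc[OF that(1)] by simp
    have f_alt: "f r u = r \<otimes> (u \<otimes> (inv r \<otimes> v \<otimes> r) \<otimes> inv u) \<otimes> inv r" if "r \<in> R" "u \<in> U" for r u
      using that Rc Uc vc by (simp add: f_def word)
    have fQ: "f r u \<in> Q" if "r \<in> R" "u \<in> U" for r u
      using R(2)[OF that(1) inner[OF that]] f_alt[OF that] by simp
    have row: "finprod ?Q (f r) U = \<one>" if r: "r \<in> R" for r
    proof -
      let ?w = "inv r \<otimes> v \<otimes> r"
      have w: "?w \<in> Q" using R(2)[OF sg(2)[OF R(1) r] v] Rc[OF r] by simp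
      have "finprod ?Q (f r) U = finprod ?Q (\<lambda>u. r \<otimes> (u \<otimes> ?w \<otimes> inv u) \<otimes> inv r) U"
        by (rule q.finprod_cong') (use fQ f_alt r in auto)
      also have "\<dots> = r \<otimes> finprod ?Q (\<lambda>u. u \<otimes> ?w \<otimes> inv u) U \<otimes> inv r"
        by (rule q.finprod_hom[OF conjugation_hom[OF Q(1) Rc[OF r] R(2)[OF r]]]) (use U(2) w in auto)
      finally show ?thesis using prodU[OF w] Rc[OF r] by simp
    qed
    have column: "finprod ?Q (\<lambda>r. f r u) R = \<one>" if u: "u \<in> U" "u \<noteq> \<one>" for u
    proof -
      let ?c = "\<lambda>r. r \<otimes> u \<otimes> inv r \<otimes> inv u" and ?w = "u \<otimes> v \<otimes> inv u"
      have uc: "u \<in> carrier G" by (rule Uc[OF u(1)])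
      have w: "?w \<in> Q" by (rule U(2)[OF u(1) v])
      have cR: "?c r \<in> R" if r: "r \<in> R" for r
      proof -
        have "r \<otimes> (u \<otimes> inv r \<otimes> inv u) \<in> R" using UR[OF u(1) sg(2)[OF R(1) r]] r R(1) by (simp add: sg)
        then show ?thesis using uc Rc[OF r] by (simp add: word)
      qed
      have inj: "inj_on ?c R"
      proof (rule inj_onI)
        fix r s assume rs: "r \<in> R" "s \<in> R" "?c r = ?c s"
        have c: "r \<in> carrier G" "s \<in> carrier G" using rs Rc by auto
        have e: "r \<otimes> u \<otimes> inv r = s \<otimes> u \<otimes> inv s"
        proof -
          have "?c r \<otimes> u = ?c s \<otimes> u" using rs(3) by simp
          then show ?thesis using c uc by (simp add: word)
        qed
        have "inv s \<otimes> r \<otimes> u = inv s \<otimes> (r \<otimes> u \<otimes> inv r) \<otimes> r" using c uc by (simp add: word)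
        also have "\<dots> = u \<otimes> (inv s \<otimes> r)" unfolding e using c uc by (simp add: word)
        finally have "inv s \<otimes> r \<otimes> u = u \<otimes> (inv s \<otimes> r)" .
        moreover have "inv s \<otimes> r \<in> R" using rs R(1) by (simp add: sg)
        ultimately have "inv s \<otimes> r \<in> centralizer_in R {u}" by (auto simp: centralizer_in_def)
        then have "inv s \<otimes> r = \<one>" using free[OF u] by blast
        then have "s \<otimes> (inv s \<otimes> r) = s" using c by simp
        then show "r = s" using c by simp
      qed
      have img: "?c ` R = R" by (rule endo_inj_surj[OF finite_subgroup[OF R(1)] _ inj]) (use cR in blast)
      have "finprod ?Q (\<lambda>r. f r u) R = finprod ?Q (\<lambda>r. ?c r \<otimes> ?w \<otimes> inv (?c r)) R"
      proof (rule q.finprod_cong')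
        show "(\<lambda>r. ?c r \<otimes> ?w \<otimes> inv (?c r)) \<in> R \<rightarrow> carrier ?Q" using R(2)[OF cR w] by simp
        show "f r u = ?c r \<otimes> ?w \<otimes> inv (?c r)" if "r \<in> R" for r
          using Rc[OF that] uc vc by (simp add: f_def word)
      qed simp
      also have "\<dots> = finprod ?Q (\<lambda>s. s \<otimes> ?w \<otimes> inv s) R"
        using q.finprod_reindex[of "\<lambda>s. s \<otimes> ?w \<otimes> inv s" ?c R] inj R(2)[OF _ w] by (simp add: img)
      finally show ?thesis using prodR[OF w] by simp
    qed
    have column_one: "finprod ?Q (\<lambda>r. f r \<one>) R = v [^] card R"
    proof -
      have "finprod ?Q (\<lambda>r. f r \<one>) R = finprod ?Q (\<lambda>r. v) R"
        by (rule q.finprod_cong') (use Rc vc v in \<open>auto simp: f_def\<close>)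
      then show ?thesis using q.finprod_const[of v R] v nat_pow_consistent by simp
    qed
    have vR: "v [^] card R \<in> Q" using q.nat_pow_closed[of v "card R"] v nat_pow_consistent by simp
    have "\<one> = finprod ?Q (\<lambda>r. finprod ?Q (f r) U) R"
      using q.finprod_one_eqI[of R "\<lambda>r. finprod ?Q (f r) U"] row by simp
    also have "\<dots> = finprod ?Q (\<lambda>u. finprod ?Q (\<lambda>r. f r u) R) U"
      by (rule q.finprod_swap[OF finite_subgroup[OF R(1)]]) (use fQ in simp)
    also have "\<dots> = finprod ?Q (\<lambda>u. if \<one> = u then v [^] card R else \<one>\<^bsub>?Q\<^esub>) U"
      by (rule q.finprod_cong') (use column column_one vR sg(3)[OF Q(1)] in auto)
    also have "\<dots> = v [^] card R"
      using q.finprod_singleton[of \<one> U "\<lambda>_. v [^] card R"] sg(3)[OF U(1)] finite_subgroup[OF U(1)] vR by simp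
    finally have 1: "v [^] card R = \<one>" by simp
    have 2: "v [^] card Q = \<one>"
      using q.pow_card_carrier[of v] v finite_subgroup[OF Q(1)] nat_pow_consistent by simp
    have "ord v dvd card R" "ord v dvd card Q" using pow_eq_id[OF vc] 1 2 by auto
    then have "ord v = 1" using cop by (metis coprime_common_divisor_nat)
    then show ?thesis using ord_eq_1[OF vc] by simp
  qed
  then show ?thesis using sg(3)[OF Q(1)] by blast
qed

lemma long_maximal_chain:
  assumes "subgroup A G" "subgroup B G" "subgroup C G" "subgroup D G"
    and "A \<subseteq> B" "A \<noteq> B" "B \<subseteq> C" "B \<noteq> C" "C \<subseteq> D" "C \<noteq> D"
  shows "\<exists>k>2. maximal_chain D k A"
proof -
  obtain i j k where "maximal_chain B (Suc i) A" "maximal_chain C (Suc j) B" "maximal_chain D (Suc k) C"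
    using maximal_chain_exists_proper assms by meson
  then have "maximal_chain D (Suc i + Suc j + Suc k) A"
    using maximal_chain_trans by blast
  then show ?thesis by (intro exI[of _ "Suc i + Suc j + Suc k"]) simp
qed

end

subsection \<open>Two classes\<close>

context minimal_nondispersive_series
begin

text \<open>If \<open>U\<close> is maximal in \<open>U Q\<close>, it acts irreducibly on \<open>Q\<close>.\<close>

lemma Q_irreducible:
  assumes "subgroup U G" "U \<subseteq> X" "maximal_in U (U <#> Q)" "subgroup A G" "A \<subseteq> Q"
    and "\<And>u. u \<in> U \<Longrightarrow> conj_by u A \<subseteq> A" "U \<inter> Q = {\<one>}"
  shows "A = {\<one>} \<or> A = Q"
proof -
  have s: "subgroup (U <#> A) G"
    by (rule subgroup_set_mult_normalized[OF assms(1,4)]) (use assms(6) in \<open>auto simp: conj_by_def\<close>)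
  have "U <#> A \<subseteq> U <#> Q" by (rule mono_set_mult) (use assms(5) in auto)
  then have "U <#> A = U \<or> U <#> A = U <#> Q"
    using maximal_inD(5)[OF assms(3) s subset_set_mult(1)[OF assms(1,4)]] by blast
  then show ?thesis
  proof
    assume "U <#> A = U"
    then have "A \<subseteq> U \<inter> Q" using subset_set_mult(2)[OF assms(1,4)] assms(5) by blast
    then show ?thesis using assms(7) sg(3)[OF assms(4)] by blast
  next
    assume e: "U <#> A = U <#> Q"
    have "U \<inter> A = {\<one>}" using assms(5,7) sg(3)[OF assms(1)] sg(3)[OF assms(4)] by blast
    then have "card A = card Q"
      using card_set_mult[OF assms(1,4)] card_set_mult[OF assms(1) Q(1)] e assms(7) card_pos[OF assms(1)] by simp
    then show ?thesis using subgroup_eqI_card[OF assms(4) Q(1) assms(5)] by blast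
  qed
qed

text \<open>Suppose \<open>Q = E\<close>, so that \<open>a\<close> and \<open>b\<close> are the only classes and \<open>n = 2\<close>. Let \<open>R\<close> be a Hall subgroup for
  \<open>b\<close>, let \<open>N = R U\<close> be its normaliser and \<open>H = Q U\<close>. The bound on the length of maximal chains turns every
  inclusion in sight into a maximal one: \<open>R\<close> is maximal in \<open>R Q\<close>, \<open>U\<close> in \<open>H\<close>, and \<open>R\<close> and \<open>U\<close> have no
  proper nontrivial subgroups. Hence \<open>Q\<close> is abelian, \<open>R\<close> and \<open>U\<close> act on it without nontrivial fixed points,
  and \<open>R U\<close> is a Frobenius group, which is impossible.\<close>

theorem contradiction: False
proof -
  have nEK: "normal_in E K" by (rule normal_in_between[OF nE K(1) EK K(3)])
  have copE: "coprime (card E) (index K E)"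
    using pi_number_coprime[OF index_KE card_E] by (simp add: coprime_commute)
  obtain R where R0: "subgroup R G" "R \<subseteq> K" "card R = index K E"
    using Schur_Zassenhaus[OF finite_group_axioms nEK copE] by blast
  have KR: "index K R = card E"
    using card_index[OF R0(1) K(1) R0(2)] card_index[OF E(1) K(1) EK] R0(3) card_pos[OF R0(1)]
    by (metis mult.commute mult_cancel1 not_gr_zero)
  have Rb: "hall_in b R X"
    using R0 K(3) X index_KE index_trans[OF R0(1) K(1,2) R0(2) K(3)] KR card_E index_XK_b
    by (auto simp: hall_in_def pi_number_mult)
  note r = hall_inD[OF Rb]
  have RQ: "R \<inter> Q = {\<one>}" "R <#> Q = K" using hall_b_factorisation[OF Rb] E_eq_Q by auto
  obtain k where k: "maximal_chain K k (R <#> Q)" "n = k + 2" and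
    RK: "maximal_in R (R <#> Q)" and KX: "maximal_in K X"
    using hall_b_chain_exact[OF Rb] by blast
  have "k = 0"
  proof (rule ccontr)
    assume "k \<noteq> 0"
    then obtain A where "maximal_in K A" "A \<subseteq> K"
      using k(1) maximal_chainD(3) unfolding RQ(2) by (auto elim: maximal_chain.cases)
    then show False using maximal_inD(3,4) by blast
  qed
  then have n: "n = 2" using k(2) by simp
  have long: "class_subnormal X A" if "subgroup A G" "subgroup B G" "subgroup C G"
    "A \<subseteq> B" "A \<noteq> B" "B \<subseteq> C" "B \<noteq> C" "C \<subseteq> X" "C \<noteq> X" for A B C
    using long_maximal_chain[OF that(1-3) X that(4-)] long_chains n by blast
  note not_normal = hall_b_not_normal_in[OF Rb]
  obtain p j where p: "prime p" "card R = p ^ j" using hall_b_prime_power[OF Rb] by blast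
  have "j \<noteq> 0" using p(2) hall_b_ne[OF Rb] card_1_iff[OF r(1)] by (cases j) auto
  then have pb: "p \<in> b" using p r(4) by (auto simp: pi_number_def)
  have sylR: "sylow_of p R K"
    unfolding sylow_of_def using R0(1,2) p KR card_E pb by (auto simp: pi_number_def)
  define N where "N = normalizer_in X R"
  have sN: "subgroup N G" "N \<subseteq> X"
    unfolding N_def by (rule subgroup_normalizer_in[OF X r(3)], rule normalizer_in_subset)
  have RN: "normal_in R N" unfolding N_def by (rule normal_in_normalizer[OF X r(1,3)])
  note rn = normal_inD[OF RN]
  have NX: "N \<noteq> X" using RN not_normal[OF normal_in_self[OF X]] by auto
  have KN: "K <#> N = X" unfolding N_def by (rule Frattini_sylow[OF nK sylR])
  have NK: "K \<inter> N = R"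
  proof -
    have s: "subgroup (K \<inter> N) G" by (rule subgroups_Inter_pair[OF K(1) sN(1)])
    have "K \<inter> N = R \<or> K \<inter> N = K"
      using maximal_inD(5)[OF RK s] rn(3) R0(2) unfolding RQ(2) by blast
    moreover have "K \<inter> N \<noteq> K"
    proof
      assume "K \<inter> N = K"
      then have "normal_in R K" using normal_in_between[OF RN K(1) R0(2)] by blast
      then show False using not_normal[OF nK] by blast
    qed
    ultimately show ?thesis by blast
  qed
  have iNR: "index N R = index X K"
    using index_Int_factor[OF K(1) sN(1) KN K(2,3)] NK by simp
  have copU: "coprime (card R) (index N R)"
    by (rule pi_number_coprime[OF r(4)]) (simp add: iNR index_XK_b)
  obtain U where U: "subgroup U G" "U \<subseteq> N" "card U = index N R"
    using Schur_Zassenhaus[OF finite_group_axioms RN copU] by blast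
  have "card R * card U = card N" using U(3) card_index[OF rn(1-3)] by simp
  then have RU: "R \<inter> U = {\<one>}" "R <#> U = N"
    using coprime_factorisation[OF r(1) U(1) sN(1) rn(3) U(2)] copU U(3) by auto
  have UX: "U \<subseteq> X" using U(2) sN(2) by blast
  have Une: "U \<noteq> {\<one>}" using U(3) iNR index_XK_ne card_1_iff[OF U(1)] by simp
  have KU: "K \<inter> U = {\<one>}" using NK U(2) RU(1) sg(3)[OF K(1)] sg(3)[OF U(1)] by blast
  have UQ: "U \<inter> Q = {\<one>}" using KU QK sg(3)[OF U(1)] sg(3)[OF Q(1)] by blast
  define H where "H = U <#> Q"
  note h = subgroup_set_mult[OF U(1) UX nQ, folded H_def]
  have cH: "card H = card Q * index X K"
    using card_set_mult_index[OF U(1) UX nQ] UQ U(3) iNR by (simp add: H_def index_triv)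
  have cX: "card X = card H * card R"
    using card_X E_eq_Q index_self[OF Q(1)] cH R0(3) by simp
  have "index X H = card R" using cX card_pos[OF h(1)] by (simp add: index_def)
  moreover have "pi_number (- a) (card R)"
    by (rule pi_number_class_neq[OF ab(1,2) _ r(4)]) (use ab in blast)
  ultimately have Ha: "hall_in a H X"
    using h X cH card_Q index_XK by (auto simp: hall_in_def pi_number_mult)
  have cU: "pi_number a (card U)" using U(3) iNR index_XK by simp
  obtain H0 where H0: "normal_in H0 X" "H0 \<subseteq> H"
    "\<And>A. class_subnormal X A \<Longrightarrow> pi_number a (card A) \<Longrightarrow> A \<subseteq> H0"
    using hall_core_exists[OF Ha ab(1)] by blast
  have QH0: "Q \<subseteq> H0"
    by (rule H0(3)[OF class_subnormal_normal[OF class_subnormal_refl[OF X] nQ] card_Q])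
  have U_not: "\<not> class_subnormal X U"
  proof
    assume "class_subnormal X U"
    then have "U \<subseteq> H0" using H0(3) cU by blast
    then have "H = H0"
      using set_mult_subset[OF normal_inD(1)[OF H0(1)] _ QH0, of U] H0(2) unfolding H_def by blast
    then show False using H0(1) hall_a_not_normal[OF Ha] by blast
  qed
  have Q_not: "\<not> Q \<subseteq> U" using UQ Q_ne sg(3)[OF Q(1)] by blast
  have UH: "U \<noteq> H" using Q_not h(4) by blast
  have R_ne1: "card R \<noteq> 1" using hall_b_ne[OF Rb] card_1_iff[OF r(1)] by simp
  have HX: "H \<noteq> X" using cX R_ne1 card_pos[OF h(1)] by auto
  have maxH: "maximal_in H X"
    unfolding maximal_in_def using long[OF U(1) h(1) _ h(3) UH] U_not h(1,2) X HX by blast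
  have maxU: "maximal_in U H"
    unfolding maximal_in_def using long[OF U(1) _ h(1) _ _ _ _ h(2) HX] U_not U(1) h(1,3) UH by blast
  have U_simple: "A = {\<one>} \<or> A = U" if A: "subgroup A G" "A \<subseteq> U" for A
  proof -
    note t = subgroup_set_mult[OF A(1) _ nK, OF order_trans[OF A(2) UX]]
    have i: "card (A <#> K) = card K * card A"
    proof -
      have "A \<inter> K = {\<one>}" using KU A(2) sg(3)[OF A(1)] sg(3)[OF K(1)] by blast
      then show ?thesis
        using card_set_mult_index[OF A(1) order_trans[OF A(2) UX] nK] by (simp add: index_triv)
    qed
    have "A <#> K = K \<or> A <#> K = X" using maximal_inD(5)[OF KX t(1,4,2)] .
    then have "card A = 1 \<or> card A = card U"
      using i card_pos[OF K(1)] card_index[OF K(1-3)] U(3) iNR by auto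
    then show ?thesis using card_1_iff[OF A(1)] subgroup_eqI_card[OF A(1) U(1) A(2)] by blast
  qed
  have R_simple: "A = {\<one>} \<or> A = R" if A: "subgroup A G" "A \<subseteq> R" for A
  proof -
    obtain R0 where R0: "normal_in R0 X" "R0 \<subseteq> R" "R0 \<noteq> R"
      "\<And>A. subgroup A G \<Longrightarrow> A \<subseteq> R \<Longrightarrow> A \<noteq> R \<Longrightarrow> A \<subseteq> R0"
      using hall_b_unique_maximal[OF Rb] by blast
    note t = subgroup_set_mult[OF h(1,2) R0(1)] and r0 = normal_inD[OF R0(1)]
    have cR0: "pi_number b (card R0)" by (rule pi_number_dvd[OF r(4) card_dvd[OF r0(1) r(1) R0(2)]])
    have HR: "H \<inter> R = {\<one>}"
    proof -
      have D: "subgroup (H \<inter> R) G" by (rule subgroups_Inter_pair[OF h(1) r(1)])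
      have "card (H \<inter> R) dvd card H" "card (H \<inter> R) dvd card R"
        by (rule card_dvd[OF D h(1)] card_dvd[OF D r(1)], blast)+
      then have "card (H \<inter> R) = 1"
        using hall_inD(4)[OF Ha] r(4) pi_number_dvd pi_number_both_disjoint[OF _ _ class_disjoint[OF ab]] by metis
      then show ?thesis using card_1_iff[OF D] by simp
    qed
    have "H <#> R0 = H \<or> H <#> R0 = X" by (rule maximal_inD(5)[OF maxH t(1,3,2)])
    then have "R0 = {\<one>}"
    proof
      assume "H <#> R0 = H"
      then have "R0 \<subseteq> H \<inter> R" using t(4) R0(2) by blast
      then show ?thesis using HR sg(3)[OF r0(1)] by blast
    next
      assume e: "H <#> R0 = X"
      have "H \<inter> R0 = {\<one>}" using HR R0(2) sg(3)[OF h(1)] sg(3)[OF r0(1)] by blast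
      then have "card R0 = card R"
        using card_set_mult[OF h(1) r0(1)] e cX card_pos[OF h(1)] by auto
      then have "R0 = R" by (rule subgroup_eqI_card[OF r0(1) r(1) R0(2)])
      then show ?thesis using R0(3) by blast
    qed
    then show ?thesis using R0(4)[OF A] sg(3)[OF A(1)] by blast
  qed
  have Xc: "\<And>x. x \<in> X \<Longrightarrow> x \<in> carrier G" using X mem_carrier by blast
  have Rc: "R \<subseteq> carrier G" and Uc: "U \<subseteq> carrier G" and Qc: "Q \<subseteq> carrier G"
    using r(1) U(1) Q(1) subgroup.subset by blast+
  \<comment> \<open>If \<open>R\<close> and \<open>U\<close> commute, then \<open>H = Q U\<close> is normalised by \<open>R\<close>.\<close>
  have not_commute: "\<not> (\<forall>x\<in>R. \<forall>u\<in>U. x \<otimes> u = u \<otimes> x)"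
  proof
    assume comm: "\<forall>x\<in>R. \<forall>u\<in>U. x \<otimes> u = u \<otimes> x"
    have "normal_in H X"
    proof (rule normalizer_in_eqI[OF X h(1,2) _ h(2) r(3)])
      have "coprime (card H) (card R)"
        by (rule pi_number_coprime[OF hall_inD(4)[OF Ha]])
           (rule pi_number_class_neq[OF ab(1,2) _ r(4)], use ab in blast)
      then show "H <#> R = X" using coprime_factorisation(2)[OF h(1) r(1) X h(2) r(3)] cX by simp
      show "conj_by x H = H" if "x \<in> H" for x
        by (rule normal_in_conj_by[OF normal_in_self[OF h(1)] that])
      fix x assume x: "x \<in> R"
      have xc: "x \<in> carrier G" using x Rc by blast
      have "x \<otimes> u \<otimes> inv x = u" if "u \<in> U" for u
      proof -
        have "x \<otimes> u = u \<otimes> x" using comm x that by blast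
        then show ?thesis using xc that Uc by (simp add: word subset_eq)
      qed
      then have "conj_by x U = U" by (simp add: conj_by_def)
      moreover have "conj_by x Q = Q" using normal_in_conj_by[OF nQ] r(3) x by blast
      ultimately show "conj_by x H = H" unfolding H_def using conj_by_set_mult[OF xc Uc Qc] by simp
    qed
    then show False using hall_a_not_normal[OF Ha] by blast
  qed
  have invariant_R: "A = {\<one>} \<or> A = Q" if "subgroup A G" "A \<subseteq> Q" "\<And>x. x \<in> R \<Longrightarrow> conj_by x A \<subseteq> A" for A
    by (rule Q_irreducible[OF r(1,3) RK that RQ(1)])
  have invariant_U: "A = {\<one>} \<or> A = Q" if "subgroup A G" "A \<subseteq> Q" "\<And>x. x \<in> U \<Longrightarrow> conj_by x A \<subseteq> A" for A
    by (rule Q_irreducible[OF U(1) UX maxU[unfolded H_def] that UQ])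
  have centralized: "conj_by x (centralizer_in Q Y) \<subseteq> centralizer_in Q Y"
    if "x \<in> Y" "Y \<subseteq> carrier G" for x Y
  proof
    fix z assume "z \<in> conj_by x (centralizer_in Q Y)"
    then obtain v where v: "v \<in> centralizer_in Q Y" "z = x \<otimes> v \<otimes> inv x" by (auto simp: conj_by_def)
    have c: "x \<in> carrier G" "v \<in> carrier G" using v that Qc by (auto simp: centralizer_in_def)
    have "v \<otimes> x = x \<otimes> v" using v(1) that(1) unfolding centralizer_in_def by blast
    then have "x \<otimes> v = v \<otimes> x" by simp
    then have "z = v" unfolding v(2) using c by (simp add: m_assoc)
    then show "z \<in> centralizer_in Q Y" using v(1) by simp
  qed
  have CR: "centralizer_in Q R = {\<one>}"
  proof -
    have "centralizer_in Q R = {\<one>} \<or> centralizer_in Q R = Q"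
      by (rule invariant_R[OF subgroup_centralizer_in[OF Q(1) Rc] _ centralized[OF _ Rc]])
         (auto simp: centralizer_in_def)
    moreover have "centralizer_in Q R \<noteq> Q"
    proof
      assume e: "centralizer_in Q R = Q"
      have "normal_in R K"
      proof (rule normalizer_in_eqI[OF K(1) r(1) R0(2) RQ(2) R0(2) QK])
        show "conj_by x R = R" if "x \<in> R" for x
          by (rule normal_in_conj_by[OF normal_in_self[OF r(1)] that])
        fix v assume v: "v \<in> Q"
        have "v \<otimes> x \<otimes> inv v = x" if "x \<in> R" for x
        proof -
          have "v \<in> centralizer_in Q R" using e v by simp
          then have "v \<otimes> x = x \<otimes> v" using that unfolding centralizer_in_def by blast
          then show ?thesis using v that Qc Rc by (simp add: word subset_eq)
        qed
        then show "conj_by v R = R" by (simp add: conj_by_def)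
      qed
      then show False using not_normal[OF nK] by blast
    qed
    ultimately show ?thesis by blast
  qed
  have UR: "u \<otimes> x \<otimes> inv u \<in> R" if "u \<in> U" "x \<in> R" for u x
    using rn(4) U(2) that by blast
  have CU: "centralizer_in Q U = {\<one>}"
  proof -
    have "centralizer_in Q U = {\<one>} \<or> centralizer_in Q U = Q"
      by (rule invariant_U[OF subgroup_centralizer_in[OF Q(1) Uc] _ centralized[OF _ Uc]])
         (auto simp: centralizer_in_def)
    moreover have "centralizer_in Q U \<noteq> Q"
    proof
      assume e: "centralizer_in Q U = Q"
      let ?C = "centralizer_in X Q"
      have nC: "normal_in ?C X" by (rule normal_in_centralizer[OF nQ])
      note c = normal_inD[OF nC]
      have UC: "U \<subseteq> ?C"
      proof
        fix u assume u: "u \<in> U"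
        have "u \<otimes> v = v \<otimes> u" if "v \<in> Q" for v
        proof -
          have "v \<in> centralizer_in Q U" using e that by simp
          then show ?thesis using u by (auto simp: centralizer_in_def)
        qed
        then show "u \<in> ?C" using u UX by (auto simp: centralizer_in_def)
      qed
      have "?C \<inter> R = {\<one>} \<or> ?C \<inter> R = R"
        by (rule R_simple[OF subgroups_Inter_pair[OF c(1) r(1)]]) blast
      then show False
      proof
        assume "?C \<inter> R = R"
        then have RC: "R \<subseteq> ?C" by blast
        have "Q \<subseteq> centralizer_in Q R"
        proof
          fix v assume v: "v \<in> Q"
          have "v \<otimes> x = x \<otimes> v" if "x \<in> R" for x
          proof -
            have "x \<in> ?C" using RC that by blast
            then show ?thesis using v by (auto simp: centralizer_in_def)
          qed
          then show "v \<in> centralizer_in Q R" using v by (auto simp: centralizer_in_def)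
        qed
        then show False using CR Q_ne sg(3)[OF Q(1)] by blast
      next
        assume CR1: "?C \<inter> R = {\<one>}"
        have "x \<otimes> u = u \<otimes> x" if x: "x \<in> R" and u: "u \<in> U" for x u
        proof -
          have cl: "x \<in> carrier G" "u \<in> carrier G" using x u Rc Uc by auto
          have "x \<otimes> u \<otimes> inv x \<in> ?C" using c(4) r(3) x UC u by blast
          then have 1: "x \<otimes> u \<otimes> inv x \<otimes> inv u \<in> ?C" using UC u c(1) by (auto simp: sg)
          have "x \<otimes> (u \<otimes> inv x \<otimes> inv u) \<in> R" using UR[OF u sg(2)[OF r(1) x]] x r(1) by (simp add: sg)
          then have "x \<otimes> u \<otimes> inv x \<otimes> inv u \<in> R" using cl by (simp add: word)
          then have "x \<otimes> u \<otimes> inv x \<otimes> inv u = \<one>" using 1 CR1 by blast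
          then have "x \<otimes> u \<otimes> inv x \<otimes> inv u \<otimes> (u \<otimes> x) = u \<otimes> x" using cl by simp
          then show ?thesis using cl by (simp add: word)
        qed
        then show False using not_commute by blast
      qed
    qed
    ultimately show ?thesis by blast
  qed
  have free: "centralizer_in R {u} = {\<one>}" if u: "u \<in> U" "u \<noteq> \<one>" for u
  proof (rule ccontr)
    assume "centralizer_in R {u} \<noteq> {\<one>}"
    moreover have "subgroup (centralizer_in R {u}) G"
      by (rule subgroup_centralizer_in[OF r(1)]) (use u Uc in blast)
    ultimately have e: "centralizer_in R {u} = R"
      using R_simple[of "centralizer_in R {u}"] by (auto simp: centralizer_in_def)
    have "u \<in> centralizer_in U R"
      unfolding centralizer_in_def
    proof (intro CollectI conjI ballI)
      fix x assume "x \<in> R"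
      then have "x \<in> centralizer_in R {u}" using e by simp
      then show "u \<otimes> x = x \<otimes> u" by (auto simp: centralizer_in_def)
    qed (rule u(1))
    then have "centralizer_in U R \<noteq> {\<one>}" using u(2) by blast
    moreover have "subgroup (centralizer_in U R) G" by (rule subgroup_centralizer_in[OF U(1) Rc])
    ultimately have "centralizer_in U R = U"
      using U_simple[of "centralizer_in U R"] by (auto simp: centralizer_in_def)
    then have "x \<otimes> v = v \<otimes> x" if "x \<in> R" "v \<in> U" for x v
    proof -
      have "v \<in> centralizer_in U R" using \<open>centralizer_in U R = U\<close> that by simp
      then show ?thesis using that by (auto simp: centralizer_in_def)
    qed
    then show False using not_commute by blast
  qed
  \<comment> \<open>A Sylow subgroup of \<open>Q\<close> is normalised by a conjugate of \<open>R\<close>, so a conjugate of it is all of \<open>Q\<close>.\<close>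
  have Q_abelian: "v \<otimes> w = w \<otimes> v" if "v \<in> Q" "w \<in> Q" for v w
  proof -
    obtain t where t: "prime t" "t dvd card Q" using nontrivial_prime_divisor[OF Q(1) Q_ne] by blast
    obtain P where P: "sylow_of t P Q" using sylow_exists[OF t(1) Q(1)] by blast
    note s = sylow_ofD[OF P]
    have Pne: "P \<noteq> {\<one>}" by (rule sylow_of_nontrivial[OF P t(2)])
    have nQK: "normal_in Q K" by (rule normal_in_between[OF nQ K(1) QK K(3)])
    have PK: "P \<subseteq> K" using s(3) QK by blast
    have Pc: "P \<subseteq> carrier G" using s(2) by (rule subgroup.subset)
    let ?Y = "normalizer_in K P"
    have Y: "subgroup ?Y G" "?Y \<subseteq> K"
      using subgroup_normalizer_in[OF K(1) PK] normalizer_in_subset by auto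
    have "index K Q = index ?Y (Q \<inter> ?Y)"
      by (rule index_Int_factor[OF Q(1) Y(1) Frattini_sylow[OF nQK P] K(1) QK])
    moreover have D: "subgroup (Q \<inter> ?Y) G" by (rule subgroups_Inter_pair[OF Q(1) Y(1)])
    ultimately have RY: "card R dvd card ?Y"
      using index_dvd_card[OF D Y(1)] R0(3) E_eq_Q by simp
    obtain T where T: "sylow_of p T ?Y" using sylow_exists[OF p(1) Y(1)] by blast
    note ts = sylow_ofD[OF T]
    have "coprime (card R) (index ?Y T)"
      using ts(5) p prime_imp_coprime[OF p(1) ts(5)] by simp
    then have RT: "card R dvd card T"
      using RY card_index[OF ts(2) Y(1) ts(3)] by (simp add: coprime_dvd_mult_left_iff)
    have TK: "T \<subseteq> K" using ts(3) Y(2) by blast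
    obtain i where "card T = p ^ i" using ts(4) by blast
    then obtain x where x: "x \<in> K" "T \<subseteq> conj_by x R"
      using sylow_conj[OF K(1) ts(2) TK _ sylR] by blast
    have xc: "x \<in> carrier G" using x(1) K(1) mem_carrier by blast
    have "card T = card (conj_by x R)"
    proof (rule antisym)
      show "card T \<le> card (conj_by x R)"
        by (rule card_mono[OF finite_subgroup[OF subgroup_conj_by[OF r(1) xc]] x(2)])
      show "card (conj_by x R) \<le> card T"
        using card_conj_by[OF xc Rc] dvd_imp_le[OF RT card_pos[OF ts(2)]] by simp
    qed
    then have TR: "T = conj_by x R"
      using subgroup_eqI_card[OF ts(2) subgroup_conj_by[OF r(1) xc] x(2)] by simp
    let ?P = "conj_by (inv x) P"
    have ix: "inv x \<in> X" using x(1) K by (auto simp: sg)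
    have "?P \<subseteq> Q" using conj_by_mono[OF s(3)] normal_in_conj_by[OF nQ ix] by blast
    moreover have sP: "subgroup ?P G" using subgroup_conj_by[OF s(2)] xc by simp
    moreover have "conj_by y ?P \<subseteq> ?P" if y: "y \<in> R" for y
    proof -
      have yc: "y \<in> carrier G" using y Rc by blast
      have "x \<otimes> y \<otimes> inv x \<in> T" using TR y by (auto simp: conj_by_def)
      then have e: "conj_by (x \<otimes> y \<otimes> inv x) P = P" using ts(3) by (auto simp: normalizer_in_def)
      have "conj_by y ?P = conj_by (y \<otimes> inv x) P" using conj_by_mult[OF yc _ Pc] xc by simp
      also have "y \<otimes> inv x = inv x \<otimes> (x \<otimes> y \<otimes> inv x)" using xc yc by (simp add: word)
      also have "conj_by (inv x \<otimes> (x \<otimes> y \<otimes> inv x)) P = ?P"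
        using conj_by_mult[OF _ _ Pc, of "inv x" "x \<otimes> y \<otimes> inv x"] xc yc e by simp
      finally show ?thesis by simp
    qed
    ultimately have "?P = {\<one>} \<or> ?P = Q" using invariant_R by blast
    moreover have cP: "card ?P = card P" using card_conj_by[of "inv x" P] xc Pc by simp
    moreover have "card P \<noteq> 1" using card_1_iff[OF s(2)] Pne by simp
    ultimately have "card Q = card P" using card_1_iff[OF sP] by auto
    then obtain m where m: "card Q = t ^ m" using s(4) by auto
    have nZ: "normal_in (centre Q) X" by (rule normal_in_centre[OF nQ])
    have "centre Q = {\<one>} \<or> centre Q = Q"
      by (rule invariant_R[OF normal_inD(1)[OF nZ]])
         (use normal_in_conj_by[OF nZ] r(3) in \<open>auto simp: centralizer_in_def\<close>)
    then have "centre Q = Q" using centre_prime_power_nontrivial[OF Q(1) m t(1) Q_ne] by blast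
    then have "v \<in> centre Q" using that by simp
    then show ?thesis using that by (auto simp: centralizer_in_def)
  qed
  have "Q = {\<one>}"
  proof (rule Frobenius_group_action_trivial[OF Q(1) Q_abelian r(1) _ U(1) _ UR free CR CU])
    show "x \<otimes> v \<otimes> inv x \<in> Q" if "x \<in> R" "v \<in> Q" for x v using Q(4) r(3) that by blast
    show "x \<otimes> v \<otimes> inv x \<in> Q" if "x \<in> U" "v \<in> Q" for x v using Q(4) UX that by blast
    show "coprime (card R) (card Q)" by (rule pi_number_coprime[OF r(4) card_Q_b])
  qed
  then show False using Q_ne by blast
qed

end

section \<open>Dispersive groups\<close>

context classed_group
begin

lemma dispersive_series_last_factor:
  assumes "dispersive_series X M" "M \<noteq> {\<one>}"
  obtains N s where "normal_in N X" "N \<subset> M" "s \<in> S" "pi_number s (index M N)" "pi_number (- s) (card N)"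
proof -
  have "M = {\<one>} \<or> (\<exists>N s. normal_in N X \<and> N \<subset> M \<and> s \<in> S \<and> pi_number s (index M N) \<and> pi_number (- s) (card N))"
    using assms(1)
  proof induction
    case (dispersive_series_step N M s)
    show ?case
    proof (cases "N = M")
      case False
      then have "N \<subset> M" using dispersive_series_step(3) by blast
      then show ?thesis
        using dispersive_series_step(4-6) dispersive_series_normal[OF dispersive_series_step(1)] by blast
    qed (use dispersive_series_step in simp)
  qed simp
  then show thesis using assms(2) that by blast
qed

end

context minimal_nondispersive
begin

lemma trivial: "X = {\<one>}"
proof (rule ccontr)
  assume X1: "X \<noteq> {\<one>}"
  obtain K a where nK: "normal_in K X" "K \<noteq> X" and a: "a \<in> S" "pi_number a (index X K)"
    using soluble_proper_normal[OF soluble X1] by blast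
  note K = normal_inD[OF nK(1)]
  have not_a: False if "pi_number a (card K)"
  proof -
    have "pi_number a (card X)" using that a(2) card_index[OF K(1-3)] by (simp add: pi_number_mult)
    then have "hall_in a X X" using X index_self[OF X] by (simp add: hall_in_def)
    then show False using no_normal_hall[OF a(1) normal_in_self[OF X]] X1 by blast
  qed
  \<comment> \<open>A normal Hall subgroup of a normal subgroup whose index belongs to \<open>a\<close> can only be for the class \<open>a\<close>.\<close>
  have class_a: "s = a" if "normal_in Y X" "pi_number a (index X Y)" "s \<in> S" "normal_in R Y" "hall_in s R Y" "R \<noteq> {\<one>}"
    for Y R s
  proof (rule ccontr)
    assume "s \<noteq> a"
    note h = hall_inD[OF that(5)] and y = normal_inD[OF that(1)]
    have "pi_number (- s) (index X Y)" by (rule pi_number_class_neq[OF that(3) a(1) \<open>s \<noteq> a\<close> that(2)])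
    then have "hall_in s R X"
      using h y index_trans[OF h(1) y(1,2) h(3) y(3)] by (auto simp: hall_in_def pi_number_mult)
    then show False
      using no_normal_hall[OF that(3) normal_hall_in_characteristic[OF that(5,4,1)]] that(6) by blast
  qed
  have dK: "dispersive_series K K" by (rule proper[OF K(1,3) nK(2)])
  have K1: "K \<noteq> {\<one>}" using not_a by auto
  obtain Q s where Q: "s \<in> S" "Q \<noteq> {\<one>}" "normal_in Q K" "hall_in s Q K"
    using dispersive_normal_hall[OF dK K1] by blast
  have "s = a" by (rule class_a[OF nK(1) a(2) Q(1,3,4,2)])
  then have Qa: "hall_in a Q K" using Q(4) by simp
  note q = hall_inD[OF Qa]
  have nQ: "normal_in Q X" by (rule normal_hall_in_characteristic[OF Qa Q(3) nK(1)])
  obtain E b where E: "normal_in E K" "E \<subset> K" "b \<in> S" "pi_number b (index K E)" "pi_number (- b) (card E)"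
    using dispersive_series_last_factor[OF dK K1] by blast
  note e = normal_inD[OF E(1)]
  have nE: "normal_in E X"
    by (rule normal_hall_characteristic[OF E(1,5) _ nK(1)]) (use E(4) in simp)
  have "b \<noteq> a"
  proof
    assume ba: "b = a"
    have XE: "pi_number a (index X E)"
      using index_trans[OF e(1) K(1,2) e(3) K(3)] E(4) a(2) ba by (simp add: pi_number_mult)
    show False
    proof (cases "E = {\<one>}")
      case True
      then show ?thesis using not_a E(4) ba by (simp add: index_triv)
    next
      case False
      have "E \<subseteq> X" "E \<noteq> X" using E(2) K(3) by auto
      then obtain Y s where Y: "s \<in> S" "Y \<noteq> {\<one>}" "normal_in Y E" "hall_in s Y E"
        using dispersive_normal_hall[OF proper[OF e(1)] False] by blast
      note y = hall_inD[OF Y(4)]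
      have "s = a" by (rule class_a[OF nE XE Y(1,3,4,2)])
      moreover have "pi_number (- a) (card Y)"
        using pi_number_dvd[OF E(5) card_dvd[OF y(1,2,3)]] ba by simp
      ultimately show ?thesis using y(4) pi_number_both card_1_iff[OF y(1)] Y(2) by blast
    qed
  qed
  have cQ: "pi_number (- b) (card Q)"
    by (rule pi_number_class_neq[OF E(3) a(1) \<open>b \<noteq> a\<close> q(4)])
  have QE: "Q \<subseteq> E"
    by (rule pi_subgroup_le_normal[OF E(1) _ q(1,3) cQ]) (use E(4) in simp)
  interpret minimal_nondispersive_series G S X n a b K E Q
  proof unfold_locales
    show "pi_number (- a) (index K Q)" by (rule q(5))
    show "E \<noteq> K" using E(2) by blast
    show "a \<noteq> b" using \<open>b \<noteq> a\<close> by blast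
  qed (use a E(3,4,5) nK nE nQ QE e(3) Q(2) q(4) in auto)
  show False by (rule contradiction)
qed

end

context classed_group
begin

text \<open>A dispersive series of a complement \<open>B\<close> of \<open>Y\<close>, multiplied by \<open>Y\<close>, continues the series \<open>{1} < Y\<close>.\<close>

lemma dispersive_of_normal_hall:
  assumes Y: "normal_in Y X" "hall_in s Y X" "s \<in> S" "Y \<noteq> {\<one>}"
    and proper: "\<And>B. subgroup B G \<Longrightarrow> B \<subseteq> X \<Longrightarrow> B \<noteq> X \<Longrightarrow> dispersive_series B B"
  shows "dispersive_series X X"
proof -
  note y = hall_inD[OF Y(2)]
  have cop: "coprime (card Y) (index X Y)" by (rule pi_number_coprime[OF y(4,5)])
  obtain B where B: "subgroup B G" "B \<subseteq> X" "card B = index X Y"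
    using Schur_Zassenhaus[OF finite_group_axioms Y(1) cop] by blast
  have "card B * card Y = card X" using B(3) card_index[OF y(1-3)] by simp
  then have BY: "B \<inter> Y = {\<one>}" "B <#> Y = X"
    using coprime_factorisation[OF B(1) y(1,2) B(2) y(3)] cop B(3) by (auto simp: coprime_commute)
  have "B \<noteq> X"
  proof
    assume "B = X"
    then have "Y = {\<one>}" using BY(1) y(3) by blast
    then show False using Y(4) by blast
  qed
  have card_mult: "card (M <#> Y) = card M * card Y" if "subgroup M G" "M \<subseteq> B" for M
  proof -
    have "M \<inter> Y = {\<one>}" using that BY(1) sg(3)[OF that(1)] sg(3)[OF y(1)] by blast
    then show ?thesis using card_set_mult[OF that(1) y(1)] by simp
  qed
  have "dispersive_series X (N <#> Y)" if "dispersive_series B N" for N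
    using that
  proof induction
    case dispersive_series_triv
    have "{\<one>} <#> Y = Y" using mem_carrier[OF y(1)] by (auto simp: set_mult_def)
    moreover have "dispersive_series X Y"
      by (rule dispersive_series.dispersive_series_step[OF dispersive_series.dispersive_series_triv[OF y(2)]
            Y(1) _ Y(3)])
         (use y sg(3)[OF y(1)] in \<open>auto simp: index_triv\<close>)
    ultimately show ?case by simp
  next
    case (dispersive_series_step N M t)
    note nn = normal_inD[OF dispersive_series_normal[OF dispersive_series_step(1)]]
    note m = normal_inD[OF dispersive_series_step(2)]
    have MX: "M \<subseteq> X" and NX: "N \<subseteq> X" using m(3) nn(3) B(2) by auto
    note my = subgroup_set_mult[OF m(1) MX Y(1)] and ny = subgroup_set_mult[OF nn(1) NX Y(1)]
    show ?case
    proof (cases "N = M")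
      case True
      then show ?thesis using dispersive_series_step.IH by simp
    next
      case False
      have cN: "card (N <#> Y) = card N * card Y" and cM: "card (M <#> Y) = card M * card Y"
        using card_mult nn m by auto
      have sub: "N <#> Y \<subseteq> M <#> Y" by (rule mono_set_mult) (use dispersive_series_step(3) in auto)
      have iMN: "index (M <#> Y) (N <#> Y) = index M N"
        using cN cM card_pos[OF y(1)] by (simp add: index_def)
      have "t \<noteq> s"
      proof
        assume "t = s"
        have "index M N dvd card B"
          using index_dvd_card[OF nn(1) m(1) dispersive_series_step(3)] card_dvd[OF m(1) B(1) m(3)] by (rule dvd_trans)
        then have "index M N = 1"
          using y(5) B(3) dispersive_series_step(5) \<open>t = s\<close> pi_number_dvd pi_number_both by metis
        then show False using index_eq_1[OF nn(1) m(1) dispersive_series_step(3)] False by simp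
      qed
      have "card M * card Y * index X (M <#> Y) = card M * card Y * index B M"
        using card_index[OF my(1) y(2) my(2)] card_index[OF m(1) B(1) m(3)] cM
          card_index[OF y(1-3)] B(3) by (metis mult.assoc mult.commute)
      then have iX: "index X (M <#> Y) = index B M" using card_pos[OF m(1)] card_pos[OF y(1)] by simp
      have nMY: "normal_in (M <#> Y) X"
      proof (rule normalizer_in_eqI[OF y(2) my(1,2) BY(2) B(2) y(3)])
        show "conj_by x (M <#> Y) = M <#> Y" if "x \<in> Y" for x
          by (rule normal_in_conj_by[OF normal_in_self[OF my(1)]]) (use that my(4) in blast)
        fix x assume x: "x \<in> B"
        have xc: "x \<in> carrier G" using x B(1) mem_carrier by blast
        have "conj_by x M = M" by (rule normal_in_conj_by[OF dispersive_series_step(2) x])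
        moreover have "conj_by x Y = Y" using normal_in_conj_by[OF Y(1)] x B(2) by blast
        ultimately show "conj_by x (M <#> Y) = M <#> Y"
          using conj_by_set_mult[OF xc subgroup.subset[OF m(1)] subgroup.subset[OF y(1)]] by simp
      qed
      have cY: "pi_number (- t) (card Y)"
        by (rule pi_number_class_neq[OF dispersive_series_step(4) Y(3) \<open>t \<noteq> s\<close> y(4)])
      show ?thesis
        by (rule dispersive_series.dispersive_series_step[OF dispersive_series_step.IH nMY sub dispersive_series_step(4)])
           (use iMN iX cN cY dispersive_series_step in \<open>auto simp: pi_number_mult\<close>)
    qed
  qed
  from this[OF proper[OF B(1,2) \<open>B \<noteq> X\<close>]] show ?thesis using BY(2) by simp
qed

text \<open>The hypothesis passes to a maximal subgroup with \<open>n - 1\<close> in place of \<open>n\<close>, since the index of a maximal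
  subgroup belongs to a single class. So in a minimal counterexample all proper subgroups are dispersive.\<close>

theorem dispersive_of_subnormal_chains:
  assumes "soluble_series X X" "n \<le> card (prime_classes (card X))"
    and "\<And>A. maximal_chain X (Suc n) A \<Longrightarrow> class_subnormal X A"
  shows "dispersive_series X X"
  using assms
proof (induction "card X" arbitrary: X n rule: less_induct)
  case less
  note soluble = less.prems(1)
  note x = normal_inD[OF soluble_series_normal[OF soluble]]
  show ?case
  proof (cases "X = {\<one>}")
    case True
    then show ?thesis using dispersive_series_triv[OF x(1)] by simp
  next
    case False
    have fin: "finite (prime_classes (card X))" by (rule finite_prime_classes[OF card_pos[OF x(1)]])
    \<comment> \<open>The case \<open>n = 0\<close> is subsumed under \<open>n = 1\<close>.\<close>
    obtain m where m: "Suc m \<le> card (prime_classes (card X))"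
      "\<And>A. maximal_chain X (Suc (Suc m)) A \<Longrightarrow> class_subnormal X A"
    proof (cases n)
      case 0
      obtain p where p: "prime p" "p dvd card X" using nontrivial_prime_divisor[OF x(1) False] by blast
      obtain s where "s \<in> S" "p \<in> s" using class_exists[OF p(1)] by blast
      then have "s \<in> prime_classes (card X)" using p by (auto simp: prime_classes_def)
      then have "Suc 0 \<le> card (prime_classes (card X))" using fin by (metis Suc_leI card_gt_0_iff empty_iff)
      moreover have "class_subnormal X A" if "maximal_chain X (Suc (Suc 0)) A" for A
        by (rule maximal_chains_subnormal_Suc[OF _ that]) (use less.prems(3) 0 in simp)
      ultimately show ?thesis using that by blast
    next
      case (Suc m)
      then show ?thesis using less.prems(2,3) that by blast
    qed
    have long: "class_subnormal X A" if "Suc m < k" "maximal_chain X k A" for k A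
      by (rule long_maximal_chains_subnormal[OF m(2) that])
    have proper: "dispersive_series Y Y" if Y: "subgroup Y G" "Y \<subseteq> X" "Y \<noteq> X" for Y
    proof -
      obtain M where M: "Y \<subseteq> M" "maximal_in M X" using maximal_exists[OF Y(1) x(1) Y(2,3)] by blast
      note mm = maximal_inD[OF M(2)]
      have lt: "card M < card X" using mm finite_subgroup[OF x(1)] by (metis psubsetI psubset_card_mono)
      obtain s where s: "s \<in> S" "pi_number s (index X M)" using soluble_maximal_index[OF soluble M(2)] by blast
      have "prime_classes (card X) \<subseteq> insert s (prime_classes (card M))"
        using card_index[OF mm(1-3)] prime_classes_pi_number[OF s] by (auto simp: prime_classes_mult)
      moreover have "finite (prime_classes (card M))" by (rule finite_prime_classes[OF card_pos[OF mm(1)]])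
      ultimately have "card (prime_classes (card X)) \<le> Suc (card (prime_classes (card M)))"
        using card_mono[of "insert s (prime_classes (card M))" "prime_classes (card X)"]
        by (simp add: card_insert_if split: if_splits)
      then have mle: "m \<le> card (prime_classes (card M))" using m(1) by simp
      have "class_subnormal M A" if A: "maximal_chain M (Suc m) A" for A
      proof -
        have "maximal_chain X (Suc m + 1) A" by (rule maximal_chain_trans[OF A maximal_chain_1[OF M(2)]])
        then have "class_subnormal X A" using m(2) by simp
        from class_subnormal_restrict[OF this mm(1,3)] show ?thesis
          using maximal_chainD(3)[OF A] by (simp add: Int_absorb2)
      qed
      then have "dispersive_series M M"
        by (rule less.hyps[OF lt soluble_series_subgroup[OF soluble mm(1,3)] mle])
      then show ?thesis by (rule dispersive_series_subgroup[OF _ Y(1) M(1)])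
    qed
    show ?thesis
    proof (rule ccontr)
      assume neg: "\<not> dispersive_series X X"
      interpret minimal_nondispersive G S X "Suc m"
      proof unfold_locales
        show "soluble_series X X" by (rule soluble)
        show "Suc m \<le> card (prime_classes (card X))" by (rule m(1))
        show "class_subnormal X A" if "Suc m < k" "maximal_chain X k A" for k A using long that by blast
        show "dispersive_series Y Y" if "subgroup Y G" "Y \<subseteq> X" "Y \<noteq> X" for Y using proper that by blast
        show "Q = {\<one>}" if "s \<in> S" "normal_in Q X" "hall_in s Q X" for s Q
          using dispersive_of_normal_hall[OF that(2,3,1) _ proper] neg by blast
      qed
      show False using trivial False by blast
    qed
  qed
qed

end

section \<open>The theorem in terms of quotient groups\<close>

context finite_group
begin

lemma order_quotient:
  assumes "normal_in N X"
  shows "order (G\<lparr>carrier := X\<rparr> Mod N) = index X N"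
proof -
  note n = normal_inD[OF assms]
  have g: "group (G\<lparr>carrier := X\<rparr>)" by (rule subgroup.subgroup_is_group[OF n(2) group_axioms])
  have "subgroup N (G\<lparr>carrier := X\<rparr>)" using n subgroup_in_iff by blast
  from group.lagrange[OF g this] have "card (rcosets\<^bsub>G\<lparr>carrier := X\<rparr>\<^esub> N) * card N = card X"
    by (simp add: order_def)
  then have "card (rcosets\<^bsub>G\<lparr>carrier := X\<rparr>\<^esub> N) * card N = index X N * card N"
    using card_index[OF n(1-3)] by (simp add: mult.commute)
  then show ?thesis using card_pos[OF n(1)] by (simp add: order_def FactGroup_def)
qed

lemma normal_core:
  assumes "subgroup A G" "subgroup X G" "A \<subseteq> X"
  shows "normal_in (normal_core A (G\<lparr>carrier := X\<rparr>)) X" "normal_core A (G\<lparr>carrier := X\<rparr>) \<subseteq> A"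
proof -
  let ?P = "\<lambda>N. normal_in N X \<and> N \<subseteq> A"
  let ?F = "{N. ?P N}"
  have "finite ?F"
    by (rule finite_subset[of _ "Pow X"]) (use finite_subgroup[OF assms(2)] assms(3) in auto)
  moreover have "{\<one>} \<in> ?F" using normal_in_triv[OF assms(2)] sg(3)[OF assms(1)] by simp
  ultimately have "\<exists>N\<in>?F. {\<one>} \<subseteq> N \<and> (\<forall>K\<in>?F. N \<subseteq> K \<longrightarrow> N = K)" by (rule finite_has_maximal2)
  then obtain N where N: "N \<in> ?F" "\<forall>K\<in>?F. N \<subseteq> K \<longrightarrow> N = K" by (elim bexE conjE)
  then have n: "normal_in N X" "N \<subseteq> A" by auto
  have "normal_core A (G\<lparr>carrier := X\<rparr>) = N"
    unfolding normal_core_def normal_in_iff[OF assms(2)]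
  proof (rule Greatest_equality)
    show "?P N" using n by simp
    fix M assume M: "?P M"
    have "normal_in (N <#> M) X" by (rule normal_in_set_mult[OF n(1) conjunct1[OF M]])
    moreover have "N <#> M \<subseteq> A" by (rule set_mult_subset[OF assms(1) n(2) conjunct2[OF M]])
    moreover have s: "N \<subseteq> N <#> M" "M \<subseteq> N <#> M"
      by (rule subset_set_mult[OF normal_inD(1)[OF n(1)] normal_inD(1)[OF conjunct1[OF M]]])+
    ultimately have "N = N <#> M" using N(2) by blast
    then show "M \<subseteq> N" using s by simp
  qed
  then show "normal_in (normal_core A (G\<lparr>carrier := X\<rparr>)) X" "normal_core A (G\<lparr>carrier := X\<rparr>) \<subseteq> A"
    using n by auto
qed

lemma maximal_chain_k_maximal:
  assumes "maximal_chain (carrier G) k A" "k \<ge> 1"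
  shows "k_maximal_subgroup k A G"
proof -
  have "\<exists>M. M 0 = carrier G \<and> M k = A \<and> (\<forall>i\<in>{1..k}. maximal_in (M i) (M (i - 1)))"
    using assms(1)
  proof induction
    case maximal_chain_0
    show ?case by (rule exI[of _ "\<lambda>_. carrier G"]) simp
  next
    case (maximal_chain_Suc A B k)
    then obtain M where M: "M 0 = carrier G" "M k = B" "\<forall>i\<in>{1..k}. maximal_in (M i) (M (i - 1))" by blast
    let ?M = "M(Suc k := A)"
    have "\<forall>i\<in>{1..Suc k}. maximal_in (?M i) (?M (i - 1))"
    proof
      fix i assume "i \<in> {1..Suc k}"
      then consider "i = Suc k" | "i \<in> {1..k}" by force
      then show "maximal_in (?M i) (?M (i - 1))"
        by cases (use M maximal_chain_Suc in auto)
    qed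
    then show ?case using M(1) by (intro exI[of _ ?M]) simp
  qed
  then obtain M where M: "M 0 = carrier G" "M k = A" "\<forall>i\<in>{1..k}. maximal_in (M i) (M (i - 1))" by blast
  have "maximal_subgroup Y (G\<lparr>carrier := Z\<rparr>)" if "maximal_in Y Z" for Y Z
    unfolding maximal_subgroup_def subgroup_in_iff[OF maximal_inD(2)[OF that]]
    using maximal_inD[OF that] by auto
  then show ?thesis using M assms(2) unfolding k_maximal_subgroup_def by blast
qed

end

context classed_group
begin

lemma sigma_primary_pi_number:
  assumes "group Y" "sigma_primary S Y" "order Y > 0"
  shows "\<exists>s\<in>S. pi_number s (order Y)"
  using assms(2) unfolding sigma_primary_def
proof
  assume "carrier Y = {\<one>\<^bsub>Y\<^esub>}"
  moreover obtain s where "s \<in> S" using class_exists[OF two_is_prime_nat] by blast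
  ultimately show ?thesis by (intro bexI[of _ s]) (simp_all add: order_def)
next
  assume "card (sigma_classes S Y) = 1"
  then obtain s where s: "sigma_classes S Y = {s}" by (auto simp: card_1_singleton_iff)
  then have "s \<in> S" by (auto simp: sigma_classes_def)
  moreover have "p \<in> s" if p: "prime p" "p dvd order Y" for p
  proof -
    obtain t where t: "t \<in> S" "p \<in> t" using class_exists[OF p(1)] by blast
    then have "t \<in> sigma_classes S Y" using p by (auto simp: sigma_classes_def prime_divisors_def)
    then show ?thesis using s t by simp
  qed
  ultimately show ?thesis using assms(3) by (auto simp: pi_number_def)
qed

lemma sigma_primary_quotient:
  assumes "normal_in N X" "sigma_primary S (G\<lparr>carrier := X\<rparr> Mod N)"
  shows "\<exists>s\<in>S. pi_number s (index X N)"
proof -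
  note n = normal_inD[OF assms(1)]
  have "group (G\<lparr>carrier := X\<rparr> Mod N)"
    by (rule normal.factorgroup_is_group) (simp add: normal_in_iff[OF n(2)] assms(1))
  from sigma_primary_pi_number[OF this assms(2)] show ?thesis
    using order_quotient[OF assms(1)] index_pos[OF n(1-3)] by simp
qed

text \<open>A maximal term of such series would otherwise be the bottom of a chief factor and could be replaced by
  the top.\<close>

lemma soluble_series_carrier:
  assumes "sigma_soluble S G"
  shows "soluble_series (carrier G) (carrier G)"
proof -
  let ?F = "{N. soluble_series (carrier G) N}"
  have sub: "N \<subseteq> carrier G" if "N \<in> ?F" for N
    using that normal_inD(3)[OF soluble_series_normal] by simp
  have "finite ?F" by (rule finite_subset[of _ "Pow (carrier G)"]) (use sub finite_carrier in auto)
  moreover have "{\<one>} \<in> ?F" using soluble_series_triv[OF subgroup_self] by simp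
  ultimately have "\<exists>N\<in>?F. {\<one>} \<subseteq> N \<and> (\<forall>K\<in>?F. N \<subseteq> K \<longrightarrow> N = K)" by (rule finite_has_maximal2)
  then obtain N where N: "N \<in> ?F" "\<forall>K\<in>?F. N \<subseteq> K \<longrightarrow> N = K" by (elim bexE conjE)
  have n: "normal_in N (carrier G)" using N(1) soluble_series_normal by simp
  have "N = carrier G"
  proof (rule ccontr)
    assume ne: "N \<noteq> carrier G"
    let ?H = "{H. normal_in H (carrier G) \<and> N \<subset> H}"
    have "finite ?H"
      by (rule finite_subset[of _ "Pow (carrier G)"]) (use finite_carrier in \<open>auto dest: normal_inD(3)\<close>)
    moreover have "carrier G \<in> ?H" using normal_in_self[OF subgroup_self] ne normal_inD(3)[OF n] by auto
    ultimately have "\<exists>H\<in>?H. H \<subseteq> carrier G \<and> (\<forall>K\<in>?H. K \<subseteq> H \<longrightarrow> H = K)" by (rule finite_has_minimal2)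
    then obtain H where H: "H \<in> ?H" "\<forall>K\<in>?H. K \<subseteq> H \<longrightarrow> H = K" by (elim bexE conjE)
    then have h: "normal_in H (carrier G)" "N \<subset> H" by auto
    have "chief_factor G H N"
      unfolding chief_factor_def normal_iff
    proof (intro conjI notI)
      assume "\<exists>K. normal_in K (carrier G) \<and> N \<subset> K \<and> K \<subset> H"
      then obtain K where "normal_in K (carrier G)" "N \<subset> K" "K \<subset> H" by (elim exE conjE)
      then show False using H(2) by auto
    qed (use h n in auto)
    then have "sigma_primary S (G\<lparr>carrier := H\<rparr> Mod N)" using assms by (auto simp: sigma_soluble_def)
    moreover have "normal_in N H"
      by (rule normal_in_between[OF n normal_inD(1)[OF h(1)] _ normal_inD(3)[OF h(1)]]) (use h(2) in blast)
    ultimately obtain s where "s \<in> S" "pi_number s (index H N)" using sigma_primary_quotient by blast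
    then have "soluble_series (carrier G) H"
      using soluble_series_step[of "carrier G" N H s] N(1) h by auto
    then show False using N(2) h(2) by auto
  qed
  then show ?thesis using N(1) by simp
qed

lemma class_subnormal_carrier:
  assumes "sigma_subnormal S A G"
  shows "class_subnormal (carrier G) A"
proof -
  obtain t :: nat and B where B: "B 0 = A" "B t = carrier G" "\<forall>i\<le>t. subgroup (B i) G"
    and step: "\<forall>i\<in>{1..t}. B (i - 1) \<subseteq> B i \<and> (B (i - 1) \<lhd> G\<lparr>carrier := B i\<rparr> \<or>
      sigma_primary S (G\<lparr>carrier := B i\<rparr> Mod normal_core (B (i - 1)) (G\<lparr>carrier := B i\<rparr>)))"
    using assms unfolding sigma_subnormal_def by (elim exE conjE)
  have "j \<le> t \<Longrightarrow> class_subnormal (carrier G) (B (t - j))" for j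
  proof (induction j)
    case 0
    then show ?case using B(2) class_subnormal_refl[OF subgroup_self] by simp
  next
    case (Suc j)
    let ?X = "B (t - j)" and ?A = "B (t - Suc j)"
    have IH: "class_subnormal (carrier G) ?X" using Suc by simp
    have X: "subgroup ?X G" and Y: "subgroup ?A G" using B(3) by auto
    have "t - j \<in> {1..t}" "t - j - 1 = t - Suc j" using Suc.prems by auto
    then have AX: "?A \<subseteq> ?X" and or: "?A \<lhd> G\<lparr>carrier := ?X\<rparr> \<or>
        sigma_primary S (G\<lparr>carrier := ?X\<rparr> Mod normal_core ?A (G\<lparr>carrier := ?X\<rparr>))"
      using step by metis+
    from or show ?case
    proof
      assume "?A \<lhd> G\<lparr>carrier := ?X\<rparr>"
      then show ?thesis using class_subnormal_normal[OF IH] normal_in_iff[OF X] by simp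
    next
      note c = normal_core[OF Y X AX]
      assume "sigma_primary S (G\<lparr>carrier := ?X\<rparr> Mod normal_core ?A (G\<lparr>carrier := ?X\<rparr>))"
      then obtain s where "s \<in> S" "pi_number s (index ?X (normal_core ?A (G\<lparr>carrier := ?X\<rparr>)))"
        using sigma_primary_quotient[OF c(1)] by blast
      then show ?thesis by (rule class_subnormal_primary[OF IH Y AX c])
    qed
  qed
  from this[of t] show ?thesis using B(1) by simp
qed

lemma sigma_classes_carrier: "sigma_classes S G = prime_classes (card (carrier G))"
  by (auto simp: sigma_classes_def prime_classes_def prime_divisors_def order_def)

lemma hall_subgroup_iff:
  assumes "subgroup H G"
  shows "hall_subgroup s H G \<longleftrightarrow> hall_in s H (carrier G)"
proof -
  have "card (rcosets H) * card H = index (carrier G) H * card H"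
    using lagrange[OF assms] card_index[OF assms subgroup_self subgroup.subset[OF assms]]
    by (simp add: order_def mult.commute)
  then have "card (rcosets H) = index (carrier G) H" using card_pos[OF assms] by simp
  then show ?thesis
    using assms subgroup.subset[OF assms] subgroup_self card_pos[OF assms]
      index_pos[OF assms subgroup_self subgroup.subset[OF assms]]
    by (auto simp: hall_subgroup_def hall_in_def pi_number_def)
qed

lemma dispersive_series_indexed:
  assumes "dispersive_series X M"
  shows "\<exists>(t::nat) N. N 1 = {\<one>} \<and> N (t + 1) = M \<and> (\<forall>i\<in>{1..t + 1}. normal_in (N i) X) \<and>
    (\<forall>i\<in>{1..t}. N i \<subset> N (i + 1) \<and> (\<exists>s\<in>S. pi_number s (index (N (i + 1)) (N i)) \<and>
      pi_number (- s) (card (N i)) \<and> pi_number (- s) (index X (N (i + 1)))))"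
  using assms
proof induction
  case dispersive_series_triv
  then show ?case
    using normal_in_triv by (intro exI[of _ 0] exI[of _ "\<lambda>_. {\<one>}"]) simp
next
  case (dispersive_series_step K M s)
  show ?case
  proof (cases "K = M")
    case True
    then show ?thesis using dispersive_series_step.IH by simp
  next
    case False
    obtain t :: nat and N where N: "N 1 = {\<one>}" "N (t + 1) = K" "\<forall>i\<in>{1..t + 1}. normal_in (N i) X"
      "\<forall>i\<in>{1..t}. N i \<subset> N (i + 1) \<and> (\<exists>s\<in>S. pi_number s (index (N (i + 1)) (N i)) \<and>
        pi_number (- s) (card (N i)) \<and> pi_number (- s) (index X (N (i + 1))))"
      using dispersive_series_step.IH by (elim exE conjE)
    let ?N = "N(t + 2 := M)"
    have "normal_in (?N i) X" if "i \<in> {1..t + 2}" for i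
      using that N(3) dispersive_series_step(2) by (cases "i = t + 2") auto
    moreover have "?N i \<subset> ?N (i + 1) \<and> (\<exists>s\<in>S. pi_number s (index (?N (i + 1)) (?N i)) \<and>
        pi_number (- s) (card (?N i)) \<and> pi_number (- s) (index X (?N (i + 1))))" if i: "i \<in> {1..t + 1}" for i
    proof (cases "i = t + 1")
      case True
      then have "?N i = K" "?N (i + 1) = M" using N(2) by auto
      moreover have "K \<subset> M" using False dispersive_series_step(3) by blast
      ultimately show ?thesis using dispersive_series_step(4-7) by metis
    next
      case False
      then have "i \<in> {1..t}" "?N i = N i" "?N (i + 1) = N (i + 1)" using i by auto
      then show ?thesis using N(4) by metis
    qed
    moreover have "?N 1 = {\<one>}" "?N (t + 2) = M" using N(1) by auto
    ultimately show ?thesis by (intro exI[of _ "t + 1"] exI[of _ ?N]) simp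
  qed
qed

text \<open>By the Schur-Zassenhaus theorem every factor of the series has a complement \<open>H i\<close> in the ambient group.
  As each class occurs for one factor only, these form a complete Hall set.\<close>

lemma sigma_dispersive_carrier:
  assumes "dispersive_series (carrier G) (carrier G)"
  shows "sigma_dispersive S G"
proof -
  let ?X = "carrier G"
  obtain t :: nat and N where N: "N 1 = {\<one>}" "N (t + 1) = ?X" "\<forall>i\<in>{1..t + 1}. normal_in (N i) ?X"
    and "\<forall>i\<in>{1..t}. N i \<subset> N (i + 1) \<and> (\<exists>s\<in>S. pi_number s (index (N (i + 1)) (N i)) \<and>
      pi_number (- s) (card (N i)) \<and> pi_number (- s) (index ?X (N (i + 1))))"
    using dispersive_series_indexed[OF assms] by (elim exE conjE)
  then have strict: "\<And>i. i \<in> {1..t} \<Longrightarrow> N i \<subset> N (i + 1)"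
    and "\<forall>i\<in>{1..t}. \<exists>s. s \<in> S \<and> pi_number s (index (N (i + 1)) (N i)) \<and>
      pi_number (- s) (card (N i)) \<and> pi_number (- s) (index ?X (N (i + 1)))"
    by (blast, blast)
  from bchoice[OF this(2)] obtain c where
    c: "\<And>i. i \<in> {1..t} \<Longrightarrow> c i \<in> S" "\<And>i. i \<in> {1..t} \<Longrightarrow> pi_number (c i) (index (N (i + 1)) (N i))"
      "\<And>i. i \<in> {1..t} \<Longrightarrow> pi_number (- c i) (card (N i))"
      "\<And>i. i \<in> {1..t} \<Longrightarrow> pi_number (- c i) (index ?X (N (i + 1)))" by blast
  have n: "normal_in (N i) ?X" if "i \<in> {1..t + 1}" for i using N(3) that by blast
  have sN: "subgroup (N i) G" "N i \<subseteq> ?X" if "i \<in> {1..t + 1}" for i using normal_inD[OF n[OF that]] by auto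
  have pair: "i \<in> {1..t + 1}" "i + 1 \<in> {1..t + 1}" if "i \<in> {1..t}" for i using that by auto
  have cop: "coprime (card (N i)) (index (N (i + 1)) (N i))" if i: "i \<in> {1..t}" for i
    using pi_number_coprime[OF c(2)[OF i] c(3)[OF i]] by (simp add: coprime_commute)
  have "\<forall>i\<in>{1..t}. \<exists>H. subgroup H G \<and> H \<subseteq> N (i + 1) \<and> card H = index (N (i + 1)) (N i)"
  proof
    fix i assume i: "i \<in> {1..t}"
    have "normal_in (N i) (N (i + 1))"
      by (rule normal_in_between[OF n[OF pair(1)[OF i]] sN(1)[OF pair(2)[OF i]] _ sN(2)[OF pair(2)[OF i]]])
         (use strict[OF i] in blast)
    from Schur_Zassenhaus[OF finite_group_axioms this cop[OF i]]
    show "\<exists>H. subgroup H G \<and> H \<subseteq> N (i + 1) \<and> card H = index (N (i + 1)) (N i)" .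
  qed
  from bchoice[OF this] obtain H where
    H: "\<And>i. i \<in> {1..t} \<Longrightarrow> subgroup (H i) G" "\<And>i. i \<in> {1..t} \<Longrightarrow> H i \<subseteq> N (i + 1)"
      "\<And>i. i \<in> {1..t} \<Longrightarrow> card (H i) = index (N (i + 1)) (N i)" by blast
  have idx: "card (N (i + 1)) = card (N i) * card (H i)" if i: "i \<in> {1..t}" for i
    using card_index[OF sN(1)[OF pair(1)[OF i]] sN(1)[OF pair(2)[OF i]]] strict[OF i] H(3)[OF i] by auto
  have prod: "N i <#> H i = N (i + 1)" if i: "i \<in> {1..t}" for i
  proof (rule coprime_factorisation(2)[OF sN(1)[OF pair(1)[OF i]] H(1)[OF i] sN(1)[OF pair(2)[OF i]] _ H(2)[OF i]])
    show "N i \<subseteq> N (i + 1)" using strict[OF i] by blast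
    show "coprime (card (N i)) (card (H i))" using cop[OF i] H(3)[OF i] by simp
    show "card (N i) * card (H i) = card (N (i + 1))" using idx[OF i] by simp
  qed
  have hall: "hall_in (c i) (H i) ?X" if i: "i \<in> {1..t}" for i
  proof -
    have s: "subgroup (N (i + 1)) G" by (rule sN(1)[OF pair(2)[OF i]])
    have "index (N (i + 1)) (H i) = card (N i)"
      using idx[OF i] card_pos[OF H(1)[OF i]] by (simp add: index_def)
    then have "pi_number (- c i) (index ?X (H i))"
      using index_trans[OF H(1)[OF i] s subgroup_self H(2)[OF i] sN(2)[OF pair(2)[OF i]]] c(3,4)[OF i]
      by (simp add: pi_number_mult)
    then show ?thesis
      using H[OF i] c(2)[OF i] subgroup.subset[OF H(1)[OF i]] subgroup_self by (simp add: hall_in_def)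
  qed
  have H1: "card (H i) \<noteq> 1" if i: "i \<in> {1..t}" for i
    using index_eq_1[OF sN(1)[OF pair(1)[OF i]] sN(1)[OF pair(2)[OF i]]] strict[OF i] H(3)[OF i] by auto
  have same_class: "s = c i" if "i \<in> {1..t}" "s \<in> S" "hall_in s (H i) ?X" for s i
  proof (rule ccontr)
    assume "s \<noteq> c i"
    then have "card (H i) = 1"
      using pi_number_both_disjoint[OF hall_inD(4)[OF that(3)] hall_inD(4)[OF hall[OF that(1)]]]
        class_disjoint[OF that(2) c(1)[OF that(1)]] by blast
    then show False using H1[OF that(1)] by blast
  qed
  have mono: "N i \<subseteq> N j" if "i \<in> {1..t + 1}" "j \<in> {1..t + 1}" "i \<le> j" for i j
    using that(3,2)
  proof (induction rule: dec_induct)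
    case (step m)
    have "m \<in> {1..t}" using step.hyps step.prems that(1) by auto
    then show ?case using strict[of m] step by auto
  qed simp
  have lt: False if ij: "i \<in> {1..t}" "j \<in> {1..t}" "i < j" "c i = c j" for i j
  proof -
    have "card (H i) dvd card (N j)"
      by (rule card_dvd[OF H(1)[OF ij(1)] sN(1)[OF pair(1)[OF ij(2)]]])
         (use H(2)[OF ij(1)] mono[OF pair(2)[OF ij(1)] pair(1)[OF ij(2)]] ij(3) in auto)
    then have "pi_number (- c i) (card (H i))" using c(3)[OF ij(2)] ij(4) pi_number_dvd by metis
    then show False using hall_inD(4)[OF hall[OF ij(1)]] pi_number_both H1[OF ij(1)] by blast
  qed
  have classes: "\<exists>i\<in>{1..t}. s = c i" if s: "s \<in> sigma_classes S G" for s
  proof -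
    obtain p where p: "s \<in> S" "p \<in> s" "prime p" "p dvd card ?X"
      using s by (auto simp: sigma_classes_carrier prime_classes_def)
    have "j \<le> t \<Longrightarrow> p dvd card (N (j + 1)) \<Longrightarrow> \<exists>i\<in>{1..t}. p dvd card (H i)" for j
    proof (induction j)
      case 0
      then show ?case using N(1) p(3) by simp
    next
      case (Suc j)
      have j: "Suc j \<in> {1..t}" using Suc.prems by auto
      have "p dvd card (N (Suc j)) \<or> p dvd card (H (Suc j))"
        using Suc.prems(2) idx[OF j] prime_dvd_mult_iff[OF p(3)] by simp
      then show ?case using Suc j by auto
    qed
    from this[of t] obtain i where i: "i \<in> {1..t}" "p dvd card (H i)" using N(2) p(4) by auto
    have "p \<in> c i" using hall_inD(4)[OF hall[OF i(1)]] i(2) p(3) by (auto simp: pi_number_def)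
    then show ?thesis using class_unique[OF p(1) c(1)[OF i(1)] p(2)] i(1) by blast
  qed
  have complete: "complete_hall_set S (H ` {1..t}) G"
    unfolding complete_hall_set_def
  proof (intro conjI ballI impI)
    fix K assume "K \<in> H ` {1..t}"
    then obtain i where i: "i \<in> {1..t}" "K = H i" by blast
    show "subgroup K G" using H(1) i by simp
    obtain p where p: "prime p" "p dvd card (H i)" using prime_factor_nat[OF H1[OF i(1)]] by blast
    have "p \<in> c i" using hall_inD(4)[OF hall[OF i(1)]] p by (auto simp: pi_number_def)
    moreover have "p dvd card ?X"
      using p(2) card_dvd[OF H(1)[OF i(1)] subgroup_self subgroup.subset[OF H(1)[OF i(1)]]] by (rule dvd_trans)
    ultimately have "c i \<in> sigma_classes S G"
      using c(1)[OF i(1)] p(1) by (auto simp: sigma_classes_carrier prime_classes_def)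
    then show "\<exists>s\<in>sigma_classes S G. hall_subgroup s K G"
      using hall[OF i(1)] hall_subgroup_iff[OF H(1)[OF i(1)]] i(2) by blast
  next
    fix s assume s: "s \<in> sigma_classes S G"
    then have sS: "s \<in> S" by (simp add: sigma_classes_def)
    obtain i where i: "i \<in> {1..t}" "s = c i" using classes[OF s] by blast
    show "\<exists>!K. K \<in> H ` {1..t} \<and> hall_subgroup s K G"
    proof (rule ex1I[of _ "H i"])
      show "H i \<in> H ` {1..t} \<and> hall_subgroup s (H i) G"
        using hall[OF i(1)] hall_subgroup_iff[OF H(1)[OF i(1)]] i by simp
      fix K assume K: "K \<in> H ` {1..t} \<and> hall_subgroup s K G"
      then obtain j where j: "j \<in> {1..t}" "K = H j" by blast
      then have "hall_in s (H j) ?X" using K hall_subgroup_iff[OF H(1)[OF j(1)]] by simp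
      then have "c i = c j" using same_class[OF j(1) sS] i(2) by simp
      then have "i = j" using lt[OF i(1) j(1)] lt[OF j(1) i(1)] by (metis linorder_neqE_nat)
      then show "K = H i" using j(2) by simp
    qed
  qed
  show ?thesis
    unfolding sigma_dispersive_def sigma_group_def normal_iff
    using complete N strict prod by (intro conjI exI[of _ "H ` {1..t}"] exI[of _ t] exI[of _ N] exI[of _ H]) auto
qed

end

theorem corollary1p4:
  fixes I :: "'i set" and \<sigma> :: "'i \<Rightarrow> nat set"
    and G :: "('a, 'b) monoid_scheme" and n :: nat
  assumes "partition_of_primes I \<sigma>"
    and "group G" and "finite (carrier G)"
    and "sigma_soluble (\<sigma> ` I) G"
    and "card (sigma_classes (\<sigma> ` I) G) \<ge> n"
    and "\<And>A. k_maximal_subgroup (n + 1) A G \<Longrightarrow> sigma_subnormal (\<sigma> ` I) A G"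
  shows "sigma_dispersive (\<sigma> ` I) G"
proof -
  have "\<exists>s\<in>\<sigma> ` I. p \<in> s" if "prime p" for p
    using assms(1) that by (auto simp: partition_of_primes_def)
  moreover have "s = t" if st: "s \<in> \<sigma> ` I" "t \<in> \<sigma> ` I" "p \<in> s" "p \<in> t" for s t p
  proof -
    obtain i j where ij: "i \<in> I" "j \<in> I" "s = \<sigma> i" "t = \<sigma> j" using st(1,2) by blast
    have "i = j"
    proof (rule ccontr)
      assume "i \<noteq> j"
      then have "\<sigma> i \<inter> \<sigma> j = {}"
        using assms(1) ij(1,2) by (simp add: partition_of_primes_def disjoint_family_on_def)
      then show False using st(3,4) ij(3,4) by blast
    qed
    then show ?thesis using ij(3,4) by simp
  qed
  ultimately interpret classed_group G "\<sigma> ` I"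
    using assms(2,3) by (simp add: classed_group_def classed_group_axioms_def finite_group_def finite_group_axioms_def)
  have "dispersive_series (carrier G) (carrier G)"
  proof (rule dispersive_of_subnormal_chains)
    show "soluble_series (carrier G) (carrier G)" by (rule soluble_series_carrier[OF assms(4)])
    show "n \<le> card (prime_classes (card (carrier G)))" using assms(5) by (simp add: sigma_classes_carrier)
    show "class_subnormal (carrier G) A" if "maximal_chain (carrier G) (Suc n) A" for A
      using maximal_chain_k_maximal[OF that] assms(6) class_subnormal_carrier by simp
  qed
  then show ?thesis by (rule sigma_dispersive_carrier)
qed

end
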